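(* Let $n\ge 1$, let $\Omega\subset\mathbb{R}^n$ be a bounded domain of class $C^{2+\nu}$ for some $\nu>0$, let $p>0$, and let $f:\overline\Omega\to[0,\infty)$ be a nonnegative Hölder continuous function with $f\not\equiv 0$. Let $u$ be the unique maximal classical solution, with maximal existence time $T$, of $$u_t=\Delta u+f(x)(1-u)^{-p}\ \ (x\in\Omega,\ t>0),\qquad u=0\ \ (x\in\partial\Omega,\ t>0),\qquad u(x,0)=0\ \ (x\in\Omega),$$ and assume $T<\infty$. Write $\delta(x)=\mathrm{dist}(x,\partial\Omega)$. Assume that either $$0<p<1,$$ or $$f(x)=o\bigl(\delta^{p+1}(x)\bigr)\quad\text{as }\delta(x)\to0 .$$ Then quenching does not occur near the boundary, i.e. the quenching set $\mathcal{Q}$ of $u$ satisfies $\mathcal{Q}\subset\Omega$.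
   Context: The problem has a unique classical solution $u$ (with $u<1$) on a short time interval, and it can be continued as long as $\max_{x\in\overline\Omega}u(x,t)<1$. $[0,T)$, $T\le\infty$, denotes its maximal existence interval. If $T<\infty$ then $\limsup_{t\to T^-}\max_{x\in\overline\Omega}u(x,t)=1$ (finite-time quenching). When $T<\infty$, a point $x_0\in\overline\Omega$ is called a quenching point if there is a sequence $(x_k,t_k)\in\overline\Omega\times(0,T)$ with $x_k\to x_0$, $t_k\uparrow T$ and $u(x_k,t_k)\to1$ as $k\to\infty$. The quenching set $\mathcal{Q}\subset\overline\Omega$ is the set of all quenching points. The condition $f(x)=o(\delta^{p+1}(x))$ as $\delta(x)\to0$ means that for every $\theta>0$ there is $\eta>0$ such that $f(x)\le\theta\,\delta(x)^{p+1}$ for all $x\in\Omega$ with $\delta(x)<\eta$. *)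

theory Defs
  imports "HOL-Analysis.Analysis"
begin

definition partial_deriv ::
    "'a::euclidean_space \<Rightarrow> ('a \<Rightarrow> real) \<Rightarrow> 'a \<Rightarrow> real" where
  "partial_deriv b g x = frechet_derivative g (at x) b"

definition laplacian :: "('a::euclidean_space \<Rightarrow> real) \<Rightarrow> 'a \<Rightarrow> real" where
  "laplacian g x = (\<Sum>b\<in>Basis. partial_deriv b (partial_deriv b g) x)"

definition holder_on :: "real \<Rightarrow> 'a::metric_space set \<Rightarrow> ('a \<Rightarrow> real) \<Rightarrow> bool" where
  "holder_on \<alpha> S g \<longleftrightarrow>
     (\<exists>C. \<forall>x\<in>S. \<forall>y\<in>S. \<bar>g x - g y\<bar> \<le> C * dist x y powr \<alpha>)"

definition C2_holder :: "real \<Rightarrow> ('a::euclidean_space \<Rightarrow> real) \<Rightarrow> bool" where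
  "C2_holder \<nu> g \<longleftrightarrow>
     (\<forall>x. g differentiable (at x)) \<and>
     (\<forall>b\<in>Basis. \<forall>x. partial_deriv b g differentiable (at x)) \<and>
     (\<forall>b\<in>Basis. \<forall>c\<in>Basis. holder_on \<nu> UNIV (partial_deriv c (partial_deriv b g)))"

text \<open>Bounded domains of class \<open>C\<^sup>2\<^sup>+\<^sup>\<nu>\<close>, for exponents \<open>0 < \<nu> \<le> 1\<close>: near every boundary point
  the domain is the strict epigraph, in the direction of some unit vector \<open>e\<close>, of a function of
  the component orthogonal to \<open>e\<close>. Only the values of \<open>\<gamma>\<close> on the hyperplane \<open>e\<^sup>\<bottom>\<close> matter; as
  usual \<open>\<gamma>\<close> is taken to be globally defined, which is no restriction because the graph condition
  is local and \<open>\<gamma>\<close> may be cut off and extended constantly along \<open>e\<close>. In dimension one \<open>e\<^sup>\<bottom>\<close> is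
  \<open>{0}\<close> and \<open>\<gamma>\<close> contributes just a constant.\<close>

definition bounded_C2_holder_domain :: "real \<Rightarrow> 'a::euclidean_space set \<Rightarrow> bool" where
  "bounded_C2_holder_domain \<nu> \<Omega> \<longleftrightarrow>
     open \<Omega> \<and> connected \<Omega> \<and> \<Omega> \<noteq> {} \<and> bounded \<Omega> \<and>
     (\<forall>x0\<in>frontier \<Omega>. \<exists>r>0. \<exists>e \<gamma>. norm e = 1 \<and> C2_holder \<nu> \<gamma> \<and>
        \<Omega> \<inter> ball x0 r = {x \<in> ball x0 r. \<gamma> (x - (x \<bullet> e) *\<^sub>R e) < x \<bullet> e})"

text \<open>Classical solutions on \<open>[0,T)\<close> are of class \<open>C\<^sup>2\<^sup>,\<^sup>1\<close> inside the cylinder and continuous up to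
  its parabolic boundary.\<close>

definition C21_on ::
    "('a::euclidean_space) set \<Rightarrow> ereal \<Rightarrow> ('a \<Rightarrow> real \<Rightarrow> real) \<Rightarrow> bool" where
  "C21_on \<Omega> T u \<longleftrightarrow> (let Q = \<Omega> \<times> {t. 0 < t \<and> ereal t < T} in
     (\<forall>(x,t)\<in>Q. (\<lambda>s. u x s) differentiable (at t)) \<and>
     (\<forall>(x,t)\<in>Q. (\<lambda>y. u y t) differentiable (at x)) \<and>
     (\<forall>b\<in>Basis. \<forall>(x,t)\<in>Q. partial_deriv b (\<lambda>y. u y t) differentiable (at x)) \<and>
     continuous_on Q (\<lambda>(x,t). deriv (\<lambda>s. u x s) t) \<and>
     (\<forall>b\<in>Basis. continuous_on Q (\<lambda>(x,t). partial_deriv b (\<lambda>y. u y t) x)) \<and>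
     (\<forall>b\<in>Basis. \<forall>c\<in>Basis. continuous_on Q
        (\<lambda>(x,t). partial_deriv c (partial_deriv b (\<lambda>y. u y t)) x)))"

definition classical_solution ::
    "('a::euclidean_space) set \<Rightarrow> ('a \<Rightarrow> real) \<Rightarrow> real \<Rightarrow> ereal \<Rightarrow> ('a \<Rightarrow> real \<Rightarrow> real) \<Rightarrow> bool"
  where
  "classical_solution \<Omega> f p T u \<longleftrightarrow>
     0 < T \<and>
     continuous_on (closure \<Omega> \<times> {t. 0 \<le> t \<and> ereal t < T}) (\<lambda>(x,t). u x t) \<and>
     C21_on \<Omega> T u \<and>
     (\<forall>x\<in>closure \<Omega>. \<forall>t. 0 \<le> t \<and> ereal t < T \<longrightarrow> u x t < 1) \<and>
     (\<forall>x\<in>\<Omega>. \<forall>t. 0 < t \<and> ereal t < T \<longrightarrow>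
        deriv (\<lambda>s. u x s) t = laplacian (\<lambda>y. u y t) x + f x * (1 - u x t) powr (- p)) \<and>
     (\<forall>x\<in>frontier \<Omega>. \<forall>t. 0 < t \<and> ereal t < T \<longrightarrow> u x t = 0) \<and>
     (\<forall>x\<in>\<Omega>. u x 0 = 0)"

definition maximal_classical_solution ::
    "('a::euclidean_space) set \<Rightarrow> ('a \<Rightarrow> real) \<Rightarrow> real \<Rightarrow> ereal \<Rightarrow> ('a \<Rightarrow> real \<Rightarrow> real) \<Rightarrow> bool"
  where
  "maximal_classical_solution \<Omega> f p T u \<longleftrightarrow>
     classical_solution \<Omega> f p T u \<and>
     \<not> (\<exists>T' v. T < T' \<and> classical_solution \<Omega> f p T' v \<and>
          (\<forall>x\<in>closure \<Omega>. \<forall>t. 0 \<le> t \<and> ereal t < T \<longrightarrow> v x t = u x t))"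

definition quenching_set ::
    "('a::euclidean_space) set \<Rightarrow> ereal \<Rightarrow> ('a \<Rightarrow> real \<Rightarrow> real) \<Rightarrow> 'a set" where
  "quenching_set \<Omega> T u = {x0 \<in> closure \<Omega>. \<exists>x t.
     (\<forall>k::nat. x k \<in> closure \<Omega> \<and> 0 < t k \<and> ereal (t k) < T) \<and>
     x \<longlonglongrightarrow> x0 \<and> incseq t \<and> (\<lambda>k. ereal (t k)) \<longlonglongrightarrow> T \<and>
     (\<lambda>k. u (x k) (t k)) \<longlonglongrightarrow> 1}"

end

theory Submission
  imports Defs
begin

text \<open>
  Let \<open>\<phi>\<close> be a nonnegative subsolution of the heat equation on a ball in \<open>\<Omega>\<close>, vanishing on its sphere.
  As the \<open>\<ell>\<^sup>q\<close>-norm with \<open>q = p + 1\<close> is convex and increasing, the norm \<open>W\<close> of the pair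
  \<open>(1 - u(x, t + h), \<phi>(x, t))\<close> is a subsolution of the equation \<open>Y\<^sub>t = \<Delta>Y - f Y powr (-p)\<close>
  satisfied by \<open>Y = 1 - u\<close>; the reaction terms match exactly. Comparison of \<open>W\<close> with \<open>1 - u(x, t)\<close>, where
  \<open>\<phi> powr q\<close> is of size \<open>h\<close>, and telescoping in time yield for every \<open>k > 1\<close> the bound
  \<open>1 - u \<ge> c \<delta> powr k (T - t) powr (1/q)\<close> near the boundary. Both alternatives of the hypothesis then give
  \<open>f (1 - u) powr (-p) \<le> C (\<delta> powr (\<mu> - 2) + (T - t) powr (-\<sigma>))\<close> with \<open>0 < \<mu>\<close> and \<open>\<sigma> < 1\<close>: the first term is
  absorbed by the barrier \<open>\<delta> powr \<mu>\<close>, the second is integrable in time. If \<open>p < 1\<close>, take \<open>k = 1/p\<close> and split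
  \<open>\<delta> powr (-1) (T - t) powr (-p/q)\<close> by Young's inequality; otherwise take \<open>k = 1 + 1/p\<close>.
\<close>

section \<open>A parabolic maximum principle\<close>

text \<open>In differential form the estimate reads u_t >= c \<phi>^q (1 - u)^(-p): the quantity (1
  - u)^q decreases in time at a rate of at least q c \<phi>^q. The usual proof applies a maximum
  principle to the difference of the two sides and so differentiates the equation in time, which
  asks for more derivatives than a classical solution has by definition. The norm inequality with a
  time shift h is the integrated form and needs u alone. The reaction terms match because the
  supporting functional of the norm at (V, \<phi>), with W the value of the norm, puts the weight
  (V/W)^p on V, and (V/W)^p V^(-p) = W^(-p); this fixes q = p + 1. The restriction k > 1 comes from
  \<phi>: the k-th power of the depth in a ball is a subsolution up to the sphere thanks to a
  gradient term with the factor k(k - 1). The exponents follow: k = 1/p is admissible exactly for p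
  < 1 and gives \<delta>^(-kp) = \<delta>^(-1), which leaves room below the critical power
  \<delta>^(-2), while k = 1 + 1/p gives \<delta>^(-p-1), which the decay of f cancels.\<close>

definition has_d2 :: "('a::euclidean_space \<Rightarrow> real) \<Rightarrow> 'a \<Rightarrow> 'a \<Rightarrow> real \<Rightarrow> bool" where
  "has_d2 g x b c \<longleftrightarrow> (\<exists>g'. (\<forall>\<^sub>F s in nhds 0. ((\<lambda>s. g (x + s *\<^sub>R b)) has_real_derivative g' s) (at s)) \<and>
     (g' has_real_derivative c) (at 0))"

text \<open>Second derivatives are taken along coordinate lines and as relations: sums, multiples
  and powers then combine by one-variable calculus, and a maximum on each line is all that the
  maximum principle uses.\<close>

definition has_lap :: "('a::euclidean_space \<Rightarrow> real) \<Rightarrow> 'a \<Rightarrow> real \<Rightarrow> bool" where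
  "has_lap g x L \<longleftrightarrow> (\<exists>c. (\<forall>b\<in>Basis. has_d2 g x b (c b)) \<and> L = sum c Basis)"

lemma isCont_eventually_less:
  fixes f :: "'a::t2_space \<Rightarrow> 'b::order_topology"
  assumes "isCont f x" "f x < a"
  shows "\<forall>\<^sub>F y in nhds x. f y < a"
  using assms order_tendstoD(2)[of f "f x" "at x" a] by (simp add: eventually_nhds_conv_at isCont_def)

lemma isCont_eventually_greater:
  fixes f :: "'a::t2_space \<Rightarrow> 'b::order_topology"
  assumes "isCont f x" "a < f x"
  shows "\<forall>\<^sub>F y in nhds x. a < f y"
  using assms order_tendstoD(1)[of f "f x" "at x" a] by (simp add: eventually_nhds_conv_at isCont_def)

lemma has_d2_add:
  assumes "has_d2 f x b c" "has_d2 g x b d"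
  shows "has_d2 (\<lambda>y. f y + g y) x b (c + d)"
proof -
  from assms obtain f' g' where
    f: "\<forall>\<^sub>F s in nhds 0. ((\<lambda>s. f (x + s *\<^sub>R b)) has_real_derivative f' s) (at s)" "(f' has_real_derivative c) (at 0)"
    and g: "\<forall>\<^sub>F s in nhds 0. ((\<lambda>s. g (x + s *\<^sub>R b)) has_real_derivative g' s) (at s)" "(g' has_real_derivative d) (at 0)"
    unfolding has_d2_def by blast
  have "\<forall>\<^sub>F s in nhds 0. ((\<lambda>s. f (x + s *\<^sub>R b) + g (x + s *\<^sub>R b)) has_real_derivative (f' s + g' s)) (at s)"
    using f(1) g(1) by eventually_elim (rule DERIV_add)
  moreover have "((\<lambda>s. f' s + g' s) has_real_derivative (c + d)) (at 0)"
    using f(2) g(2) by (rule DERIV_add)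
  ultimately show ?thesis unfolding has_d2_def by (intro exI[of _ "\<lambda>s. f' s + g' s"]) simp
qed

lemma has_d2_cmult:
  assumes "has_d2 f x b c"
  shows "has_d2 (\<lambda>y. a * f y) x b (a * c)"
proof -
  from assms obtain f' where
    f: "\<forall>\<^sub>F s in nhds 0. ((\<lambda>s. f (x + s *\<^sub>R b)) has_real_derivative f' s) (at s)" "(f' has_real_derivative c) (at 0)"
    unfolding has_d2_def by blast
  have "\<forall>\<^sub>F s in nhds 0. ((\<lambda>s. a * f (x + s *\<^sub>R b)) has_real_derivative (a * f' s)) (at s)"
    using f(1) by eventually_elim (rule DERIV_cmult)
  moreover have "((\<lambda>s. a * f' s) has_real_derivative (a * c)) (at 0)"
    using f(2) by (rule DERIV_cmult)
  ultimately show ?thesis unfolding has_d2_def by (intro exI[of _ "\<lambda>s. a * f' s"]) simp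
qed

lemma has_d2_const: "has_d2 (\<lambda>y. a) x b 0"
  unfolding has_d2_def by (rule exI[of _ "\<lambda>_. 0"]) auto

lemma has_lap_add: "has_lap f x c \<Longrightarrow> has_lap g x d \<Longrightarrow> has_lap (\<lambda>y. f y + g y) x (c + d)"
proof -
  assume "has_lap f x c" "has_lap g x d"
  then obtain a b where "\<forall>i\<in>Basis. has_d2 f x i (a i)" "c = sum a Basis"
     "\<forall>i\<in>Basis. has_d2 g x i (b i)" "d = sum b Basis"
    unfolding has_lap_def by blast
  then show ?thesis unfolding has_lap_def
    by (intro exI[of _ "\<lambda>i. a i + b i"]) (auto simp: sum.distrib intro: has_d2_add)
qed

lemma has_lap_cmult: "has_lap f x c \<Longrightarrow> has_lap (\<lambda>y. a * f y) x (a * c)"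
proof -
  assume "has_lap f x c"
  then obtain d where "\<forall>i\<in>Basis. has_d2 f x i (d i)" "c = sum d Basis"
    unfolding has_lap_def by blast
  then show ?thesis unfolding has_lap_def
    by (intro exI[of _ "\<lambda>i. a * d i"]) (auto simp: sum_distrib_left intro: has_d2_cmult)
qed

lemma has_lap_const: "has_lap (\<lambda>y. a) x 0"
  unfolding has_lap_def by (rule exI[of _ "\<lambda>_. 0"]) (auto intro: has_d2_const)

lemma has_lap_diff: "has_lap f x c \<Longrightarrow> has_lap g x d \<Longrightarrow> has_lap (\<lambda>y. f y - g y) x (c - d)"
  using has_lap_add[of f x c "\<lambda>y. (-1) * g y" "(-1) * d"] has_lap_cmult[of g x d "-1"] by simp

lemma eventually_nhds_line:
  assumes "\<forall>\<^sub>F y in nhds x. P y"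
  shows "\<forall>\<^sub>F s in nhds (0::real). P (x + s *\<^sub>R (b::'a::real_normed_vector))"
proof -
  have "((\<lambda>s. x + s *\<^sub>R b) \<longlongrightarrow> x + 0 *\<^sub>R b) (nhds 0)"
    by (intro tendsto_intros filterlim_ident)
  then have "filterlim (\<lambda>s. x + s *\<^sub>R b) (nhds x) (nhds 0)" by simp
  then show ?thesis using assms by (simp add: filterlim_iff)
qed

text \<open>With \<open>c > 0\<close> the first derivative, zero at the maximum, is positive just
  after it, so by the mean value theorem the function would exceed its maximum.\<close>

lemma has_d2_local_max:
  assumes "has_d2 g x b c" and max: "\<forall>\<^sub>F y in nhds x. g y \<le> g x"
  shows "c \<le> 0"
proof (rule ccontr)
  assume "\<not> c \<le> 0"
  then have c: "c > 0" by simp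
  from assms obtain g' where
    g: "\<forall>\<^sub>F s in nhds 0. ((\<lambda>s. g (x + s *\<^sub>R b)) has_real_derivative g' s) (at s)" "(g' has_real_derivative c) (at 0)"
    unfolding has_d2_def by blast
  define \<phi> where "\<phi> = (\<lambda>s. g (x + s *\<^sub>R b))"
  have "\<forall>\<^sub>F s in nhds 0. (\<phi> has_real_derivative g' s) (at s) \<and> \<phi> s \<le> \<phi> 0"
    using g(1) eventually_nhds_line[OF max, of b] unfolding \<phi>_def by eventually_elim auto
  then obtain e where e: "e > 0" "\<And>s. \<bar>s\<bar> < e \<Longrightarrow> (\<phi> has_real_derivative g' s) (at s) \<and> \<phi> s \<le> \<phi> 0"
    unfolding eventually_nhds_metric by (auto simp: dist_real_def)
  have g0: "g' 0 = 0"
    by (rule DERIV_local_max[of \<phi> _ 0 e]) (use e in auto)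
  obtain d where d: "d > 0" "\<And>s. 0 < s \<Longrightarrow> s < d \<Longrightarrow> g' s > g' 0"
    using DERIV_pos_inc_right[OF g(2) c] by auto
  define s where "s = min e d / 2"
  have s: "0 < s" "s < e" "s < d" using e(1) d(1) unfolding s_def by linarith+
  have "\<exists>y. 0 < y \<and> y < s \<and> \<phi> s - \<phi> 0 = (s - 0) * g' y"
    by (rule MVT2) (use s e in auto)
  then obtain y where y: "0 < y" "y < s" "\<phi> s - \<phi> 0 = s * g' y" by auto
  have "g' y > 0" using d(2)[of y] y s g0 by auto
  then have "s * g' y > 0" using s by simp
  then show False using y(3) e(2)[of s] s by auto
qed

lemma has_lap_local_max:
  assumes "has_lap g x L" and "\<forall>\<^sub>F y in nhds x. g y \<le> g x"
  shows "L \<le> 0"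
proof -
  from assms(1) obtain c where "\<forall>b\<in>Basis. has_d2 g x b (c b)" "L = sum c Basis"
    unfolding has_lap_def by blast
  then show ?thesis using has_d2_local_max[OF _ assms(2)] by (auto intro: sum_nonpos)
qed

text \<open>The subsolution inequality is only required of a function touching \<open>z\<close> from below, so that \<open>z\<close> may be a
  supremum of smooth functions.\<close>

lemma parabolic_max_principle:
  fixes z :: "'a::euclidean_space \<Rightarrow> real \<Rightarrow> real"
  assumes S: "compact S" and cont: "continuous_on (S \<times> {ta..tb}) (\<lambda>(x,t). z x t)"
    and touch: "\<And>x t. x \<in> S \<Longrightarrow> ta \<le> t \<Longrightarrow> t \<le> tb \<Longrightarrow> 0 < z x t \<Longrightarrow>
      \<exists>v d D. ta < t \<and> x \<in> interior S \<and> v x t = z x t \<and>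
        (\<forall>\<^sub>F y in nhds x. v y t \<le> z y t) \<and> (\<forall>\<^sub>F s in at_left t. v x s \<le> z x s) \<and>
        (v x has_real_derivative d) (at t) \<and> has_lap (\<lambda>y. v y t) x D \<and> d - D \<le> L * z x t"
    and "x \<in> S" "ta \<le> t" "t \<le> tb"
  shows "z x t \<le> 0"
proof (rule ccontr)
  assume "\<not> z x t \<le> 0"
  then have pos: "z x t > 0" by simp
  \<comment> \<open>At a positive maximum of \<open>E z\<close> the damped touching function has
    time derivative \<open>E (d - (L + 1) z)\<close>; \<open>d - D \<le> L z\<close> and
    \<open>D \<le> 0\<close> make it strictly negative. The extra 1 in the exponent gives the
    strictness.\<close>
  define E where "E = (\<lambda>s. exp (- (L + 1) * (s - ta)))"
  have Epos: "E s > 0" for s by (simp add: E_def)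
  define K where "K = S \<times> {ta..tb}"
  have "compact K" unfolding K_def by (intro compact_Times S compact_Icc)
  moreover have "K \<noteq> {}" using assms(4-6) unfolding K_def by auto
  moreover have "continuous_on K (\<lambda>(x,t). E t * z x t)"
    using cont unfolding K_def E_def case_prod_beta by (intro continuous_intros) auto
  ultimately obtain w where w: "w \<in> K" "\<forall>y\<in>K. (\<lambda>(x,t). E t * z x t) y \<le> (\<lambda>(x,t). E t * z x t) w"
    using continuous_attains_sup by meson
  obtain x1 t1 where w1: "w = (x1, t1)" by force
  have in1: "x1 \<in> S" "ta \<le> t1" "t1 \<le> tb" using w(1) w1 unfolding K_def by auto
  have max: "E s * z y s \<le> E t1 * z x1 t1" if "y \<in> S" "ta \<le> s" "s \<le> tb" for y s
    using w(2) that unfolding w1 K_def by auto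
  have "0 < E t * z x t" using pos Epos by simp
  then have "0 < E t1 * z x1 t1" using max[of x t] assms(4-6) by linarith
  then have z1: "z x1 t1 > 0" using Epos[of t1] by (simp add: zero_less_mult_iff)
  from touch[OF in1 z1] obtain v d D where v: "ta < t1" "x1 \<in> interior S" "v x1 t1 = z x1 t1"
    "\<forall>\<^sub>F y in nhds x1. v y t1 \<le> z y t1" "\<forall>\<^sub>F s in at_left t1. v x1 s \<le> z x1 s"
    "(v x1 has_real_derivative d) (at t1)" "has_lap (\<lambda>y. v y t1) x1 D" "d - D \<le> L * z x1 t1"
    by blast
  have "\<forall>\<^sub>F y in nhds x1. y \<in> interior S" using v(2) by (intro eventually_nhds_in_open) auto
  with v(4) have "\<forall>\<^sub>F y in nhds x1. v y t1 \<le> v x1 t1"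
  proof eventually_elim
    case (elim y)
    then have "y \<in> S" using interior_subset by auto
    from max[OF this, of t1] in1 have "z y t1 \<le> z x1 t1" using Epos[of t1] by simp
    then show ?case using elim v(3) by simp
  qed
  then have D: "D \<le> 0" by (rule has_lap_local_max[OF v(7)])
  have der: "((\<lambda>s. E s * v x1 s) has_real_derivative (E t1 * (d - (L + 1) * z x1 t1))) (at t1)"
    unfolding E_def by (rule derivative_eq_intros v(6) refl | simp add: v(3) algebra_simps)+
  \<comment> \<open>The maximum may sit at the final time \<open>tb\<close>, so it is compared with
    earlier times; this is why touching in time is phrased with \<open>at_left\<close>.\<close>
  have "E t1 * (d - (L + 1) * z x1 t1) \<ge> 0"
  proof (rule ccontr)
    assume "\<not> ?thesis"
    then obtain e where e: "e > 0" "\<And>h. 0 < h \<Longrightarrow> h < e \<Longrightarrow> E t1 * v x1 t1 < E (t1 - h) * v x1 (t1 - h)"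
      using DERIV_neg_dec_left[OF der] by (auto simp: not_le)
    have "\<forall>\<^sub>F s in at_left t1. s \<in> {max ta (t1 - e)<..<t1}"
      using e v(1) by (intro eventually_at_leftI[of "max ta (t1 - e)"]) auto
    with v(5) have "\<forall>\<^sub>F s in at_left t1. False"
    proof eventually_elim
      case (elim s)
      have "E t1 * v x1 t1 < E s * v x1 s" using e(2)[of "t1 - s"] elim by auto
      also have "\<dots> \<le> E s * z x1 s" using elim Epos[of s] by simp
      also have "\<dots> \<le> E t1 * z x1 t1" using max[of x1 s] in1 elim by auto
      finally show False using v(3) by simp
    qed
    then show False by (simp add: eventually_False)
  qed
  then have "d - (L + 1) * z x1 t1 \<ge> 0" using Epos[of t1] by (simp add: zero_le_mult_iff)
  with D v(8) z1 show False by (simp add: algebra_simps)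
qed

lemma parabolic_max_principle_smooth:
  fixes z :: "'a::euclidean_space \<Rightarrow> real \<Rightarrow> real"
  assumes "compact S" "continuous_on (S \<times> {ta..tb}) (\<lambda>(x,t). z x t)"
    and "\<And>x t. x \<in> S \<Longrightarrow> ta \<le> t \<Longrightarrow> t \<le> tb \<Longrightarrow> 0 < z x t \<Longrightarrow>
      ta < t \<and> x \<in> interior S \<and>
      (\<exists>d D. (z x has_real_derivative d) (at t) \<and> has_lap (\<lambda>y. z y t) x D \<and> d - D \<le> L * z x t)"
    and "x \<in> S" "ta \<le> t" "t \<le> tb"
  shows "z x t \<le> 0"
proof (rule parabolic_max_principle[OF assms(1,2) _ assms(4-6)])
  fix x t assume "x \<in> S" "ta \<le> t" "t \<le> tb" "0 < z x t"
  from assms(3)[OF this] obtain d D where "ta < t" "x \<in> interior S"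
    "(z x has_real_derivative d) (at t)" "has_lap (\<lambda>y. z y t) x D" "d - D \<le> L * z x t" by blast
  then show "\<exists>v d D. ta < t \<and> x \<in> interior S \<and> v x t = z x t \<and>
        (\<forall>\<^sub>F y in nhds x. v y t \<le> z y t) \<and> (\<forall>\<^sub>F s in at_left t. v x s \<le> z x s) \<and>
        (v x has_real_derivative d) (at t) \<and> has_lap (\<lambda>y. v y t) x D \<and> d - D \<le> L * z x t"
    by (intro exI[of _ z] exI[of _ d] exI[of _ D]) simp
qed

section \<open>Subsolutions of the heat equation on growing balls\<close>

text \<open>A power of the depth in the ball of squared radius \<open>A + B * (t - ta)\<close>,
  damped in time. With \<open>B > 0\<close> it carries positivity from a small ball to a larger one;
  with \<open>B = 0\<close> it is the weight \<phi> of the norm estimate.\<close>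

definition bump :: "real \<Rightarrow> real \<Rightarrow> real \<Rightarrow> real \<Rightarrow> real \<Rightarrow> 'a::euclidean_space \<Rightarrow> 'a \<Rightarrow> real \<Rightarrow> real" where
  "bump K k A B ta z x t =
     exp (- K * (t - ta)) * max 0 (A + B * (t - ta) - (norm (x - z))\<^sup>2) powr k"

lemma bump_nonneg: "0 \<le> bump K k A B ta z x t"
  by (simp add: bump_def)

lemma bump_pos_iff: "0 < bump K k A B ta z x t \<longleftrightarrow> (norm (x - z))\<^sup>2 < A + B * (t - ta)"
  by (auto simp: bump_def zero_less_mult_iff max_def)

lemma continuous_on_bump:
  "0 < k \<Longrightarrow> continuous_on S (\<lambda>(x,t). bump K k A B ta z x t)"
  unfolding bump_def case_prod_beta
  by (intro continuous_intros continuous_on_powr') auto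

lemma norm_sq_line: "(norm (x + s *\<^sub>R b - z))\<^sup>2 = (norm (x - z))\<^sup>2 + 2 * s * ((x - z) \<bullet> b) + s\<^sup>2 * (b \<bullet> b)"
  unfolding power2_norm_eq_inner by (simp add: inner_simps inner_commute algebra_simps power2_eq_square)

lemma has_d2_norm_sq:
  assumes "b \<in> Basis"
  shows "has_d2 (\<lambda>y. (norm (y - z))\<^sup>2) x b 2"
proof -
  have bb: "b \<bullet> b = 1" using assms by simp
  show ?thesis unfolding has_d2_def norm_sq_line bb
    by (rule exI[of _ "\<lambda>s. 2 * ((x - z) \<bullet> b) + 2 * s"])
       (auto intro!: always_eventually derivative_eq_intros)
qed

lemma has_lap_norm_sq: "has_lap (\<lambda>y. (norm (y - z))\<^sup>2) (x::'a::euclidean_space) (2 * real DIM('a))"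
  unfolding has_lap_def by (rule exI[of _ "\<lambda>_. 2"]) (auto intro: has_d2_norm_sq)

lemma has_d2_powr:
  assumes g: "\<forall>\<^sub>F s in nhds 0. ((\<lambda>s. g (x + s *\<^sub>R b)) has_real_derivative g' s) (at s)"
    "(g' has_real_derivative c) (at 0)" and pos: "0 < g x"
  shows "has_d2 (\<lambda>y. g y powr k) x b (k * (k - 1) * g x powr (k - 2) * (g' 0)\<^sup>2 + k * g x powr (k - 1) * c)"
proof -
  let ?g = "\<lambda>s. g (x + s *\<^sub>R b)"
  have g0: "(?g has_real_derivative g' 0) (at 0)" using g(1) eventually_nhds_x_imp_x by blast
  then have "isCont ?g 0" by (rule DERIV_isCont)
  then have "\<forall>\<^sub>F s in nhds 0. 0 < ?g s"
    using pos by (intro isCont_eventually_greater) auto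
  with g(1) have "\<forall>\<^sub>F s in nhds 0. ((\<lambda>s. ?g s powr k) has_real_derivative (k * ?g s powr (k - 1) * g' s)) (at s)"
    by eventually_elim (auto intro!: derivative_eq_intros simp: powr_diff)
  moreover have "((\<lambda>s. k * ?g s powr (k - 1) * g' s) has_real_derivative
      (k * (k - 1) * g x powr (k - 2) * (g' 0)\<^sup>2 + k * g x powr (k - 1) * c)) (at 0)"
  proof -
    have "((\<lambda>s. ?g s powr (k - 1)) has_real_derivative (k - 1) * g x powr (k - 1 - 1) * g' 0) (at 0)"
      using DERIV_fun_powr[OF g0, of "k - 1"] pos by simp
    from DERIV_mult[OF DERIV_cmult[OF this, of k] g(2)] show ?thesis
      by (rule DERIV_cong) (simp add: algebra_simps power2_eq_square)
  qed
  ultimately show ?thesis unfolding has_d2_def by (intro exI[of _ "\<lambda>s. k * ?g s powr (k - 1) * g' s"]) simp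
qed

lemma has_d2_cong:
  assumes "has_d2 g x b c" "\<forall>\<^sub>F y in nhds x. g y = h y"
  shows "has_d2 h x b c"
proof -
  from assms obtain g' where
    g: "\<forall>\<^sub>F s in nhds 0. ((\<lambda>s. g (x + s *\<^sub>R b)) has_real_derivative g' s) (at s)" "(g' has_real_derivative c) (at 0)"
    unfolding has_d2_def by blast
  have "\<forall>\<^sub>F s in nhds 0. \<forall>\<^sub>F r in nhds s. g (x + r *\<^sub>R b) = h (x + r *\<^sub>R b)"
    using eventually_nhds_line[OF assms(2), of b] by (simp only: eventually_eventually)
  with g(1) have "\<forall>\<^sub>F s in nhds 0. ((\<lambda>s. h (x + s *\<^sub>R b)) has_real_derivative g' s) (at s)"
  proof eventually_elim
    case (elim s)
    then show ?case
      using DERIV_cong_ev[of s s "\<lambda>s. g (x + s *\<^sub>R b)" "\<lambda>s. h (x + s *\<^sub>R b)" "g' s" "g' s"] by simp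
  qed
  with g(2) show ?thesis unfolding has_d2_def by blast
qed

lemma has_lap_cong:
  "has_lap g x c \<Longrightarrow> \<forall>\<^sub>F y in nhds x. g y = h y \<Longrightarrow> has_lap h x c"
  unfolding has_lap_def using has_d2_cong by blast

text \<open>Completing the square: the coefficient \<open>P\<^sup>2 / (4 * G)\<close> makes the
  discriminant vanish.\<close>

lemma quadratic_le_0:
  fixes D P G :: real
  assumes "G > 0"
  shows "- (P\<^sup>2 / (4 * G)) * D\<^sup>2 + P * D - G \<le> 0"
proof -
  have "- (P\<^sup>2 / (4 * G)) * D\<^sup>2 + P * D - G = - (P * D - 2 * G)\<^sup>2 / (4 * G)"
    using assms by (simp add: field_simps power2_eq_square)
  also have "\<dots> \<le> 0" using assms by (intro divide_nonpos_pos) auto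
  finally show ?thesis .
qed

text \<open>Near the sphere the gradient part of the Laplacian, with the factor
  \<open>k * (k - 1) > 0\<close>, dominates; further inside the damping \<open>K\<close> does.
  \<open>K\<close> is chosen before the centre and the starting time, as the uniform estimates
  require.\<close>

lemma bump_heat_subsolution:
  assumes k: "1 < k" and A: "0 < A" and B: "0 \<le> B"
  obtains K where "0 \<le> K" "\<And>(z::'a::euclidean_space) x ta t. ta \<le> t \<Longrightarrow> 0 < bump K k A B ta z x t \<Longrightarrow>
    \<exists>d L. (bump K k A B ta z x has_real_derivative d) (at t) \<and>
      has_lap (\<lambda>y. bump K k A B ta z y t) x L \<and> d \<le> L"
proof -
  define n where "n = real DIM('a)"
  \<comment> \<open>With \<open>D\<close> the base of the power, \<open>\<phi>\<^sub>t - \<Delta>\<phi>\<close> is at most a positive multiple of \<open>- K D\<^sup>2 + P D - G\<close>.\<close>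
  define P where "P = k * (B + 2 * n + 4 * (k - 1))"
  define G where "G = 4 * k * (k - 1) * A"
  have G: "G > 0" using k A by (simp add: G_def)
  define K where "K = P\<^sup>2 / (4 * G)"
  have K: "K \<ge> 0" using G by (simp add: K_def)
  have "\<exists>d L. (bump K k A B ta z x has_real_derivative d) (at t) \<and>
      has_lap (\<lambda>y. bump K k A B ta z y t) x L \<and> d \<le> L"
    if t: "ta \<le> t" and pos: "0 < bump K k A B ta z x t" for z x :: 'a and ta t
  proof -
    define D where "D = (\<lambda>y s. A + B * (s - ta) - (norm (y - z))\<^sup>2)"
    define e where "e = (\<lambda>s. exp (- K * (s - ta)))"
    have Dpos: "D x t > 0" using pos by (simp add: bump_pos_iff D_def)
    define \<phi> where "\<phi> = (\<lambda>y s. e s * D y s powr k)"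
    define d where "d = e t * D x t powr (k - 2) * (- K * (D x t)\<^sup>2 + k * B * D x t)"
    define L where "L = e t * D x t powr (k - 2) * (4 * k * (k - 1) * (norm (x - z))\<^sup>2 - 2 * n * k * D x t)"
    have bt: "bump K k A B ta z x s = \<phi> x s" if "0 < D x s" for x s
      using that by (simp add: bump_def \<phi>_def D_def e_def)
    have 1: "(\<phi> x has_real_derivative d) (at t)"
    proof -
      have de: "(e has_real_derivative (- K * e t)) (at t)"
        unfolding e_def by (auto intro!: derivative_eq_intros)
      have dD: "(D x has_real_derivative B) (at t)"
        unfolding D_def by (auto intro!: derivative_eq_intros)
      have "(\<phi> x has_real_derivative (- K * e t * D x t powr k + k * D x t powr (k - 1) * B * e t)) (at t)"
        unfolding \<phi>_def
        by (rule DERIV_mult[OF de DERIV_fun_powr[OF dD, of k, THEN DERIV_cong]]) (use Dpos in simp_all)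
      moreover have "D x t powr k = D x t powr (k - 2) * (D x t)\<^sup>2" "D x t powr (k - 1) = D x t powr (k - 2) * D x t"
        using Dpos by (simp_all add: powr_diff powr_numeral power2_eq_square)
      ultimately show ?thesis unfolding d_def by (simp add: algebra_simps)
    qed
    have "open {s. 0 < D x s}" unfolding D_def by (intro open_Collect_less continuous_intros)
    then have "\<forall>\<^sub>F s in nhds t. 0 < D x s"
      using Dpos eventually_nhds by (metis mem_Collect_eq)
    then have ev1: "\<forall>\<^sub>F s in nhds t. bump K k A B ta z x s = \<phi> x s"
      by eventually_elim (rule bt)
    have d1: "(bump K k A B ta z x has_real_derivative d) (at t)"
      using 1 DERIV_cong_ev[OF refl ev1 refl] by blast
    have "open {y. 0 < D y t}" unfolding D_def by (intro open_Collect_less continuous_intros)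
    then have "\<forall>\<^sub>F y in nhds x. 0 < D y t"
      using Dpos eventually_nhds by (metis mem_Collect_eq)
    then have ev2: "\<forall>\<^sub>F y in nhds x. \<phi> y t = bump K k A B ta z y t"
      by eventually_elim (simp add: bt)
    have D2: "has_d2 (\<lambda>y. D y t powr k) x b
       (k * (k - 1) * D x t powr (k - 2) * (- 2 * ((x - z) \<bullet> b))\<^sup>2 + k * D x t powr (k - 1) * (- 2))"
      if b: "b \<in> Basis" for b
    proof -
      have bb: "b \<bullet> b = 1" using b by simp
      have "has_d2 (\<lambda>y. D y t powr k) x b
         (k * (k - 1) * D x t powr (k - 2) * (- 2 * ((x - z) \<bullet> b) - 2 * 0)\<^sup>2 + k * D x t powr (k - 1) * (- 2))"
      proof (rule has_d2_powr[of "\<lambda>y. D y t" x b "\<lambda>s. - 2 * ((x - z) \<bullet> b) - 2 * s" "-2" k])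
        show "0 < D x t" by (rule Dpos)
        show "\<forall>\<^sub>F s in nhds 0. ((\<lambda>s. D (x + s *\<^sub>R b) t) has_real_derivative - 2 * ((x - z) \<bullet> b) - 2 * s) (at s)"
          unfolding D_def norm_sq_line bb
          by (auto intro!: always_eventually derivative_eq_intros)
        show "((\<lambda>s. - 2 * ((x - z) \<bullet> b) - 2 * s) has_real_derivative - 2) (at 0)"
          by (auto intro!: derivative_eq_intros)
      qed
      then show ?thesis by simp
    qed
    have "has_lap (\<lambda>y. D y t powr k) x (D x t powr (k - 2) * (4 * k * (k - 1) * (norm (x - z))\<^sup>2 - 2 * n * k * D x t))"
      unfolding has_lap_def
    proof (intro exI conjI ballI)
      show "has_d2 (\<lambda>y. D y t powr k) x b
         (k * (k - 1) * D x t powr (k - 2) * (- 2 * ((x - z) \<bullet> b))\<^sup>2 + k * D x t powr (k - 1) * (- 2))"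
        if "b \<in> Basis" for b by (rule D2[OF that])
      have "(norm (x - z))\<^sup>2 = (\<Sum>b\<in>Basis. ((x - z) \<bullet> b)\<^sup>2)"
        unfolding power2_norm_eq_inner by (subst euclidean_inner) (simp add: power2_eq_square)
      then have S: "(\<Sum>b\<in>Basis. (- 2 * ((x - z) \<bullet> b))\<^sup>2) = 4 * (norm (x - z))\<^sup>2"
        by (simp add: power_mult_distrib sum_distrib_left)
      have P1: "D x t powr (k - 1) = D x t powr (k - 2) * D x t"
        using Dpos by (simp add: powr_diff powr_numeral power2_eq_square)
      show "D x t powr (k - 2) * (4 * k * (k - 1) * (norm (x - z))\<^sup>2 - 2 * n * k * D x t) =
        (\<Sum>b\<in>Basis. k * (k - 1) * D x t powr (k - 2) * (- 2 * ((x - z) \<bullet> b))\<^sup>2 + k * D x t powr (k - 1) * (- 2))"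
        unfolding sum.distrib sum_distrib_left[symmetric] S P1 by (simp add: n_def algebra_simps)
    qed
    then have "has_lap (\<lambda>y. \<phi> y t) x L"
      unfolding \<phi>_def L_def using has_lap_cmult[of "\<lambda>y. D y t powr k"] by (auto simp: mult.assoc)
    then have d2: "has_lap (\<lambda>y. bump K k A B ta z y t) x L" using ev2 by (rule has_lap_cong)
    \<comment> \<open>Here \<open>(norm (x - z))\<^sup>2\<close> is replaced by
      \<open>A + B * (t - ta) - D x t\<close>, which leaves a constant term of at most
      \<open>- G\<close> because \<open>t \<ge> ta\<close>.\<close>
    have "d - L = e t * D x t powr (k - 2) * (- K * (D x t)\<^sup>2 + P * D x t - 4 * k * (k - 1) * (A + B * (t - ta)))"
      unfolding d_def L_def P_def D_def by (simp add: algebra_simps)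
    also have "\<dots> \<le> e t * D x t powr (k - 2) * (- K * (D x t)\<^sup>2 + P * D x t - G)"
      using k B t unfolding G_def e_def by (intro mult_left_mono) (auto intro!: mult_left_mono)
    also have "\<dots> \<le> 0"
      using quadratic_le_0[OF G, of P "D x t"] unfolding K_def e_def
      by (intro mult_nonneg_nonpos) auto
    finally show ?thesis using d1 d2 by auto
  qed
  with K that show ?thesis by blast
qed

section \<open>Two power inequalities\<close>

text \<open>The mean value theorem on \<open>[a, b]\<close>, the slope being steepest at the lower
  end \<open>m\<close>. It supplies the zero order coefficient of the maximum principle as long as
  \<open>u\<close> stays away from 1.\<close>

lemma powr_minus_diff_le:
  fixes a b m p :: real
  assumes "0 < m" "m \<le> a" "a \<le> b" "0 < p"
  shows "a powr (- p) - b powr (- p) \<le> p * m powr (- p - 1) * (b - a)"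
proof (cases "a = b")
  case False
  then have ab: "a < b" using assms by simp
  have "\<exists>y. a < y \<and> y < b \<and> b powr (- p) - a powr (- p) = (b - a) * (- p * y powr (- p - 1))"
    by (rule MVT2[OF ab], rule has_real_derivative_powr) (use assms in auto)
  then obtain y where y: "a < y" "y < b" "b powr (- p) - a powr (- p) = (b - a) * (- p * y powr (- p - 1))" by blast
  have "y powr (- p - 1) \<le> m powr (- p - 1)"
    using assms y by (intro powr_mono2') auto
  then have "(b - a) * p * y powr (- p - 1) \<le> (b - a) * p * m powr (- p - 1)"
    using assms ab by (intro mult_left_mono) auto
  then show ?thesis using y(3) by (simp add: algebra_simps)
qed simp

definition pair_norm :: "real \<Rightarrow> real \<Rightarrow> real \<Rightarrow> real" where
  "pair_norm p a b = (a powr (p + 1) + b powr (p + 1)) powr (1 / (p + 1))"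

lemma pair_norm_powr: "0 < p \<Longrightarrow> pair_norm p a b powr (p + 1) = a powr (p + 1) + b powr (p + 1)"
  by (simp add: pair_norm_def powr_powr)

lemma pair_norm_nonneg: "0 \<le> pair_norm p a b"
  by (simp add: pair_norm_def)

lemma pair_norm_0: "0 < p \<Longrightarrow> 0 \<le> a \<Longrightarrow> pair_norm p a 0 = a"
  by (simp add: pair_norm_def powr_powr)

lemma pair_norm_le_iff:
  assumes "0 < p" "0 \<le> c"
  shows "pair_norm p a b \<le> c \<longleftrightarrow> a powr (p + 1) + b powr (p + 1) \<le> c powr (p + 1)"
proof
  assume "pair_norm p a b \<le> c"
  from powr_mono2[OF _ pair_norm_nonneg this, of "p + 1"] assms
  show "a powr (p + 1) + b powr (p + 1) \<le> c powr (p + 1)" by (simp add: pair_norm_powr)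
next
  assume "a powr (p + 1) + b powr (p + 1) \<le> c powr (p + 1)"
  from powr_mono2[OF _ _ this, of "1 / (p + 1)"] assms
  show "pair_norm p a b \<le> c" by (simp add: pair_norm_def powr_powr)
qed

text \<open>Duality exhibits the norm as a maximum of linear functionals; hence no second derivatives of it are needed.\<close>

lemma pair_norm_dual:
  assumes p: "0 < p" and V: "0 < V" "0 < \<phi>" and W: "W = pair_norm p V \<phi>"
  shows "0 < W" "(V / W) powr p * V + (\<phi> / W) powr p * \<phi> = W"
    and "\<And>a b. 0 \<le> a \<Longrightarrow> 0 \<le> b \<Longrightarrow> (V / W) powr p * a + (\<phi> / W) powr p * b \<le> pair_norm p a b"
proof -
  show W0: "0 < W" using V by (simp add: W pair_norm_def add_pos_pos less_imp_neq[symmetric])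
  have "V powr (p + 1) + \<phi> powr (p + 1) = W powr (p + 1)" using p by (simp add: W pair_norm_powr)
  then have sum1: "(V / W) powr (p + 1) + (\<phi> / W) powr (p + 1) = 1"
    using W0 V by (simp add: powr_divide add_divide_distrib[symmetric])
  have "(V / W) powr p * (V / W) + (\<phi> / W) powr p * (\<phi> / W) = 1"
    using sum1 W0 V by (simp add: powr_add)
  then show "(V / W) powr p * V + (\<phi> / W) powr p * \<phi> = W"
    using W0 by (simp add: field_simps)
  fix a b :: real assume ab: "0 \<le> a" "0 \<le> b"
  show "(V / W) powr p * a + (\<phi> / W) powr p * b \<le> pair_norm p a b"
  proof (cases "pair_norm p a b = 0")
    case True
    then have "a powr (p + 1) + b powr (p + 1) = 0" using pair_norm_powr[OF p, of a b] by simp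
    then have "a powr (p + 1) = 0" "b powr (p + 1) = 0"
      using powr_ge_zero[of a "p + 1"] powr_ge_zero[of b "p + 1"] by linarith+
    then show ?thesis using True by simp
  next
    case False
    define W' where "W' = pair_norm p a b"
    have W': "0 < W'" using False pair_norm_nonneg[of p a b] unfolding W'_def by linarith
    \<comment> \<open>Hoelder's inequality for two terms: both pairs are scaled to norm 1, and
      Young's inequality is applied with the conjugate exponents \<open>p + 1\<close> and
      \<open>(p + 1) / p\<close>, the latter turning the power \<open>p\<close> into
      \<open>p + 1\<close>.\<close>
    have young: "(c / W) powr p * (d / W') \<le> (d / W') powr (p + 1) / (p + 1) + (c / W) powr (p + 1) * (p / (p + 1))"
      if "0 \<le> d" "0 < c" for c d
    proof -
      have e: "p * ((p + 1) / p) = p + 1" "1 / (p + 1) + 1 / ((p + 1) / p) = 1" "1 < (p + 1) / p"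
        using p by (auto simp: field_simps)
      have "(d / W') * (c / W) powr p \<le> (d / W') powr (p + 1) / (p + 1) + ((c / W) powr p) powr ((p + 1) / p) / ((p + 1) / p)"
        using p that W' by (intro Youngs_inequality e) auto
      then show ?thesis unfolding powr_powr e by (simp add: mult.commute)
    qed
    have "W' powr (p + 1) \<noteq> 0" using W' by simp
    then have "(a / W') powr (p + 1) + (b / W') powr (p + 1) = 1"
      using pair_norm_powr[OF p, of a b, folded W'_def] W' ab
      by (simp add: powr_divide add_divide_distrib[symmetric])
    then have "((a / W') powr (p + 1) + (b / W') powr (p + 1)) / (p + 1) +
       ((V / W) powr (p + 1) + (\<phi> / W) powr (p + 1)) * (p / (p + 1)) = 1"
      unfolding sum1 using p by (simp add: field_simps)
    moreover have "(V / W) powr p * (a / W') + (\<phi> / W) powr p * (b / W') \<le>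
       ((a / W') powr (p + 1) + (b / W') powr (p + 1)) / (p + 1) +
       ((V / W) powr (p + 1) + (\<phi> / W) powr (p + 1)) * (p / (p + 1))"
      using young[OF ab(1) V(1)] young[OF ab(2) V(2)] by (simp only: add_divide_distrib distrib_right)
    ultimately have "(V / W) powr p * (a / W') + (\<phi> / W) powr p * (b / W') \<le> 1" by simp
    then show ?thesis using W' unfolding W'_def[symmetric] by (simp add: field_simps)
  qed
qed

lemma continuous_on_pair_norm:
  assumes "0 < p" "continuous_on S a" "continuous_on S b" "\<And>x. x \<in> S \<Longrightarrow> 0 \<le> a x" "\<And>x. x \<in> S \<Longrightarrow> 0 \<le> b x"
  shows "continuous_on S (\<lambda>x. pair_norm p (a x) (b x))"
  unfolding pair_norm_def
  by (intro continuous_on_powr' continuous_on_add continuous_on_const assms(2,3))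
     (use assms in auto)

section \<open>Interior balls and defining functions at the boundary\<close>

text \<open>The definition speaks of coordinate derivatives; they are assembled into a gradient
  \<open>G\<close> with derivative \<open>G'\<close>. The global Hoelder estimate, compared with the
  value at 0, bounds the second derivatives on each ball.\<close>

lemma C2_holder_gradient:
  fixes \<gamma> :: "'a::euclidean_space \<Rightarrow> real"
  assumes \<gamma>: "C2_holder \<nu> \<gamma>" and \<nu>: "0 < \<nu>"
  obtains G G' where "\<And>x. (\<gamma> has_derivative (\<lambda>v. G x \<bullet> v)) (at x)"
    "\<And>x. (G has_derivative G' x) (at x)"
    "\<And>\<rho>. \<exists>M\<ge>0. \<forall>x v. norm x \<le> \<rho> \<longrightarrow> norm (G' x v) \<le> M * norm v"
proof -
  define G where "G = (\<lambda>x. \<Sum>b\<in>Basis. partial_deriv b \<gamma> x *\<^sub>R b)"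
  define G' where "G' = (\<lambda>x v. \<Sum>b\<in>Basis. frechet_derivative (partial_deriv b \<gamma>) (at x) v *\<^sub>R b)"
  have expand: "frechet_derivative g (at x) v = (\<Sum>b\<in>Basis. (v \<bullet> b) * partial_deriv b g x)"
    if "g differentiable (at x)" for g :: "'a \<Rightarrow> real" and x v
  proof -
    have "linear (frechet_derivative g (at x))" using that by (rule linear_frechet_derivative)
    then have "frechet_derivative g (at x) (\<Sum>b\<in>Basis. (v \<bullet> b) *\<^sub>R b) = (\<Sum>b\<in>Basis. (v \<bullet> b) * partial_deriv b g x)"
      by (simp add: linear_sum linear_scale partial_deriv_def)
    then show ?thesis by (simp add: euclidean_representation)
  qed
  have d1: "\<gamma> differentiable (at x)" for x using \<gamma> by (simp add: C2_holder_def)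
  have d2: "partial_deriv b \<gamma> differentiable (at x)" if "b \<in> Basis" for x b
    using \<gamma> that by (simp add: C2_holder_def)
  have "(\<gamma> has_derivative (\<lambda>v. G x \<bullet> v)) (at x)" for x
  proof -
    have "frechet_derivative \<gamma> (at x) = (\<lambda>v. G x \<bullet> v)"
      by (rule ext, simp add: expand[OF d1] G_def inner_sum_left) (simp add: inner_commute mult.commute)
    then show ?thesis using d1[of x] frechet_derivative_works by metis
  qed
  moreover have "(G has_derivative G' x) (at x)" for x
  proof -
    have "(partial_deriv b \<gamma> has_derivative frechet_derivative (partial_deriv b \<gamma>) (at x)) (at x)" if "b \<in> Basis" for b
      using d2[OF that] by (simp add: frechet_derivative_works)
    then show ?thesis unfolding G_def G'_def by (intro has_derivative_sum has_derivative_scaleR_left)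
  qed
  moreover have "\<exists>M\<ge>0. \<forall>x v. norm x \<le> \<rho> \<longrightarrow> norm (G' x v) \<le> M * norm v" for \<rho>
  proof -
    have "\<exists>B\<ge>0. \<forall>x. norm x \<le> \<rho> \<longrightarrow> \<bar>partial_deriv c (partial_deriv b \<gamma>) x\<bar> \<le> B" if "b \<in> Basis" "c \<in> Basis" for b c
    proof -
      let ?g = "partial_deriv c (partial_deriv b \<gamma>)"
      from \<gamma> that have "holder_on \<nu> UNIV ?g" by (simp add: C2_holder_def)
      then obtain C where C: "\<And>x y. \<bar>?g x - ?g y\<bar> \<le> C * dist x y powr \<nu>" by (auto simp: holder_on_def)
      have "\<bar>?g x\<bar> \<le> \<bar>?g 0\<bar> + \<bar>C\<bar> * \<bar>\<rho>\<bar> powr \<nu>" if "norm x \<le> \<rho>" for x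
      proof -
        have "C * dist x 0 powr \<nu> \<le> \<bar>C\<bar> * \<bar>\<rho>\<bar> powr \<nu>"
          using that \<nu> by (intro mult_mono powr_mono2) auto
        then show ?thesis using C[of x 0] by linarith
      qed
      then show ?thesis by (intro exI[of _ "\<bar>?g 0\<bar> + \<bar>C\<bar> * \<bar>\<rho>\<bar> powr \<nu>"]) auto
    qed
    then have "\<forall>b c. \<exists>B. b \<in> Basis \<longrightarrow> c \<in> Basis \<longrightarrow> 0 \<le> B \<and> (\<forall>x. norm x \<le> \<rho> \<longrightarrow> \<bar>partial_deriv c (partial_deriv b \<gamma>) x\<bar> \<le> B)"
      by blast
    then obtain B where B: "\<And>b c. b \<in> Basis \<Longrightarrow> c \<in> Basis \<Longrightarrow>
        0 \<le> B b c \<and> (\<forall>x. norm x \<le> \<rho> \<longrightarrow> \<bar>partial_deriv c (partial_deriv b \<gamma>) x\<bar> \<le> B b c)"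
      by metis
    have "norm (G' x v) \<le> (\<Sum>b\<in>Basis. \<Sum>c\<in>Basis. B b c) * norm v" if x: "norm x \<le> \<rho>" for x v
    proof -
      have "norm (G' x v) \<le> (\<Sum>b\<in>Basis. norm (frechet_derivative (partial_deriv b \<gamma>) (at x) v *\<^sub>R b))"
        unfolding G'_def by (rule norm_sum)
      also have "\<dots> \<le> (\<Sum>b\<in>Basis. \<Sum>c\<in>Basis. B b c * norm v)"
      proof (rule sum_mono)
        fix b :: 'a assume b: "b \<in> Basis"
        have "\<bar>\<Sum>c\<in>Basis. (v \<bullet> c) * partial_deriv c (partial_deriv b \<gamma>) x\<bar> \<le> (\<Sum>c\<in>Basis. \<bar>(v \<bullet> c) * partial_deriv c (partial_deriv b \<gamma>) x\<bar>)"
          by (rule sum_abs)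
        also have "\<dots> \<le> (\<Sum>c\<in>Basis. B b c * norm v)"
        proof (rule sum_mono)
          fix c :: 'a assume c: "c \<in> Basis"
          have "\<bar>v \<bullet> c\<bar> * \<bar>partial_deriv c (partial_deriv b \<gamma>) x\<bar> \<le> norm v * B b c"
            using B[OF b c] x c by (intro mult_mono) (auto simp: Basis_le_norm)
          then show "\<bar>(v \<bullet> c) * partial_deriv c (partial_deriv b \<gamma>) x\<bar> \<le> B b c * norm v"
            by (simp add: abs_mult mult.commute)
        qed
        finally show "norm (frechet_derivative (partial_deriv b \<gamma>) (at x) v *\<^sub>R b) \<le> (\<Sum>c\<in>Basis. B b c * norm v)"
          using b by (simp add: expand[OF d2[OF b]])
      qed
      finally show ?thesis by (simp add: sum_distrib_right)
    qed
    moreover have "0 \<le> (\<Sum>b\<in>(Basis::'a set). \<Sum>c\<in>Basis. B b c)" using B by (intro sum_nonneg) auto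
    ultimately show ?thesis by blast
  qed
  ultimately show ?thesis by (rule that)
qed

text \<open>The function is \<open>h x = x \<bullet> e - \<gamma> (P x)\<close>, the height over the
  graph measured along \<open>e\<close>, with \<open>P\<close> the projection onto the complement of
  \<open>e\<close>. It changes at unit rate along \<open>e\<close>, so its gradient never vanishes
  and its zero set is reached by shifts along \<open>e\<close>.\<close>

lemma local_defining_function:
  fixes \<Omega> :: "'a::euclidean_space set"
  assumes dom: "bounded_C2_holder_domain \<nu> \<Omega>" and \<nu>: "0 < \<nu>" and x0: "x0 \<in> frontier \<Omega>"
  obtains r M e h N H where "0 < r" "0 < M" "norm e = 1" "h x0 = 0"
    "\<And>x. x \<in> ball x0 r \<Longrightarrow> x \<in> \<Omega> \<longleftrightarrow> 0 < h x"
    "\<And>x. (h has_derivative (\<lambda>v. N x \<bullet> v)) (at x)" "\<And>x. (N has_derivative H x) (at x)"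
    "\<And>x v. x \<in> ball x0 r \<Longrightarrow> norm (H x v) \<le> M * norm v"
    "\<And>x. x \<in> ball x0 r \<Longrightarrow> norm (N x) \<le> M"
    "\<And>x. N x \<bullet> e = 1" "\<And>x s. h (x + s *\<^sub>R e) = h x + s"
proof -
  from dom x0 obtain r0 e \<gamma> where r0: "r0 > 0" and e: "norm e = 1" and \<gamma>: "C2_holder \<nu> \<gamma>"
    and eq: "\<Omega> \<inter> ball x0 r0 = {x \<in> ball x0 r0. \<gamma> (x - (x \<bullet> e) *\<^sub>R e) < x \<bullet> e}"
    unfolding bounded_C2_holder_domain_def by blast
  obtain G G' where G: "\<And>x. (\<gamma> has_derivative (\<lambda>v. G x \<bullet> v)) (at x)" "\<And>x. (G has_derivative G' x) (at x)"
    "\<And>\<rho>. \<exists>M\<ge>0. \<forall>x v. norm x \<le> \<rho> \<longrightarrow> norm (G' x v) \<le> M * norm v"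
    by (rule C2_holder_gradient[OF \<gamma> \<nu>]) blast
  define P where "P = (\<lambda>x::'a. x - (x \<bullet> e) *\<^sub>R e)"
  define h where "h = (\<lambda>x. x \<bullet> e - \<gamma> (P x))"
  define N where "N = (\<lambda>x. e - P (G (P x)))"
  define H where "H = (\<lambda>x v. - P (G' (P x) (P v)))"
  have ee: "e \<bullet> e = 1" using e by (simp add: norm_eq_1)
  have P': "(P has_derivative P) (at x)" for x
    unfolding P_def by (auto intro!: derivative_eq_intros)
  have nP: "norm (P x) \<le> 2 * norm x" for x
  proof -
    have "norm (P x) \<le> norm x + norm ((x \<bullet> e) *\<^sub>R e)" unfolding P_def by (rule norm_triangle_ineq4)
    also have "\<dots> \<le> norm x + norm x" using Cauchy_Schwarz_ineq2[of x e] e by simp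
    finally show ?thesis by simp
  qed
  have dh: "(h has_derivative (\<lambda>v. N x \<bullet> v)) (at x)" for x
  proof -
    have "((\<lambda>x. x \<bullet> e - \<gamma> (P x)) has_derivative (\<lambda>v. v \<bullet> e - G (P x) \<bullet> P v)) (at x)"
      by (intro has_derivative_diff has_derivative_compose[OF P' G(1)] has_derivative_inner_left has_derivative_ident)
    moreover have "v \<bullet> e - G (P x) \<bullet> P v = N x \<bullet> v" for v
      by (simp add: N_def P_def inner_simps inner_commute)
    ultimately show ?thesis by (simp add: h_def)
  qed
  have dN: "(N has_derivative H x) (at x)" for x
  proof -
    have "((\<lambda>x. e - P (G (P x))) has_derivative (\<lambda>v. 0 - P (G' (P x) (P v)))) (at x)"
      by (intro has_derivative_diff has_derivative_const has_derivative_compose[OF _ P']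
          has_derivative_compose[OF P' G(2)])
    then show ?thesis by (simp add: N_def H_def)
  qed
  have Ne: "N x \<bullet> e = 1" for x using ee by (simp add: N_def P_def inner_simps)
  have he: "h (x + s *\<^sub>R e) = h x + s" for x s
  proof -
    have "P (x + s *\<^sub>R e) = P x" using ee by (simp add: P_def inner_simps algebra_simps)
    then show ?thesis using ee by (simp add: h_def inner_simps)
  qed
  define r where "r = min r0 1"
  have r: "0 < r" "r \<le> r0" "r \<le> 1" using r0 by (auto simp: r_def)
  from G(3)[of "2 * (norm x0 + 1)"]
  obtain M0 where M0: "M0 \<ge> 0" "\<And>x v. norm x \<le> 2 * (norm x0 + 1) \<Longrightarrow> norm (G' x v) \<le> M0 * norm v"
    by auto
  have "continuous_on (cball x0 1) N" 
    by (intro continuous_at_imp_continuous_on ballI has_derivative_continuous[OF dN])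
  then have "bounded (N ` cball x0 1)" by (intro compact_imp_bounded compact_continuous_image) auto
  then obtain M1 where M1: "M1 > 0" "\<And>x. x \<in> cball x0 1 \<Longrightarrow> norm (N x) \<le> M1" by (auto simp: bounded_pos)
  have H: "norm (H x v) \<le> 4 * M0 * norm v" if "x \<in> ball x0 r" for x v
  proof -
    have "norm x \<le> norm x0 + 1"
      using that r norm_triangle_sub[of x x0] by (simp add: dist_norm norm_minus_commute)
    then have "2 * norm x \<le> 2 * (norm x0 + 1)" by simp
    with nP[of x] have "norm (P x) \<le> 2 * (norm x0 + 1)" by (rule order_trans)
    then have "norm (G' (P x) (P v)) \<le> M0 * norm (P v)" by (rule M0(2))
    also have "\<dots> \<le> M0 * (2 * norm v)" using nP[of v] M0(1) by (rule mult_left_mono)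
    finally show ?thesis using nP[of "G' (P x) (P v)"] by (simp add: H_def)
  qed
  have mem: "x \<in> \<Omega> \<longleftrightarrow> 0 < h x" if "x \<in> ball x0 r" for x
  proof -
    have "x \<in> ball x0 r0" using that r by auto
    then have "x \<in> \<Omega> \<longleftrightarrow> x \<in> \<Omega> \<inter> ball x0 r0" by simp
    also have "\<dots> \<longleftrightarrow> 0 < h x" unfolding eq using \<open>x \<in> ball x0 r0\<close> by (simp add: h_def P_def)
    finally show ?thesis .
  qed
  have "open \<Omega>" using dom by (simp add: bounded_C2_holder_domain_def)
  then have "x0 \<notin> \<Omega>" "x0 \<in> closure \<Omega>" using x0 by (auto simp: frontier_def interior_open)
  have h0: "h x0 = 0"
  proof (rule antisym)
    show "h x0 \<le> 0" using mem[of x0] r \<open>x0 \<notin> \<Omega>\<close> by simp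
    show "0 \<le> h x0"
    proof (rule ccontr)
      assume "\<not> 0 \<le> h x0"
      then have neg: "h x0 < 0" by simp
      have "isCont h x0" by (rule has_derivative_continuous[OF dh])
      then have "\<forall>\<^sub>F x in nhds x0. h x < 0"
        using neg by (rule isCont_eventually_less)
      then obtain d where d: "d > 0" "\<And>x. dist x x0 < d \<Longrightarrow> h x < 0" unfolding eventually_nhds_metric by blast
      have "0 < min d r" using d r by simp
      with \<open>x0 \<in> closure \<Omega>\<close> obtain y where y: "y \<in> \<Omega>" "dist y x0 < min d r"
        unfolding closure_approachable by blast
      then show False using d(2)[of y] mem[of y] by (simp add: dist_commute)
    qed
  qed
  have Mpos: "0 < 4 * M0 + M1" using M0 M1 by simp
  have HM: "norm (H x v) \<le> (4 * M0 + M1) * norm v" if "x \<in> ball x0 r" for x v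
  proof -
    have "4 * M0 * norm v \<le> (4 * M0 + M1) * norm v" using M1 by (intro mult_right_mono) auto
    then show ?thesis using H[OF that, of v] by linarith
  qed
  have NM: "norm (N x) \<le> 4 * M0 + M1" if "x \<in> ball x0 r" for x
    using M1(2)[of x] M0(1) that r by auto
  show ?thesis by (rule that[OF r(1) Mpos e h0 mem dh dN HM NM Ne he])
qed

text \<open>Taylor's formula with remainder constant \<open>M\<close> in place of
  \<open>M / 2\<close>: the mean value theorem on the segment leaves a difference of gradients, and
  the gradient is \<open>M\<close>-Lipschitz on \<open>S\<close>.\<close>

lemma quadratic_lower_bound:
  fixes h :: "'a::euclidean_space \<Rightarrow> real"
  assumes h: "\<And>x. (h has_derivative (\<lambda>v. N x \<bullet> v)) (at x)" and N: "\<And>x. (N has_derivative H x) (at x)"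
    and S: "convex S" and H: "\<And>x v. x \<in> S \<Longrightarrow> norm (H x v) \<le> M * norm v" and xy: "x \<in> S" "y \<in> S"
  shows "h y + N y \<bullet> (x - y) - M * (norm (x - y))\<^sup>2 \<le> h x"
proof -
  define w where "w = x - y"
  have "((\<lambda>s. h (y + s *\<^sub>R w)) has_real_derivative (N (y + s *\<^sub>R w) \<bullet> w)) (at s)" for s
  proof -
    have "((\<lambda>s. y + s *\<^sub>R w) has_derivative (\<lambda>r. r *\<^sub>R w)) (at s)"
      by (auto intro!: derivative_eq_intros)
    from has_derivative_compose[OF this h[of "y + s *\<^sub>R w"]]
    show ?thesis by (rule has_derivative_imp_has_field_derivative) simp
  qed
  then have "\<exists>s. 0 < s \<and> s < 1 \<and> h (y + 1 *\<^sub>R w) - h (y + 0 *\<^sub>R w) = (1 - 0) * (N (y + s *\<^sub>R w) \<bullet> w)"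
    by (intro MVT2) auto
  then obtain s where s: "0 < s" "s < 1" "h x - h y = N (y + s *\<^sub>R w) \<bullet> w" by (auto simp: w_def)
  have "y + s *\<^sub>R w = (1 - s) *\<^sub>R y + s *\<^sub>R x" by (simp add: w_def algebra_simps)
  then have inS: "y + s *\<^sub>R w \<in> S" using S xy s by (simp add: convexD)
  have "norm (N (y + s *\<^sub>R w) - N y) \<le> M * norm (y + s *\<^sub>R w - y)"
  proof (rule differentiable_bound[OF S _ _ inS xy(2)])
    show "(N has_derivative H x) (at x within S)" for x using N has_derivative_at_withinI by blast
    show "onorm (H x) \<le> M" if "x \<in> S" for x using H[OF that] by (rule onorm_le)
  qed
  also have "\<dots> \<le> M * norm w"
  proof -
    obtain b :: 'a where b: "b \<in> Basis" using nonempty_Basis by blast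
    have "norm (H x b) \<le> M" using H[OF xy(1), of b] b by simp
    then have "0 \<le> M" by (rule order_trans[OF norm_ge_zero])
    moreover have "norm (s *\<^sub>R w) \<le> norm w" using s by (simp add: mult_left_le_one_le)
    ultimately show ?thesis by (simp add: mult_left_mono)
  qed
  finally have 1: "norm (N (y + s *\<^sub>R w) - N y) \<le> M * norm w" .
  have "(N y - N (y + s *\<^sub>R w)) \<bullet> w \<le> norm (N y - N (y + s *\<^sub>R w)) * norm w" by (rule norm_cauchy_schwarz)
  also have "\<dots> \<le> M * norm w * norm w" using 1 by (intro mult_right_mono) (auto simp: norm_minus_commute)
  finally show ?thesis using s(3) by (simp add: w_def[symmetric] inner_diff_left power2_eq_square)
qed

text \<open>The point \<open>y\<close> is shifted along \<open>e\<close> to a foot \<open>yb\<close>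
  on the boundary, at distance exactly \<open>h y\<close>. The ball of radius \<open>R\<close>
  tangent at \<open>yb\<close>, centred along the gradient there, lies in the domain by the
  quadratic lower bound. It contains \<open>y\<close> even when \<open>y - yb\<close> is not normal,
  because \<open>N yb \<bullet> e = 1\<close> guarantees a definite normal component.\<close>

lemma C2_domain_boundary:
  fixes \<Omega> :: "'a::euclidean_space set"
  assumes dom: "bounded_C2_holder_domain \<nu> \<Omega>" and \<nu>: "0 < \<nu>" and x0: "x0 \<in> frontier \<Omega>"
  obtains r R M c h N H where "0 < r" "0 < R" "0 < M" "0 < c" "h x0 = 0"
    "\<And>x. x \<in> ball x0 r \<Longrightarrow> x \<in> \<Omega> \<longleftrightarrow> 0 < h x"
    "\<And>x. (h has_derivative (\<lambda>v. N x \<bullet> v)) (at x)" "\<And>x. (N has_derivative H x) (at x)"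
    "\<And>x v. x \<in> ball x0 r \<Longrightarrow> norm (H x v) \<le> M * norm v" "\<And>x. 1 \<le> norm (N x)"
    "\<And>y. y \<in> \<Omega> \<Longrightarrow> y \<in> ball x0 r \<Longrightarrow> infdist y (frontier \<Omega>) \<le> h y"
    "\<And>y. y \<in> \<Omega> \<Longrightarrow> y \<in> ball x0 r \<Longrightarrow>
      \<exists>z. ball z R \<subseteq> \<Omega> \<and> y \<in> ball z R \<and> c * h y \<le> R\<^sup>2 - (norm (y - z))\<^sup>2"
proof -
  obtain r0 M e h N H where r0: "0 < r0" and M: "0 < M" and e: "norm e = 1" and h0: "h x0 = 0"
    and mem: "\<And>x. x \<in> ball x0 r0 \<Longrightarrow> x \<in> \<Omega> \<longleftrightarrow> 0 < h x"
    and dh: "\<And>x. (h has_derivative (\<lambda>v. N x \<bullet> v)) (at x)" and dN: "\<And>x. (N has_derivative H x) (at x)"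
    and H: "\<And>x v. x \<in> ball x0 r0 \<Longrightarrow> norm (H x v) \<le> M * norm v"
    and NM: "\<And>x. x \<in> ball x0 r0 \<Longrightarrow> norm (N x) \<le> M"
    and Ne: "\<And>x. N x \<bullet> e = 1" and he: "\<And>x s. h (x + s *\<^sub>R e) = h x + s"
    by (rule local_defining_function[OF assms]) blast
  have op: "open \<Omega>" using dom by (simp add: bounded_C2_holder_domain_def)
  have N1: "1 \<le> norm (N x)" for x using norm_cauchy_schwarz[of "N x" e] e Ne[of x] by simp
  \<comment> \<open>\<open>1 / (2 * M)\<close> lets the ball curve away faster than the boundary
    can. \<open>r0 / 8\<close> keeps it in \<open>ball x0 r0\<close>: the foot will be within
    \<open>r0 / 2\<close> of \<open>x0\<close>, and the ball has diameter
    \<open>2 * R\<close>.\<close>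
  define R where "R = min (1 / (2 * M)) (r0 / 8)"
  have R: "0 < R" "R \<le> 1 / (2 * M)" "R \<le> r0 / 8" using M r0 by (auto simp: R_def)
  \<comment> \<open>The three bounds serve in turn: the foot stays within
    \<open>r + M * r \<le> r0 / 2\<close> of \<open>x0\<close>; the height satisfies
    \<open>d \<le> M * r \<le> R / M\<close>; and \<open>ball x0 r\<close> lies in
    \<open>ball x0 r0\<close>.\<close>
  define r where "r = min (r0 / (2 * (1 + M))) (min (R / M\<^sup>2) (r0 / 2))"
  have r: "0 < r" "r \<le> r0 / (2 * (1 + M))" "r \<le> R / M\<^sup>2" "r \<le> r0 / 2"
    unfolding r_def
  proof -
    show "0 < min (r0 / (2 * (1 + M))) (min (R / M\<^sup>2) (r0 / 2))" using M r0 R by simp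
  qed (rule min.cobounded1 order_trans[OF min.cobounded2 min.cobounded1] order_trans[OF min.cobounded2 min.cobounded2])+
  have rM: "r * (1 + M) \<le> r0 / 2" using r(2) M by (simp add: field_simps)
  have sub: "ball x0 r \<subseteq> ball x0 r0" using r r0 by auto
  have key: "infdist y (frontier \<Omega>) \<le> h y \<and>
      (\<exists>z. ball z R \<subseteq> \<Omega> \<and> y \<in> ball z R \<and> R / M * h y \<le> R\<^sup>2 - (norm (y - z))\<^sup>2)"
    if y: "y \<in> \<Omega>" "y \<in> ball x0 r" for y
  proof -
    define d where "d = h y"
    have d0: "0 < d" using mem[of y] y sub by (auto simp: d_def)
    have "norm (h y - h x0) \<le> M * norm (y - x0)"
    proof (rule differentiable_bound[of "ball x0 r0" h])
      show "(h has_derivative (\<lambda>v. N x \<bullet> v)) (at x within ball x0 r0)" for x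
        using dh has_derivative_at_withinI by blast
      show "onorm (\<lambda>v. N x \<bullet> v) \<le> M" if "x \<in> ball x0 r0" for x
      proof (rule onorm_le)
        fix v
        have "norm (N x \<bullet> v) \<le> norm (N x) * norm v" using Cauchy_Schwarz_ineq2[of "N x" v] by simp
        also have "\<dots> \<le> M * norm v" using NM[OF that] by (intro mult_right_mono) auto
        finally show "norm (N x \<bullet> v) \<le> M * norm v" .
      qed
    qed (use y sub r0 in auto)
    moreover have yr: "norm (y - x0) < r" using y(2) by (simp add: dist_norm norm_minus_commute)
    ultimately have dM: "d \<le> M * r" using h0 d0 mult_strict_left_mono[OF yr M] unfolding d_def real_norm_def by linarith
    define yb where "yb = y - d *\<^sub>R e"
    have hyb: "h yb = 0" using he[of y "- d"] by (simp add: yb_def d_def)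
    have "norm (yb - x0) \<le> norm (y - x0) + norm (d *\<^sub>R e)"
      unfolding yb_def using norm_triangle_ineq4[of "y - x0" "d *\<^sub>R e"] by (simp add: algebra_simps)
    also have "\<dots> < r + M * r" using yr dM d0 e by simp
    also have "\<dots> \<le> r0 / 2" using rM by (simp add: algebra_simps)
    finally have ybx: "norm (yb - x0) < r0 / 2" .
    then have ybin: "yb \<in> ball x0 r0" using r0 by (simp add: dist_norm norm_minus_commute)
    have "yb \<notin> \<Omega>" using mem[OF ybin] hyb by simp
    moreover have "yb \<in> closure \<Omega>"
      unfolding closure_approachable
    proof (intro allI impI)
      fix \<epsilon> :: real assume \<epsilon>: "0 < \<epsilon>"
      define s where "s = min \<epsilon> (r0 / 2) / 2"
      have s: "0 < s" "s < \<epsilon>" "s < r0 / 2" using \<epsilon> r0 by (auto simp: s_def min_def)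
      have "norm (yb + s *\<^sub>R e - x0) \<le> norm (yb - x0) + norm (s *\<^sub>R e)"
        using norm_triangle_ineq[of "yb - x0" "s *\<^sub>R e"] by (simp add: algebra_simps)
      then have "yb + s *\<^sub>R e \<in> ball x0 r0" using ybx s e by (simp add: dist_norm norm_minus_commute)
      then have "yb + s *\<^sub>R e \<in> \<Omega>" using mem he[of yb s] hyb s by simp
      moreover have "dist (yb + s *\<^sub>R e) yb < \<epsilon>" using s e by (simp add: dist_norm)
      ultimately show "\<exists>w\<in>\<Omega>. dist w yb < \<epsilon>" by blast
    qed
    ultimately have "yb \<in> frontier \<Omega>" using op by (simp add: frontier_def interior_open)
    then have "infdist y (frontier \<Omega>) \<le> dist y yb" by (rule infdist_le)
    also have "\<dots> = h y" using e d0 by (simp add: yb_def dist_norm d_def)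
    finally have 1: "infdist y (frontier \<Omega>) \<le> h y" .
    define n where "n = norm (N yb)"
    have n: "1 \<le> n" "n \<le> M" using N1 NM[OF ybin] by (auto simp: n_def)
    define z where "z = yb + (R / n) *\<^sub>R N yb"
    have nz: "norm ((R / n) *\<^sub>R N yb) = R" using n R by (simp add: n_def[symmetric])
    \<comment> \<open>Membership in the tangent ball becomes \<open>(norm (x - yb))\<^sup>2 < 2 * (R
      / n) * (N yb \<bullet> (x - yb))\<close>, the form to which the quadratic lower bound
      applies.\<close>
    have expand: "R\<^sup>2 - (norm (x - z))\<^sup>2 = 2 * (R / n) * (N yb \<bullet> (x - yb)) - (norm (x - yb))\<^sup>2" for x
    proof -
      have "x - z = (x - yb) - (R / n) *\<^sub>R N yb" by (simp add: z_def)
      moreover have "(norm (a - b))\<^sup>2 = (norm a)\<^sup>2 - 2 * (b \<bullet> a) + (norm b)\<^sup>2" for a b :: 'a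
        unfolding power2_norm_eq_inner by (simp add: inner_diff_left inner_diff_right inner_commute)
      ultimately have "(norm (x - z))\<^sup>2 = (norm (x - yb))\<^sup>2 - 2 * (((R / n) *\<^sub>R N yb) \<bullet> (x - yb)) + (norm ((R / n) *\<^sub>R N yb))\<^sup>2"
        by metis
      then show ?thesis unfolding nz by simp
    qed
    have "ball z R \<subseteq> \<Omega>"
    proof
      fix x assume x: "x \<in> ball z R"
      have xz: "norm (x - z) < R" using x by (simp add: dist_norm norm_minus_commute)
      have "norm (z - yb) = R" using nz by (simp add: z_def)
      then have "norm (x - yb) < 2 * R" using xz norm_triangle_ineq[of "x - z" "z - yb"] by simp
      then have "norm (x - x0) < r0"
        using ybx R norm_triangle_ineq[of "x - yb" "yb - x0"] by simp
      then have xin: "x \<in> ball x0 r0" by (simp add: dist_norm norm_minus_commute)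
      have "(norm (x - z))\<^sup>2 < R\<^sup>2" using xz by (intro power_strict_mono) auto
      then have less: "(norm (x - yb))\<^sup>2 < 2 * (R / n) * (N yb \<bullet> (x - yb))" using expand[of x] by linarith
      have "M * (norm (x - yb))\<^sup>2 < N yb \<bullet> (x - yb)"
      proof -
        have pos: "0 < N yb \<bullet> (x - yb)"
        proof (rule ccontr)
          assume "\<not> 0 < N yb \<bullet> (x - yb)"
          then have "2 * (R / n) * (N yb \<bullet> (x - yb)) \<le> 0" using R n by (intro mult_nonneg_nonpos) auto
          then show False using less zero_le_power2[of "norm (x - yb)"] by linarith
        qed
        have "M * (norm (x - yb))\<^sup>2 < M * (2 * (R / n) * (N yb \<bullet> (x - yb)))"
          using less M by (rule mult_strict_left_mono)
        also have "\<dots> = (2 * M * R / n) * (N yb \<bullet> (x - yb))" by simp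
        also have "\<dots> \<le> 1 * (N yb \<bullet> (x - yb))"
        proof (rule mult_right_mono)
          have "2 * M * R \<le> 1" using R(2) M by (simp add: field_simps)
          then show "2 * M * R / n \<le> 1" using n by (simp add: divide_le_eq)
        qed (use pos in simp)
        finally show ?thesis by simp
      qed
      moreover have "h yb + N yb \<bullet> (x - yb) - M * (norm (x - yb))\<^sup>2 \<le> h x"
        by (rule quadratic_lower_bound[OF dh dN convex_ball H xin ybin])
      ultimately have "0 < h x" using hyb by linarith
      then show "x \<in> \<Omega>" using mem[OF xin] by simp
    qed
    moreover have low: "R / M * h y \<le> R\<^sup>2 - (norm (y - z))\<^sup>2"
    proof -
      have "y - yb = d *\<^sub>R e" by (simp add: yb_def)
      then have val: "R\<^sup>2 - (norm (y - z))\<^sup>2 = 2 * (R / n) * d - d\<^sup>2"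
        using expand[of y] Ne[of yb] e d0 by simp
      \<comment> \<open>Half of \<open>2 * (R / n) * d\<close> pays for \<open>d\<^sup>2\<close>
        once \<open>d \<le> R / M \<le> R / n\<close>.\<close>
      have dR: "d \<le> R / M"
      proof -
        have "M * r \<le> M * (R / M\<^sup>2)" using r(3) M by (intro mult_left_mono) auto
        also have "\<dots> = R / M" using M by (simp add: power2_eq_square)
        finally show ?thesis using dM by simp
      qed
      have Rn: "R / M \<le> R / n" using n R by (intro divide_left_mono) auto
      have "d * d \<le> R / n * d" by (rule mult_right_mono) (use dR Rn d0 in linarith)+
      moreover have "R / M * d \<le> R / n * d" by (rule mult_right_mono[OF Rn]) (use d0 in simp)
      ultimately have "R / M * d \<le> 2 * (R / n * d) - d * d" by linarith
      then show ?thesis unfolding val by (simp add: d_def power2_eq_square mult.assoc)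
    qed
    moreover have "y \<in> ball z R"
    proof -
      have "0 < R / M * h y" using d0 R M by (simp add: d_def)
      with low have "(norm (y - z))\<^sup>2 < R\<^sup>2" by linarith
      then have "norm (y - z) < R" using R power2_less_imp_less[of "norm (y - z)" R] by simp
      then show ?thesis by (simp add: dist_norm norm_minus_commute)
    qed
    ultimately show ?thesis using 1 by blast
  qed
  show ?thesis
  proof (rule that[of r R M "R / M" h N H])
    show "0 < R / M" using R M by simp
    show "x \<in> \<Omega> \<longleftrightarrow> 0 < h x" if "x \<in> ball x0 r" for x using mem sub that by blast
    show "norm (H x v) \<le> M * norm v" if "x \<in> ball x0 r" for x v using H sub that by blast
  qed (use r R M h0 dh dN N1 key in blast)+
qed

section \<open>Monotonicity and growth of the solution\<close>

text \<open>The finite existence time is a real number here. Boundary regularity enters the lemmas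
  below only through balls \<open>ball z R\<close> inside the domain and a defining function
  \<open>h\<close>, both passed as premises.\<close>

locale quenching_solution =
  fixes \<Omega> :: "'a::euclidean_space set" and f :: "'a \<Rightarrow> real" and p T :: real
    and u :: "'a \<Rightarrow> real \<Rightarrow> real"
  assumes open_dom: "open \<Omega>" and connected_dom: "connected \<Omega>" and bounded_dom: "bounded \<Omega>"
    and p_pos: "0 < p" and f_cont: "continuous_on (closure \<Omega>) f"
    and f_nonneg: "\<And>x. x \<in> closure \<Omega> \<Longrightarrow> 0 \<le> f x"
    and sol: "classical_solution \<Omega> f p (ereal T) u"
begin

section \<open>Elementary properties of the solution\<close>

lemma T_pos: "0 < T"
  using sol by (simp add: classical_solution_def)

lemma compact_closure_dom: "compact (closure \<Omega>)"
  using bounded_dom by (simp add: compact_closure)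

lemma dom_subset: "x \<in> \<Omega> \<Longrightarrow> x \<in> closure \<Omega>"
  using closure_subset by auto

lemma closure_cases: "x \<in> closure \<Omega> \<Longrightarrow> x \<in> \<Omega> \<or> x \<in> frontier \<Omega>"
  using open_dom by (simp add: frontier_def interior_open)

lemma u_cont: "continuous_on (closure \<Omega> \<times> {0..<T}) (\<lambda>(x,t). u x t)"
proof -
  have "{t. 0 \<le> t \<and> ereal t < ereal T} = {0..<T}" by auto
  then show ?thesis using sol by (simp add: classical_solution_def)
qed

lemma u_cont_shift:
  assumes "S \<subseteq> closure \<Omega>" "0 \<le> a" "0 \<le> h" "b + h < T" "0 \<le> a + h"
  shows "continuous_on (S \<times> {a..b}) (\<lambda>(x,t). u x (t + h))"
proof -
  have "continuous_on (S \<times> {a..b}) (\<lambda>w. (\<lambda>(x,t). u x t) (fst w, snd w + h))"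
    by (rule continuous_on_compose2[OF u_cont]) (use assms in \<open>auto intro!: continuous_intros\<close>)
  then show ?thesis by (simp add: case_prod_beta)
qed

lemma u_lt_1: "x \<in> closure \<Omega> \<Longrightarrow> 0 \<le> t \<Longrightarrow> t < T \<Longrightarrow> u x t < 1"
  using sol by (simp add: classical_solution_def)

text \<open>The boundary values are prescribed for positive times; at time 0 the value is the limit
  from the right, by continuity on the closed cylinder.\<close>

lemma u_frontier:
  assumes "x \<in> frontier \<Omega>" "0 \<le> t" "t < T"
  shows "u x t = 0"
proof (cases "t = 0")
  case False
  then show ?thesis using sol assms by (simp add: classical_solution_def)
next
  case True
  have x: "x \<in> closure \<Omega>" using assms(1) by (simp add: frontier_def)
  have "continuous_on {0..T/2} (\<lambda>s. (\<lambda>(x,t). u x t) (x, s))"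
    by (rule continuous_on_compose2[OF u_cont]) (use x T_pos in \<open>auto intro!: continuous_intros\<close>)
  then have "((\<lambda>s. u x s) \<longlongrightarrow> u x 0) (at 0 within {0..T/2})"
    using T_pos by (auto simp: continuous_on_def)
  then have lim: "((\<lambda>s. u x s) \<longlongrightarrow> u x 0) (at_right 0)"
    using T_pos by (simp add: at_within_Icc_at_right)
  have "\<forall>\<^sub>F s in at_right 0. s \<in> {0<..<T}"
    using T_pos by (rule eventually_at_right_real)
  then have "\<forall>\<^sub>F s in at_right 0. u x s = 0"
    by eventually_elim (use sol assms(1) in \<open>auto simp: classical_solution_def\<close>)
  then have "((\<lambda>s. u x s) \<longlongrightarrow> 0) (at_right 0)" by (rule tendsto_eventually)
  with lim have "u x 0 = 0" by (intro tendsto_unique[OF _ lim]) auto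
  then show ?thesis using True by simp
qed

lemma u_initial: "x \<in> closure \<Omega> \<Longrightarrow> u x 0 = 0"
  using closure_cases[of x] u_frontier[of x 0] sol T_pos by (auto simp: classical_solution_def)

text \<open>Translates the Frechet derivatives of the definition into the line derivatives behind
  \<open>has_lap\<close>.\<close>

lemma u_pde:
  assumes x: "x \<in> \<Omega>" and t: "0 < t" "t < T"
  obtains L where "has_lap (\<lambda>y. u y t) x L"
    "(u x has_real_derivative (L + f x * (1 - u x t) powr (- p))) (at t)"
proof -
  have c21: "C21_on \<Omega> (ereal T) u" using sol by (simp add: classical_solution_def)
  define Q where "Q = \<Omega> \<times> {t. 0 < t \<and> ereal t < ereal T}"
  have Q: "(y, t) \<in> Q" if "y \<in> \<Omega>" for y using that t by (simp add: Q_def)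
  note c21' = c21[unfolded C21_on_def Let_def, folded Q_def]
  have d1: "(\<lambda>y. u y t) differentiable (at y)" if "y \<in> \<Omega>" for y
    using bspec[OF c21'[THEN conjunct2, THEN conjunct1] Q[OF that]] by simp
  have d2: "partial_deriv b (\<lambda>y. u y t) differentiable (at y)" if "y \<in> \<Omega>" "b \<in> Basis" for y b
    using bspec[OF bspec[OF c21'[THEN conjunct2, THEN conjunct2, THEN conjunct1] that(2)] Q[OF that(1)]] by simp
  have line: "((\<lambda>s. g (x + s *\<^sub>R b)) has_real_derivative partial_deriv b g (x + s *\<^sub>R b)) (at s)"
    if "g differentiable (at (x + s *\<^sub>R b))" for g :: "'a \<Rightarrow> real" and s b
  proof -
    have "(g has_derivative frechet_derivative g (at (x + s *\<^sub>R b))) (at (x + s *\<^sub>R b))"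
      using that by (simp add: frechet_derivative_works)
    moreover have "((\<lambda>s. x + s *\<^sub>R b) has_derivative (\<lambda>r. r *\<^sub>R b)) (at s)"
      by (auto intro!: derivative_eq_intros)
    ultimately have "((\<lambda>s. g (x + s *\<^sub>R b)) has_derivative (\<lambda>r. frechet_derivative g (at (x + s *\<^sub>R b)) (r *\<^sub>R b))) (at s)"
      by (rule has_derivative_compose[rotated])
    moreover have "linear (frechet_derivative g (at (x + s *\<^sub>R b)))"
      using that by (rule linear_frechet_derivative)
    ultimately show ?thesis
      by (elim has_derivative_imp_has_field_derivative) (simp add: partial_deriv_def linear_scale)
  qed
  have "has_d2 (\<lambda>y. u y t) x b (partial_deriv b (partial_deriv b (\<lambda>y. u y t)) x)" if b: "b \<in> Basis" for b
    unfolding has_d2_def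
  proof (intro exI conjI)
    have "\<forall>\<^sub>F y in nhds x. y \<in> \<Omega>" using x open_dom by (rule eventually_nhds_in_open[rotated])
    from eventually_nhds_line[OF this, of b]
    show "\<forall>\<^sub>F s in nhds 0. ((\<lambda>s. u (x + s *\<^sub>R b) t) has_real_derivative
        (\<lambda>s. partial_deriv b (\<lambda>y. u y t) (x + s *\<^sub>R b)) s) (at s)"
      by eventually_elim (rule line, rule d1)
    show "((\<lambda>s. partial_deriv b (\<lambda>y. u y t) (x + s *\<^sub>R b)) has_real_derivative
       partial_deriv b (partial_deriv b (\<lambda>y. u y t)) x) (at 0)"
      using line[of "partial_deriv b (\<lambda>y. u y t)" 0 b] d2[OF x b] by simp
  qed
  then have 1: "has_lap (\<lambda>y. u y t) x (laplacian (\<lambda>y. u y t) x)"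
    unfolding has_lap_def laplacian_def
    by (intro exI[of _ "\<lambda>b. partial_deriv b (partial_deriv b (\<lambda>y. u y t)) x"]) simp
  have "(\<lambda>s. u x s) differentiable (at t)"
    using bspec[OF c21'[THEN conjunct1] Q[OF x]] by simp
  then have "(u x has_real_derivative deriv (u x) t) (at t)"
    using DERIV_deriv_iff_real_differentiable by blast
  moreover have "deriv (u x) t = laplacian (\<lambda>y. u y t) x + f x * (1 - u x t) powr (- p)"
    using sol x t unfolding classical_solution_def by simp
  ultimately show ?thesis using 1 that by simp
qed

lemma f_bounded: obtains F where "0 < F" "\<And>x. x \<in> closure \<Omega> \<Longrightarrow> f x \<le> F"
proof -
  have "compact (f ` closure \<Omega>)" using compact_continuous_image[OF f_cont compact_closure_dom] .
  then obtain F where "F > 0" "\<forall>x\<in>f ` closure \<Omega>. norm x \<le> F"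
    using compact_imp_bounded[of "f ` closure \<Omega>"] bounded_pos[of "f ` closure \<Omega>"] by auto
  then show ?thesis using that[of F] by force
qed

text \<open>Compactness of \<open>closure \<Omega> \<times> {0..t1}\<close>. Strictly before
  \<open>T\<close> this gap makes the reaction term Lipschitz in \<open>u\<close>.\<close>

lemma gap:
  assumes "t1 < T"
  obtains m where "0 < m" "\<And>x t. x \<in> closure \<Omega> \<Longrightarrow> 0 \<le> t \<Longrightarrow> t \<le> t1 \<Longrightarrow> m \<le> 1 - u x t"
proof (cases "\<Omega> = {} \<or> t1 < 0")
  case True
  then show ?thesis using that[of 1] by auto
next
  case False
  have "continuous_on (closure \<Omega> \<times> {0..t1}) (\<lambda>(x,t). u x t)"
    by (rule continuous_on_subset[OF u_cont]) (use assms in auto)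
  moreover have "compact (closure \<Omega> \<times> {0..t1})" by (intro compact_Times compact_closure_dom) auto
  ultimately obtain w where w: "w \<in> closure \<Omega> \<times> {0..t1}"
    "\<forall>v\<in>closure \<Omega> \<times> {0..t1}. (\<lambda>(x,t). u x t) v \<le> (\<lambda>(x,t). u x t) w"
    using continuous_attains_sup[of "closure \<Omega> \<times> {0..t1}" "\<lambda>(x,t). u x t"] False by auto
  obtain x1 s1 where "w = (x1, s1)" by force
  with w that[of "1 - u x1 s1"] u_lt_1[of x1 s1] assms show ?thesis by auto
qed

lemma interior_closure: "x \<in> \<Omega> \<Longrightarrow> x \<in> interior (closure \<Omega>)"
  using interior_maximal[OF closure_subset open_dom] by auto

lemma u_nonneg:
  assumes "x \<in> closure \<Omega>" "0 \<le> t" "t < T"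
  shows "0 \<le> u x t"
proof -
  have "- u x t \<le> 0"
  proof (rule parabolic_max_principle_smooth[of "closure \<Omega>" 0 t "\<lambda>x t. - u x t" 0])
    show "continuous_on (closure \<Omega> \<times> {0..t}) (\<lambda>(x, t). - u x t)"
      using continuous_on_minus[OF u_cont_shift[of "closure \<Omega>" 0 0 t]] assms by (simp add: case_prod_beta)
    fix y s assume y: "y \<in> closure \<Omega>" "0 \<le> s" "s \<le> t" "0 < - u y s"
    have s: "0 < s" using y u_initial[of y] by (cases "s = 0") auto
    have yO: "y \<in> \<Omega>" using closure_cases[OF y(1)] u_frontier[of y s] y assms by auto
    obtain L where L: "has_lap (\<lambda>y. u y s) y L"
      "(u y has_real_derivative (L + f y * (1 - u y s) powr (- p))) (at s)"
      using u_pde[OF yO s] y assms by auto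
    show "0 < s \<and> y \<in> interior (closure \<Omega>) \<and>
      (\<exists>d D. ((\<lambda>t. - u y t) has_real_derivative d) (at s) \<and> has_lap (\<lambda>y. - u y s) y D \<and> d - D \<le> 0 * - u y s)"
      using s interior_closure[OF yO] DERIV_minus[OF L(2)] has_lap_cmult[OF L(1), of "-1"] f_nonneg[OF y(1)]
      by (intro conjI exI[of _ "- (L + f y * (1 - u y s) powr (- p))"] exI[of _ "- L"]) auto
  qed (use assms compact_closure_dom in auto)
  then show ?thesis by simp
qed

lemma u_shift_pde:
  assumes x: "x \<in> \<Omega>" and t: "0 < t + h" "t + h < T"
  obtains L where "has_lap (\<lambda>y. u y (t + h)) x L"
    "((\<lambda>t. u x (t + h)) has_real_derivative (L + f x * (1 - u x (t + h)) powr (- p))) (at t)"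
proof -
  from u_pde[OF assms] obtain L where L: "has_lap (\<lambda>y. u y (t + h)) x L"
    "(u x has_real_derivative (L + f x * (1 - u x (t + h)) powr (- p))) (at (t + h))" by blast
  have "((\<lambda>t. t + h) has_real_derivative 1) (at t)" by (auto intro!: derivative_eq_intros)
  from DERIV_chain2[OF L(2) this] L(1) that show ?thesis by simp
qed

text \<open>Comparison of \<open>u\<close> with its translate by \<open>h\<close>: the translate
  starts from \<open>u x h \<ge> 0 = u x 0\<close> and solves the same equation, since
  \<open>f\<close> does not depend on time. It replaces the sign of the time derivative.\<close>

lemma u_mono:
  assumes "x \<in> closure \<Omega>" "0 \<le> t" "0 \<le> h" "t + h < T"
  shows "u x t \<le> u x (t + h)"
proof -
  obtain m where m: "0 < m" "\<And>x s. x \<in> closure \<Omega> \<Longrightarrow> 0 \<le> s \<Longrightarrow> s \<le> t + h \<Longrightarrow> m \<le> 1 - u x s"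
    using gap[OF assms(4)] by blast
  obtain F where F: "0 < F" "\<And>x. x \<in> closure \<Omega> \<Longrightarrow> f x \<le> F" using f_bounded by blast
  define M where "M = p * m powr (- p - 1)"
  have M: "M \<ge> 0" using p_pos by (simp add: M_def)
  have "u x t - u x (t + h) \<le> 0"
  proof (rule parabolic_max_principle_smooth[of "closure \<Omega>" 0 t "\<lambda>x t. u x t - u x (t + h)" "F * M"])
    show "continuous_on (closure \<Omega> \<times> {0..t}) (\<lambda>(x, t). u x t - u x (t + h))"
      using continuous_on_diff[OF u_cont_shift[of "closure \<Omega>" 0 0 t] u_cont_shift[of "closure \<Omega>" 0 h t]] assms
      by (simp add: case_prod_beta)
    fix y s assume y: "y \<in> closure \<Omega>" "0 \<le> s" "s \<le> t" "0 < u y s - u y (s + h)"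
    have s: "0 < s" using y u_initial[of y] u_nonneg[of y h] assms by (cases "s = 0") auto
    have yO: "y \<in> \<Omega>" using closure_cases[OF y(1)] u_frontier[of y s] u_nonneg[of y "s + h"] y assms by auto
    obtain L where L: "has_lap (\<lambda>y. u y s) y L"
      "(u y has_real_derivative (L + f y * (1 - u y s) powr (- p))) (at s)"
      using u_pde[OF yO s] y assms by auto
    obtain L' where L': "has_lap (\<lambda>y. u y (s + h)) y L'"
      "((\<lambda>t. u y (t + h)) has_real_derivative (L' + f y * (1 - u y (s + h)) powr (- p))) (at s)"
      using u_shift_pde[OF yO, of s h] s y assms by auto
    have "(1 - u y s) powr (- p) - (1 - u y (s + h)) powr (- p) \<le> M * (u y s - u y (s + h))"
      using powr_minus_diff_le[of m "1 - u y s" "1 - u y (s + h)" p] m(1) m(2)[of y s] y assms p_pos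
      by (simp add: M_def)
    then have "f y * ((1 - u y s) powr (- p) - (1 - u y (s + h)) powr (- p)) \<le> f y * (M * (u y s - u y (s + h)))"
      using f_nonneg[OF y(1)] by (rule mult_left_mono)
    also have "\<dots> \<le> F * (M * (u y s - u y (s + h)))"
      using F(2)[OF y(1)] y M by (intro mult_right_mono) auto
    finally show "0 < s \<and> y \<in> interior (closure \<Omega>) \<and>
      (\<exists>d D. ((\<lambda>t. u y t - u y (t + h)) has_real_derivative d) (at s) \<and>
         has_lap (\<lambda>y. u y s - u y (s + h)) y D \<and> d - D \<le> F * M * (u y s - u y (s + h)))"
      using s interior_closure[OF yO] DERIV_diff[OF L(2) L'(2)] has_lap_diff[OF L(1) L'(1)]
      by (intro conjI exI[of _ "(L + f y * (1 - u y s) powr (- p)) - (L' + f y * (1 - u y (s + h)) powr (- p))"]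
          exI[of _ "L - L'"]) (auto simp: algebra_simps)
  qed (use assms compact_closure_dom in auto)
  then show ?thesis by simp
qed

text \<open>The lower bound is a subsolution that vanishes initially and on the sphere. Its time
  derivative minus its Laplacian is at most \<open>\<kappa> * (r\<^sup>2 + 2 * n * T)\<close>, which
  the choice of \<kappa> makes equal to \<open>c\<close>; and \<open>c\<close> is below the reaction
  term because \<open>u \<ge> 0\<close>.\<close>

lemma u_linear_lower_bound:
  assumes B: "ball x1 r \<subseteq> \<Omega>" "0 < r" and c: "0 < c" "\<And>x. x \<in> ball x1 r \<Longrightarrow> c \<le> f x"
  obtains \<kappa> where "0 < \<kappa>" "\<And>x t. x \<in> ball x1 r \<Longrightarrow> 0 \<le> t \<Longrightarrow> t < T \<Longrightarrow> \<kappa> * t * (r\<^sup>2 - (norm (x - x1))\<^sup>2) \<le> u x t"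
proof -
  define n where "n = real DIM('a)"
  define \<kappa> where "\<kappa> = c / (r\<^sup>2 + 2 * n * T)"
  have den: "r\<^sup>2 + 2 * n * T > 0" using B(2) T_pos by (auto simp: n_def intro!: add_pos_nonneg)
  have \<kappa>: "\<kappa> > 0" using den c by (simp add: \<kappa>_def)
  have \<kappa>c: "\<kappa> * (r\<^sup>2 + 2 * n * T) = c" using den by (simp add: \<kappa>_def)
  have cl: "cball x1 r \<subseteq> closure \<Omega>"
    using closure_mono[OF B(1)] B(2) by simp
  have "\<kappa> * t * (r\<^sup>2 - (norm (x - x1))\<^sup>2) \<le> u x t" if x: "x \<in> ball x1 r" and t: "0 \<le> t" "t < T" for x t
  proof -
    have "\<kappa> * t * (r\<^sup>2 - (norm (x - x1))\<^sup>2) - u x t \<le> 0"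
    proof (rule parabolic_max_principle_smooth[of "cball x1 r" 0 t
        "\<lambda>x t. \<kappa> * t * (r\<^sup>2 - (norm (x - x1))\<^sup>2) - u x t" 0])
      have "continuous_on (cball x1 r \<times> {0..t}) (\<lambda>(x, t). \<kappa> * t * (r\<^sup>2 - (norm (x - x1))\<^sup>2))"
        unfolding case_prod_beta by (intro continuous_intros)
      then show "continuous_on (cball x1 r \<times> {0..t}) (\<lambda>(x, t). \<kappa> * t * (r\<^sup>2 - (norm (x - x1))\<^sup>2) - u x t)"
        using continuous_on_diff[OF _ u_cont_shift[of "cball x1 r" 0 0 t]] t cl by (simp add: case_prod_beta)
      fix y s assume y: "y \<in> cball x1 r" "0 \<le> s" "s \<le> t" "0 < \<kappa> * s * (r\<^sup>2 - (norm (y - x1))\<^sup>2) - u y s"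
      have yc: "y \<in> closure \<Omega>" using y cl by auto
      have "0 \<le> u y s" using u_nonneg[OF yc] y t by auto
      with y have "0 < \<kappa> * s * (r\<^sup>2 - (norm (y - x1))\<^sup>2)" by simp
      moreover have "0 \<le> \<kappa> * s" using \<kappa> y(2) by simp
      ultimately have "0 < \<kappa> * s" and D: "(norm (y - x1))\<^sup>2 < r\<^sup>2"
        by (simp_all only: zero_less_mult_iff not_less[symmetric] diff_gt_0_iff_gt) auto
      then have s: "0 < s" using \<kappa> by (simp add: zero_less_mult_iff)
      from D have yb: "y \<in> ball x1 r" using B(2) power2_less_imp_less[of "norm (y - x1)" r]
        by (simp add: dist_norm norm_minus_commute)
      then have yO: "y \<in> \<Omega>" using B by auto
      obtain L where L: "has_lap (\<lambda>y. u y s) y L"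
        "(u y has_real_derivative (L + f y * (1 - u y s) powr (- p))) (at s)"
        using u_pde[OF yO s] y t by auto
      have "has_lap (\<lambda>y. \<kappa> * s * (r\<^sup>2 - (norm (y - x1))\<^sup>2)) y (\<kappa> * s * (0 - 2 * n))"
        unfolding n_def by (intro has_lap_cmult has_lap_diff has_lap_const has_lap_norm_sq)
      from has_lap_diff[OF this L(1)]
      have lap: "has_lap (\<lambda>y. \<kappa> * s * (r\<^sup>2 - (norm (y - x1))\<^sup>2) - u y s) y (\<kappa> * s * (0 - 2 * n) - L)" .
      have "((\<lambda>s. \<kappa> * s * (r\<^sup>2 - (norm (y - x1))\<^sup>2)) has_real_derivative \<kappa> * (r\<^sup>2 - (norm (y - x1))\<^sup>2)) (at s)"
        by (auto intro!: derivative_eq_intros)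
      from DERIV_diff[OF this L(2)]
      have der: "((\<lambda>s. \<kappa> * s * (r\<^sup>2 - (norm (y - x1))\<^sup>2) - u y s) has_real_derivative
        (\<kappa> * (r\<^sup>2 - (norm (y - x1))\<^sup>2) - (L + f y * (1 - u y s) powr (- p)))) (at s)" .
      have "1 \<le> (1 - u y s) powr (- p)"
        using powr_mono2'[of "- p" "1 - u y s" 1] u_lt_1[OF yc, of s] u_nonneg[OF yc, of s] p_pos y t by auto
      then have "f y * 1 \<le> f y * (1 - u y s) powr (- p)"
        using f_nonneg[OF yc] by (intro mult_left_mono)
      with c(2)[OF yb] have 1: "c \<le> f y * (1 - u y s) powr (- p)" by simp
      have "\<kappa> * (r\<^sup>2 - (norm (y - x1))\<^sup>2) + \<kappa> * (2 * n * s) \<le> \<kappa> * r\<^sup>2 + \<kappa> * (2 * n * T)"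
        using \<kappa> y t by (intro add_mono mult_left_mono) (auto simp: n_def)
      also have "\<dots> = c" using \<kappa>c by (simp add: algebra_simps)
      finally have sub: "\<kappa> * (r\<^sup>2 - (norm (y - x1))\<^sup>2) - (L + f y * (1 - u y s) powr (- p)) - (\<kappa> * s * (0 - 2 * n) - L) \<le> 0"
        using 1 by (simp add: algebra_simps)
      show "0 < s \<and> y \<in> interior (cball x1 r) \<and>
        (\<exists>d D. ((\<lambda>t. \<kappa> * t * (r\<^sup>2 - (norm (y - x1))\<^sup>2) - u y t) has_real_derivative d) (at s) \<and>
          has_lap (\<lambda>y. \<kappa> * s * (r\<^sup>2 - (norm (y - x1))\<^sup>2) - u y s) y D \<and>
          d - D \<le> 0 * (\<kappa> * s * (r\<^sup>2 - (norm (y - x1))\<^sup>2) - u y s))"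
        unfolding mult_zero_left using s yb by (intro conjI exI, simp_all only: interior_cball) (rule der lap sub)+
    qed (use x t in auto)
    then show ?thesis by simp
  qed
  with \<kappa> that show ?thesis by blast
qed

section \<open>Spreading of positive time increments\<close>

lemma cball_subset_closure: "ball z R \<subseteq> \<Omega> \<Longrightarrow> 0 < R \<Longrightarrow> cball z R \<subseteq> closure \<Omega>"
  using closure_mono[of "ball z R" \<Omega>] by simp

text \<open>By monotonicity in time the reaction term of the translate is the larger one, so
  increments are supersolutions of the heat equation and dominate a multiple of a spreading bump.
  The constant is uniform in the centre, in \<open>h\<close> and in \<epsilon>, so bounds
  proportional to \<open>h\<close> survive.\<close>

lemma increment_grow:
  assumes \<rho>: "0 < \<rho>" "\<rho> \<le> R" and k: "1 < k" and t: "0 \<le> ta" "ta < tb"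
  obtains c where "0 < c" "\<And>z h \<epsilon> x. ball z R \<subseteq> \<Omega> \<Longrightarrow> 0 < h \<Longrightarrow> tb + h < T \<Longrightarrow> 0 \<le> \<epsilon> \<Longrightarrow>
    (\<And>y. y \<in> ball z \<rho> \<Longrightarrow> \<epsilon> \<le> u y (ta + h) - u y ta) \<Longrightarrow> x \<in> ball z R \<Longrightarrow>
    c * \<epsilon> * (R\<^sup>2 - (norm (x - z))\<^sup>2) powr k \<le> u x (tb + h) - u x tb"
proof -
  \<comment> \<open>The speed at which the squared radius grows from \<open>\<rho>\<^sup>2\<close>
    at \<open>ta\<close> to \<open>R\<^sup>2\<close> at \<open>tb\<close>.\<close>
  define B where "B = (R\<^sup>2 - \<rho>\<^sup>2) / (tb - ta)"
  have B: "0 \<le> B" using \<rho> t by (simp add: B_def power_mono)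
  have R: "0 < R" using \<rho> by simp
  obtain K where K: "0 \<le> K" "\<And>(z::'a) x ta t. ta \<le> t \<Longrightarrow> 0 < bump K k (\<rho>\<^sup>2) B ta z x t \<Longrightarrow>
    \<exists>d L. (bump K k (\<rho>\<^sup>2) B ta z x has_real_derivative d) (at t) \<and>
      has_lap (\<lambda>y. bump K k (\<rho>\<^sup>2) B ta z y t) x L \<and> d \<le> L"
    using bump_heat_subsolution[OF k, of "\<rho>\<^sup>2" B] \<rho> B by auto
  define c where "c = exp (- K * (tb - ta)) / (\<rho>\<^sup>2) powr k"
  have c: "c > 0" using \<rho> by (simp add: c_def)
  have "c * \<epsilon> * (R\<^sup>2 - (norm (x - z))\<^sup>2) powr k \<le> u x (tb + h) - u x tb"
    if z: "ball z R \<subseteq> \<Omega>" and h: "0 < h" "tb + h < T" and \<epsilon>: "0 \<le> \<epsilon>"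
      and init: "\<And>y. y \<in> ball z \<rho> \<Longrightarrow> \<epsilon> \<le> u y (ta + h) - u y ta" and x: "x \<in> ball z R" for z h \<epsilon> x
  proof -
    \<comment> \<open>Scaled so that the bump is at most \<epsilon> at time \<open>ta\<close>, when
      it is positive exactly on \<open>ball z \<rho>\<close>.\<close>
    define C where "C = \<epsilon> / (\<rho>\<^sup>2) powr k"
    have C: "0 \<le> C" using \<epsilon> by (simp add: C_def)
    have cl: "cball z R \<subseteq> closure \<Omega>" using cball_subset_closure[OF z R] .
    have eR: "\<rho>\<^sup>2 + B * (tb - ta) = R\<^sup>2" using t by (simp add: B_def)
    have "C * bump K k (\<rho>\<^sup>2) B ta z x tb - (u x (tb + h) - u x tb) \<le> 0"
    proof (rule parabolic_max_principle_smooth[of "cball z R" ta tb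
        "\<lambda>x t. C * bump K k (\<rho>\<^sup>2) B ta z x t - (u x (t + h) - u x t)" 0])
      have "continuous_on (cball z R \<times> {ta..tb}) (\<lambda>(x,t). bump K k (\<rho>\<^sup>2) B ta z x t)"
        using k by (intro continuous_on_bump) simp
      moreover have "continuous_on (cball z R \<times> {ta..tb}) (\<lambda>(x,t). u x (t + h))"
        using cl t h by (intro u_cont_shift) auto
      moreover have "continuous_on (cball z R \<times> {ta..tb}) (\<lambda>(x,t). u x (t + 0))"
        using cl t h by (intro u_cont_shift) auto
      ultimately show "continuous_on (cball z R \<times> {ta..tb})
          (\<lambda>(x, t). C * bump K k (\<rho>\<^sup>2) B ta z x t - (u x (t + h) - u x t))"
        unfolding case_prod_beta by (intro continuous_intros) simp_all
      fix y s assume y: "y \<in> cball z R" "ta \<le> s" "s \<le> tb"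
        "0 < C * bump K k (\<rho>\<^sup>2) B ta z y s - (u y (s + h) - u y s)"
      have yc: "y \<in> closure \<Omega>" using y cl by auto
      have mono: "u y s \<le> u y (s + h)" using u_mono[OF yc, of s h] y t h by auto
      with y(4) have "0 < C * bump K k (\<rho>\<^sup>2) B ta z y s" by simp
      then have bpos: "0 < bump K k (\<rho>\<^sup>2) B ta z y s"
        using C by (simp add: zero_less_mult_iff)
      then have D: "(norm (y - z))\<^sup>2 < \<rho>\<^sup>2 + B * (s - ta)" by (simp add: bump_pos_iff)
      also have "\<dots> \<le> \<rho>\<^sup>2 + B * (tb - ta)" using y B by (intro add_left_mono mult_left_mono) auto
      also have "\<dots> = R\<^sup>2" by (rule eR)
      finally have "norm (y - z) < R" using R power2_less_imp_less[of "norm (y - z)" R] by simp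
      then have yb: "y \<in> ball z R" by (simp add: dist_norm norm_minus_commute)
      then have yO: "y \<in> \<Omega>" using z by auto
      have s: "ta < s"
      proof (rule ccontr)
        assume "\<not> ta < s"
        then have s: "s = ta" using y by simp
        have "(norm (y - z))\<^sup>2 < \<rho>\<^sup>2" using D s by simp
        then have "norm (y - z) < \<rho>" using \<rho> power2_less_imp_less[of "norm (y - z)" \<rho>] by simp
        then have "y \<in> ball z \<rho>" by (simp add: dist_norm norm_minus_commute)
        from init[OF this] have 1: "\<epsilon> \<le> u y (s + h) - u y s" by (simp add: s)
        have "bump K k (\<rho>\<^sup>2) B ta z y s \<le> (\<rho>\<^sup>2) powr k"
          unfolding bump_def s using k by (auto intro!: powr_mono2)
        then have "C * bump K k (\<rho>\<^sup>2) B ta z y s \<le> C * (\<rho>\<^sup>2) powr k" using C by (rule mult_left_mono)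
        also have "\<dots> = \<epsilon>" using \<rho> by (simp add: C_def)
        finally show False using 1 y(4) by simp
      qed
      have s0: "0 < s" using s t by simp
      obtain L where L: "has_lap (\<lambda>y. u y s) y L"
        "(u y has_real_derivative (L + f y * (1 - u y s) powr (- p))) (at s)"
        using u_pde[OF yO s0] y h by auto
      obtain L' where L': "has_lap (\<lambda>y. u y (s + h)) y L'"
        "((\<lambda>t. u y (t + h)) has_real_derivative (L' + f y * (1 - u y (s + h)) powr (- p))) (at s)"
        using u_shift_pde[OF yO, of s h] s0 y h by auto
      obtain d0 L0 where L0: "(bump K k (\<rho>\<^sup>2) B ta z y has_real_derivative d0) (at s)"
        "has_lap (\<lambda>y. bump K k (\<rho>\<^sup>2) B ta z y s) y L0" "d0 \<le> L0"
        using K(2)[OF y(2) bpos] by blast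
      have "(1 - u y s) powr (- p) \<le> (1 - u y (s + h)) powr (- p)"
        using u_lt_1[OF yc, of "s + h"] mono s0 y h p_pos by (intro powr_mono2') auto
      then have src: "f y * (1 - u y s) powr (- p) \<le> f y * (1 - u y (s + h)) powr (- p)"
        using f_nonneg[OF yc] by (rule mult_left_mono)
      define d where "d = C * d0 - ((L' + f y * (1 - u y (s + h)) powr (- p)) - (L + f y * (1 - u y s) powr (- p)))"
      define D where "D = C * L0 - (L' - L)"
      have "C * d0 \<le> C * L0" using L0(3) C by (rule mult_left_mono)
      with src have sub: "d - D \<le> 0" by (simp add: d_def D_def)
      have der: "((\<lambda>t. C * bump K k (\<rho>\<^sup>2) B ta z y t - (u y (t + h) - u y t)) has_real_derivative d) (at s)"
        unfolding d_def by (intro DERIV_diff DERIV_cmult L0 L L')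
      have lap: "has_lap (\<lambda>y. C * bump K k (\<rho>\<^sup>2) B ta z y s - (u y (s + h) - u y s)) y D"
        unfolding D_def by (intro has_lap_diff has_lap_cmult L0 L L')
      have yi: "y \<in> interior (cball z R)" using yb by simp
      show "ta < s \<and> y \<in> interior (cball z R) \<and>
        (\<exists>d D. ((\<lambda>t. C * bump K k (\<rho>\<^sup>2) B ta z y t - (u y (t + h) - u y t)) has_real_derivative d) (at s) \<and>
          has_lap (\<lambda>y. C * bump K k (\<rho>\<^sup>2) B ta z y s - (u y (s + h) - u y s)) y D \<and>
          d - D \<le> 0 * (C * bump K k (\<rho>\<^sup>2) B ta z y s - (u y (s + h) - u y s)))"
        unfolding mult_zero_left by (intro conjI exI[of _ d] exI[of _ D] s yi der lap sub)
    qed (use x t in auto)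
    moreover have "norm (x - z) < R" using x by (simp add: dist_norm norm_minus_commute)
    then have "(norm (x - z))\<^sup>2 \<le> R\<^sup>2" by (intro power_mono) auto
    then have "bump K k (\<rho>\<^sup>2) B ta z x tb = exp (- K * (tb - ta)) * (R\<^sup>2 - (norm (x - z))\<^sup>2) powr k"
      unfolding bump_def eR by simp
    ultimately show ?thesis by (simp add: c_def C_def mult.commute mult.left_commute)
  qed
  with c that show ?thesis by blast
qed

text \<open>Replaces \<open>u\<^sub>t > 0\<close>: since \<open>u\<^sub>t\<close> need not be differentiable, only increments of \<open>u\<close> are compared.\<close>

definition increments_pos :: "real \<Rightarrow> 'a set \<Rightarrow> bool" where
  "increments_pos t S \<longleftrightarrow> (\<exists>c>0. \<exists>h0>0. t + h0 < T \<and>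
     (\<forall>h. 0 < h \<and> h \<le> h0 \<longrightarrow> (\<forall>x\<in>S. c * h \<le> u x (t + h) - u x t)))"

lemma increments_pos_mono: "increments_pos t S \<Longrightarrow> S' \<subseteq> S \<Longrightarrow> increments_pos t S'"
  unfolding increments_pos_def subset_iff by fast

lemma increments_posE:
  assumes "increments_pos t S"
  obtains c h0 where "0 < c" "0 < h0" "t + h0 < T"
    "\<And>h x. 0 < h \<Longrightarrow> h \<le> h0 \<Longrightarrow> x \<in> S \<Longrightarrow> c * h \<le> u x (t + h) - u x t"
  using assms unfolding increments_pos_def by auto

lemma increments_pos_Un:
  assumes "increments_pos t A" "increments_pos t B"
  shows "increments_pos t (A \<union> B)"
proof -
  obtain c h0 where
    1: "0 < c" "0 < h0" "t + h0 < T" "\<And>h x. 0 < h \<Longrightarrow> h \<le> h0 \<Longrightarrow> x \<in> A \<Longrightarrow> c * h \<le> u x (t + h) - u x t"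
    by (rule increments_posE[OF assms(1)]) blast
  obtain c' h0' where
    2: "0 < c'" "0 < h0'" "t + h0' < T" "\<And>h x. 0 < h \<Longrightarrow> h \<le> h0' \<Longrightarrow> x \<in> B \<Longrightarrow> c' * h \<le> u x (t + h) - u x t"
    by (rule increments_posE[OF assms(2)]) blast
  have "min c c' * h \<le> u x (t + h) - u x t" if "0 < h" "h \<le> min h0 h0'" "x \<in> A \<union> B" for x h
  proof -
    have le: "min c c' * h \<le> c * h" "min c c' * h \<le> c' * h" using that(1) by (auto intro!: mult_right_mono)
    show ?thesis
    proof (cases "x \<in> A")
      case True
      then have "c * h \<le> u x (t + h) - u x t" using that by (intro 1(4)) auto
      with le show ?thesis by linarith
    next
      case False
      then have "c' * h \<le> u x (t + h) - u x t" using that by (intro 2(4)) auto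
      with le show ?thesis by linarith
    qed
  qed
  moreover have "0 < min c c'" "0 < min h0 h0'" "t + min h0 h0' < T" using 1 2 by (auto simp: min_def)
  ultimately show ?thesis unfolding increments_pos_def by blast
qed

lemma increments_pos_UN:
  assumes "finite I" "\<And>i. i \<in> I \<Longrightarrow> increments_pos t (A i)" "t < T"
  shows "increments_pos t (\<Union>i\<in>I. A i)"
  using assms(1,2)
proof (induction I rule: finite_induct)
  case empty
  show ?case unfolding increments_pos_def using assms(3)
    by (intro exI[of _ 1] exI[of _ "(T - t) / 2"] conjI) (auto simp: field_simps)
next
  case (insert i I)
  then show ?case using increments_pos_Un by simp
qed

text \<open>The bound from spreading degenerates on the sphere of radius \<open>R\<close>;
  restricting it to \<open>r < R\<close> turns it into a positive constant. The exponent 2 is one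
  admissible \<open>k > 1\<close>.\<close>

lemma increments_pos_grow:
  assumes "increments_pos ta (ball z \<rho>)" "0 < \<rho>" "\<rho> < r" "r < R" "ball z R \<subseteq> \<Omega>" "0 \<le> ta" "ta < tb" "tb < T"
  shows "increments_pos tb (ball z r)"
proof -
  obtain c h0 where
    1: "0 < c" "0 < h0" "ta + h0 < T" "\<And>h x. 0 < h \<Longrightarrow> h \<le> h0 \<Longrightarrow> x \<in> ball z \<rho> \<Longrightarrow> c * h \<le> u x (ta + h) - u x ta"
    by (rule increments_posE[OF assms(1)]) blast
  obtain c' where c': "0 < c'" "\<And>z h \<epsilon> x. ball z R \<subseteq> \<Omega> \<Longrightarrow> 0 < h \<Longrightarrow> tb + h < T \<Longrightarrow> 0 \<le> \<epsilon> \<Longrightarrow>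
    (\<And>y. y \<in> ball z \<rho> \<Longrightarrow> \<epsilon> \<le> u y (ta + h) - u y ta) \<Longrightarrow> x \<in> ball z R \<Longrightarrow>
    c' * \<epsilon> * (R\<^sup>2 - (norm (x - z))\<^sup>2) powr 2 \<le> u x (tb + h) - u x tb"
    using increment_grow[of \<rho> R 2 ta tb] assms by auto
  define h1 where "h1 = min h0 ((T - tb) / 2)"
  define d where "d = c' * c * (R\<^sup>2 - r\<^sup>2) powr 2"
  have rR: "r\<^sup>2 < R\<^sup>2" using assms by (intro power_strict_mono) auto
  have "d * h \<le> u x (tb + h) - u x tb" if h: "0 < h" "h \<le> h1" and x: "x \<in> ball z r" for h x
  proof -
    have h': "h \<le> h0" "tb + h < T" using h assms by (auto simp: h1_def field_simps)
    have "norm (x - z) \<le> r" using x by (simp add: dist_norm norm_minus_commute)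
    then have "(norm (x - z))\<^sup>2 \<le> r\<^sup>2" by (intro power_mono) auto
    then have "(R\<^sup>2 - r\<^sup>2) powr 2 \<le> (R\<^sup>2 - (norm (x - z))\<^sup>2) powr 2" using rR by (intro powr_mono2) auto
    then have "c' * (c * h) * (R\<^sup>2 - r\<^sup>2) powr 2 \<le> c' * (c * h) * (R\<^sup>2 - (norm (x - z))\<^sup>2) powr 2"
      using c' 1 h by (intro mult_left_mono) auto
    also have "\<dots> \<le> u x (tb + h) - u x tb"
      using c'(2)[OF assms(5) h(1) h'(2), of "c * h" x] 1 h h' x assms by auto
    finally show ?thesis by (simp add: d_def algebra_simps)
  qed
  moreover have "d > 0" using c' 1 rR by (simp add: d_def)
  moreover have "h1 > 0" "tb + h1 < T" using 1 assms by (auto simp: h1_def min_def field_simps)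
  ultimately show ?thesis unfolding increments_pos_def
    by (intro exI[of _ d] exI[of _ h1] conjI allI impI ballI) auto
qed

text \<open>Connectedness takes the place of a strong maximum principle: the points near which
  increments are positive form an open set with open complement in the domain, and a point with
  \<open>f > 0\<close> belongs to it.\<close>

lemma increments_pos_near:
  assumes y: "y \<in> \<Omega>" and nz: "\<exists>x\<in>closure \<Omega>. f x \<noteq> 0" and t: "0 < t" "t < T"
  shows "\<exists>r>0. increments_pos t (ball y r)"
proof -
  \<comment> \<open>All times are quantified at once, so each spreading step may start at
    \<open>t / 2\<close> and a chain of any length still ends at the given \<open>t\<close>.\<close>
  define P where "P = (\<lambda>y. \<forall>t. 0 < t \<and> t < T \<longrightarrow> (\<exists>r>0. increments_pos t (ball y r)))"
  obtain x1 where x1: "x1 \<in> \<Omega>" "f x1 > 0"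
  proof (rule ccontr)
    assume "\<not> thesis"
    with that f_nonneg[OF dom_subset] have "\<And>x. x \<in> \<Omega> \<Longrightarrow> f x = 0" by force
    then have "f x = 0" if "x \<in> closure \<Omega>" for x
      using continuous_constant_on_closure[OF f_cont _ that] by blast
    then show False using nz by blast
  qed
  have "continuous_on \<Omega> f" using f_cont continuous_on_subset closure_subset by blast
  then have "isCont f x1" using x1 open_dom by (simp add: continuous_on_eq_continuous_at)
  then have "\<forall>\<^sub>F x in nhds x1. f x1 / 2 < f x"
    using x1 by (intro isCont_eventually_greater) auto
  moreover have "\<forall>\<^sub>F x in nhds x1. x \<in> \<Omega>" using x1 open_dom by (intro eventually_nhds_in_open)
  ultimately have "\<forall>\<^sub>F x in nhds x1. x \<in> \<Omega> \<and> f x1 / 2 < f x" by eventually_elim simp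
  then obtain r where r: "r > 0" "\<And>x. dist x x1 < r \<Longrightarrow> x \<in> \<Omega> \<and> f x1 / 2 < f x"
    unfolding eventually_nhds_metric by blast
  have rO: "ball x1 r \<subseteq> \<Omega>" using r by (auto simp: dist_commute)
  have fr: "f x1 / 2 \<le> f x" if "x \<in> ball x1 r" for x using r(2)[of x] that by (auto simp: dist_commute)
  obtain \<kappa> where \<kappa>: "0 < \<kappa>" "\<And>x t. x \<in> ball x1 r \<Longrightarrow> 0 \<le> t \<Longrightarrow> t < T \<Longrightarrow> \<kappa> * t * (r\<^sup>2 - (norm (x - x1))\<^sup>2) \<le> u x t"
    using u_linear_lower_bound[OF rO r(1) _ fr] x1 by auto
  \<comment> \<open>At time 0 the increment is \<open>u x h\<close> itself, so the linear lower
    bound applies; the quarter radius keeps the depth above \<open>r\<^sup>2 / 2\<close>.\<close>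
  have base0: "increments_pos 0 (ball x1 (r / 4))"
    unfolding increments_pos_def
  proof (intro exI conjI allI impI ballI)
    show "0 < \<kappa> * (r\<^sup>2 / 2)" "0 < T / 2" "0 + T / 2 < T" using \<kappa> r T_pos by auto
    fix h x assume h: "0 < h \<and> h \<le> T / 2" and x: "x \<in> ball x1 (r / 4)"
    have xr: "x \<in> ball x1 r" using x r by auto
    have "norm (x - x1) \<le> r / 2" using x r by (simp add: dist_norm norm_minus_commute)
    then have "(norm (x - x1))\<^sup>2 \<le> (r / 2)\<^sup>2" by (intro power_mono) auto
    moreover have "(r / 2)\<^sup>2 = r\<^sup>2 / 4" by (simp add: power_divide)
    ultimately have "r\<^sup>2 / 2 \<le> r\<^sup>2 - (norm (x - x1))\<^sup>2"
      using zero_le_power2[of "norm (x - x1)"] by linarith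
    then have "\<kappa> * h * (r\<^sup>2 / 2) \<le> \<kappa> * h * (r\<^sup>2 - (norm (x - x1))\<^sup>2)" using \<kappa> h by (intro mult_left_mono) auto
    also have "\<dots> \<le> u x h" using \<kappa>(2)[OF xr, of h] h T_pos by auto
    finally show "\<kappa> * (r\<^sup>2 / 2) * h \<le> u x (0 + h) - u x 0"
      using u_initial[OF dom_subset, of x] xr rO by (auto simp: algebra_simps)
  qed
  have base: "P x1"
    unfolding P_def
  proof (intro allI impI exI[of _ "r / 2"] conjI)
    fix t assume "0 < t \<and> t < T"
    then show "increments_pos t (ball x1 (r / 2))"
      using increments_pos_grow[OF base0, of "r / 2" r t] r rO by auto
  qed (use r in simp)
  \<comment> \<open>The inclusions are \<open>ball y r\<close> in \<open>ball y' (2 * r)\<close> and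
    \<open>ball y' (3 * r)\<close> in \<open>ball y (4 * r)\<close>. Read forwards the step shows
    that \<open>A\<close> is open; read contrapositively, that \<open>\<Omega> - A\<close>
    is.\<close>
  have step: "P y" if y': "P y'" "dist y y' < r" and r: "0 < r" "ball y (4 * r) \<subseteq> \<Omega>" for y y' r
    unfolding P_def
  proof (intro allI impI)
    fix t assume t: "0 < t \<and> t < T"
    then have "0 < t / 2 \<and> t / 2 < T" by auto
    with y'(1) obtain \<rho> where \<rho>: "\<rho> > 0" "increments_pos (t / 2) (ball y' \<rho>)" unfolding P_def by blast
    have "increments_pos (t / 2) (ball y' (min \<rho> r))"
      by (rule increments_pos_mono[OF \<rho>(2)]) auto
    moreover have "ball y' (3 * r) \<subseteq> ball y (4 * r)"
    proof
      fix w assume "w \<in> ball y' (3 * r)"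
      then show "w \<in> ball y (4 * r)" using y'(2) dist_triangle[of y w y'] by simp
    qed
    ultimately have "increments_pos t (ball y' (2 * r))"
      using increments_pos_grow[of "t / 2" y' "min \<rho> r" "2 * r" "3 * r" t] \<rho> r t by auto
    moreover have "ball y r \<subseteq> ball y' (2 * r)"
    proof
      fix w assume "w \<in> ball y r"
      then show "w \<in> ball y' (2 * r)" using y'(2) dist_triangle[of y' w y] by (simp add: dist_commute)
    qed
    ultimately show "\<exists>r>0. increments_pos t (ball y r)" using r increments_pos_mono by blast
  qed
  define A where "A = {y \<in> \<Omega>. P y}"
  have oA: "open A" unfolding open_dist
  proof
    fix y' assume "y' \<in> A"
    then have y': "y' \<in> \<Omega>" "P y'" by (auto simp: A_def)
    obtain e where e: "e > 0" "ball y' e \<subseteq> \<Omega>" using y' open_dom open_contains_ball by blast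
    have "w \<in> A" if "dist w y' < e / 5" for w
    proof -
      have "ball w (4 * (e / 5)) \<subseteq> ball y' e"
      proof
        fix v assume "v \<in> ball w (4 * (e / 5))"
        then show "v \<in> ball y' e" using that dist_triangle[of y' v w] by (simp add: dist_commute)
      qed
      with e have *: "ball w (4 * (e / 5)) \<subseteq> \<Omega>" by blast
      have "w \<in> ball w (4 * (e / 5))" using e by simp
      with * have "w \<in> \<Omega>" by blast
      moreover have "P w" using step[OF y'(2) that _ *] e by simp
      ultimately show ?thesis by (simp add: A_def)
    qed
    then show "\<exists>e>0. \<forall>w. dist w y' < e \<longrightarrow> w \<in> A" using e by (intro exI[of _ "e / 5"]) auto
  qed
  have oB: "open (\<Omega> - A)" unfolding open_dist
  proof
    fix y assume y: "y \<in> \<Omega> - A"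
    obtain e where e: "e > 0" "ball y e \<subseteq> \<Omega>" using y open_dom open_contains_ball by blast
    have "w \<in> \<Omega> - A" if "dist w y < e / 4" for w
    proof -
      have "w \<in> \<Omega>" using that e by (auto simp: subset_iff dist_commute)
      moreover have "\<not> P w" using step[of w y "e / 4"] that y e by (auto simp: A_def dist_commute)
      ultimately show ?thesis by (simp add: A_def)
    qed
    then show "\<exists>e>0. \<forall>w. dist w y < e \<longrightarrow> w \<in> \<Omega> - A" using e by (intro exI[of _ "e / 4"]) auto
  qed
  have "A \<inter> \<Omega> = {} \<or> (\<Omega> - A) \<inter> \<Omega> = {}"
    by (rule connectedD[OF connected_dom oA oB]) auto
  moreover have "x1 \<in> A" using x1 base by (simp add: A_def)
  ultimately have "y \<in> A" using y by (auto simp: A_def)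
  then show ?thesis using t by (simp add: A_def P_def)
qed

lemma increments_pos_compact:
  assumes "compact S" "S \<subseteq> \<Omega>" "\<exists>x\<in>closure \<Omega>. f x \<noteq> 0" "0 < t" "t < T"
  shows "increments_pos t S"
proof -
  have "\<forall>y\<in>S. \<exists>r>0. increments_pos t (ball y r)" using increments_pos_near assms by blast
  then obtain r where r: "\<And>y. y \<in> S \<Longrightarrow> r y > 0 \<and> increments_pos t (ball y (r y))" by metis
  have "S \<subseteq> (\<Union>y\<in>S. ball y (r y))" using r by force
  then obtain C where C: "C \<subseteq> S" "finite C" "S \<subseteq> (\<Union>y\<in>C. ball y (r y))"
    using compactE_image[OF assms(1), of S "\<lambda>y. ball y (r y)"] by auto
  have "increments_pos t (\<Union>y\<in>C. ball y (r y))"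
    using C r assms(5) by (intro increments_pos_UN) auto
  then show ?thesis using C(3) increments_pos_mono by blast
qed

section \<open>Lower bound at the type I rate\<close>

text \<open>A positive difference \<open>W - (1 - u)\<close> forces \<phi> > 0, since otherwise
  \<open>W = 1 - u x (t + h)\<close> and monotonicity in time applies; this settles the sphere.
  Inside, the norm is replaced by its supporting functional at the point in question.\<close>

lemma type_I_step:
  assumes z: "ball z R \<subseteq> \<Omega>" "0 < R" and k: "0 < k" and t: "0 < t0" "0 < h" "t1 + h < T" and \<kappa>: "0 \<le> \<kappa>"
    and K: "\<And>x t. t0 \<le> t \<Longrightarrow> 0 < bump K k (R\<^sup>2) 0 t0 z x t \<Longrightarrow>
    \<exists>d L. (bump K k (R\<^sup>2) 0 t0 z x has_real_derivative d) (at t) \<and>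
      has_lap (\<lambda>y. bump K k (R\<^sup>2) 0 t0 z y t) x L \<and> d \<le> L"
    and init: "\<And>x. x \<in> ball z R \<Longrightarrow>
      pair_norm p (1 - u x (t0 + h)) (\<kappa> * bump K k (R\<^sup>2) 0 t0 z x t0) \<le> 1 - u x t0"
    and x: "x \<in> ball z R" "t0 \<le> t" "t \<le> t1"
  shows "pair_norm p (1 - u x (t + h)) (\<kappa> * bump K k (R\<^sup>2) 0 t0 z x t) \<le> 1 - u x t"
proof -
  define \<phi> where "\<phi> = (\<lambda>x t. \<kappa> * bump K k (R\<^sup>2) 0 t0 z x t)"
  have \<phi>0: "0 \<le> \<phi> x t" for x t using \<kappa> by (simp add: \<phi>_def bump_nonneg)
  have cl: "cball z R \<subseteq> closure \<Omega>" using cball_subset_closure[OF z] .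
  have t1T: "t1 < T" using t by simp
  obtain m where m: "0 < m" "\<And>x s. x \<in> closure \<Omega> \<Longrightarrow> 0 \<le> s \<Longrightarrow> s \<le> t1 \<Longrightarrow> m \<le> 1 - u x s"
    using gap[OF t1T] by blast
  obtain F where F: "0 < F" "\<And>x. x \<in> closure \<Omega> \<Longrightarrow> f x \<le> F" using f_bounded by blast
  define M where "M = p * m powr (- p - 1)"
  have M: "M \<ge> 0" using p_pos by (simp add: M_def)
  have Vpos: "0 < 1 - u y (s + h)" if "y \<in> closure \<Omega>" "0 \<le> s" "s \<le> t1" for y s
    using u_lt_1[OF that(1), of "s + h"] that t by auto
  have "pair_norm p (1 - u x (t + h)) (\<phi> x t) - (1 - u x t) \<le> 0"
  proof (rule parabolic_max_principle[of "cball z R" t0 t1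
      "\<lambda>x t. pair_norm p (1 - u x (t + h)) (\<phi> x t) - (1 - u x t)" "F * M"])
    have "continuous_on (cball z R \<times> {t0..t1}) (\<lambda>(x,t). bump K k (R\<^sup>2) 0 t0 z x t)"
      using k by (intro continuous_on_bump) simp
    then have c\<phi>: "continuous_on (cball z R \<times> {t0..t1}) (\<lambda>w. \<phi> (fst w) (snd w))"
      unfolding \<phi>_def case_prod_beta by (intro continuous_intros)
    have "continuous_on (cball z R \<times> {t0..t1}) (\<lambda>(x,t). u x (t + h))"
      using cl t by (intro u_cont_shift) auto
    then have cV: "continuous_on (cball z R \<times> {t0..t1}) (\<lambda>w. 1 - u (fst w) (snd w + h))"
      unfolding case_prod_beta by (intro continuous_intros)
    have "continuous_on (cball z R \<times> {t0..t1}) (\<lambda>(x,t). u x (t + 0))"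
      using cl t by (intro u_cont_shift) auto
    then have cY: "continuous_on (cball z R \<times> {t0..t1}) (\<lambda>w. 1 - u (fst w) (snd w))"
      unfolding case_prod_beta by (intro continuous_intros) simp
    have nn: "0 \<le> 1 - u (fst w) (snd w + h)" if "w \<in> cball z R \<times> {t0..t1}" for w
      using Vpos[of "fst w" "snd w"] that cl t by (cases w) (auto simp: less_imp_le subset_iff)
    show "continuous_on (cball z R \<times> {t0..t1})
        (\<lambda>(x, t). pair_norm p (1 - u x (t + h)) (\<phi> x t) - (1 - u x t))"
      unfolding case_prod_beta
      by (rule continuous_on_diff[OF continuous_on_pair_norm[OF p_pos cV c\<phi> nn \<phi>0] cY])
  next
    fix y s assume y: "y \<in> cball z R" "t0 \<le> s" "s \<le> t1"
      "0 < pair_norm p (1 - u y (s + h)) (\<phi> y s) - (1 - u y s)"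
    have yc: "y \<in> closure \<Omega>" using y cl by auto
    have s0: "0 < s" using y t by simp
    have mono: "u y s \<le> u y (s + h)" using u_mono[OF yc, of s h] y t by auto
    define V where "V = 1 - u y (s + h)"
    have V: "0 < V" using Vpos[OF yc, of s] y s0 by (simp add: V_def)
    have Y: "m \<le> 1 - u y s" using m(2)[OF yc, of s] y s0 by auto
    have "\<phi> y s \<noteq> 0"
    proof
      assume "\<phi> y s = 0"
      then show False using y(4) pair_norm_0[OF p_pos, of V] V mono by (simp add: V_def)
    qed
    with \<phi>0[of y s] have \<phi>pos: "0 < \<phi> y s" by simp
    then have bpos: "0 < bump K k (R\<^sup>2) 0 t0 z y s"
      using \<kappa> by (simp add: \<phi>_def zero_less_mult_iff)
    then have "(norm (y - z))\<^sup>2 < R\<^sup>2" by (simp add: bump_pos_iff)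
    then have "norm (y - z) < R" using z power2_less_imp_less[of "norm (y - z)" R] by simp
    then have yb: "y \<in> ball z R" by (simp add: dist_norm norm_minus_commute)
    then have yO: "y \<in> \<Omega>" using z by auto
    have s: "t0 < s" using init[OF yb] y by (cases "s = t0") (auto simp: \<phi>_def)
    obtain L where L: "has_lap (\<lambda>y. u y s) y L"
      "(u y has_real_derivative (L + f y * (1 - u y s) powr (- p))) (at s)"
      using u_pde[OF yO s0] y t by auto
    obtain L' where L': "has_lap (\<lambda>y. u y (s + h)) y L'"
      "((\<lambda>t. u y (t + h)) has_real_derivative (L' + f y * (1 - u y (s + h)) powr (- p))) (at s)"
      using u_shift_pde[OF yO, of s h] s0 y t by auto
    obtain d0 L0 where L0: "(bump K k (R\<^sup>2) 0 t0 z y has_real_derivative d0) (at s)"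
      "has_lap (\<lambda>y. bump K k (R\<^sup>2) 0 t0 z y s) y L0" "d0 \<le> L0"
      using K[OF y(2) bpos] by blast
    define W where "W = pair_norm p V (\<phi> y s)"
    note dual = pair_norm_dual[OF p_pos V \<phi>pos W_def]
    define \<alpha> where "\<alpha> = (V / W) powr p"
    define \<beta> where "\<beta> = (\<phi> y s / W) powr p"
    have WY: "1 - u y s < W" using y(4) by (simp add: W_def V_def)
    \<comment> \<open>The weights are frozen at \<open>(y, s)\<close>: by duality \<open>v\<close>
      equals the difference there and stays below it elsewhere, and as a linear combination it
      inherits the derivatives of its terms.\<close>
    define v where "v = (\<lambda>x r. \<alpha> * (1 - u x (r + h)) + \<beta> * \<phi> x r - (1 - u x r))"
    define d where "d = \<alpha> * (0 - (L' + f y * (1 - u y (s + h)) powr (- p))) + \<beta> * (\<kappa> * d0)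
       - (0 - (L + f y * (1 - u y s) powr (- p)))"
    define D where "D = \<alpha> * (0 - L') + \<beta> * (\<kappa> * L0) - (0 - L)"
    have below: "v x r \<le> pair_norm p (1 - u x (r + h)) (\<phi> x r) - (1 - u x r)"
      if "x \<in> closure \<Omega>" "0 \<le> r" "r \<le> t1" for x r
      unfolding v_def \<alpha>_def \<beta>_def using dual(3)[OF _ \<phi>0[of x r], of "1 - u x (r + h)"] Vpos[OF that] by simp
    have "(v y has_real_derivative d) (at s)"
      unfolding v_def d_def \<phi>_def by (intro DERIV_add DERIV_diff DERIV_cmult DERIV_const L L' L0)
    moreover have "has_lap (\<lambda>y. v y s) y D"
      unfolding v_def D_def \<phi>_def by (intro has_lap_add has_lap_diff has_lap_cmult has_lap_const L L' L0)
    moreover have "v y s = pair_norm p (1 - u y (s + h)) (\<phi> y s) - (1 - u y s)"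
      unfolding v_def \<alpha>_def \<beta>_def using dual(2) by (simp add: V_def W_def)
    moreover have "\<forall>\<^sub>F x in nhds y. v x s \<le> pair_norm p (1 - u x (s + h)) (\<phi> x s) - (1 - u x s)"
    proof -
      have "\<forall>\<^sub>F x in nhds y. x \<in> \<Omega>" using yO open_dom by (intro eventually_nhds_in_open)
      then show ?thesis by eventually_elim (use below dom_subset s0 y in auto)
    qed
    moreover have "\<forall>\<^sub>F r in at_left s. v y r \<le> pair_norm p (1 - u y (r + h)) (\<phi> y r) - (1 - u y r)"
    proof -
      have "\<forall>\<^sub>F r in at_left s. r \<in> {0<..<s}" using s0 by (rule eventually_at_left_real)
      then show ?thesis by eventually_elim (use below yc y in auto)
    qed
    moreover have "d - D \<le> F * M * (pair_norm p (1 - u y (s + h)) (\<phi> y s) - (1 - u y s))"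
    proof -
      \<comment> \<open>Weighting the equation of \<open>V\<close> by \<alpha> produces the reaction
        term of \<open>W\<close> exactly; what remains is the difference of
        \<open>powr (- p)\<close> at \<open>1 - u y s\<close> and at \<open>W\<close>, which is
        Lipschitz.\<close>
      have "V powr (- p) * \<alpha> = W powr (- p)"
        unfolding \<alpha>_def using V dual(1) by (simp add: powr_divide powr_minus field_simps)
      then have e: "\<alpha> * (f y * V powr (- p)) = f y * W powr (- p)" by (simp add: mult.commute mult.left_commute)
      have "\<beta> * (\<kappa> * d0) \<le> \<beta> * (\<kappa> * L0)" using \<kappa> L0(3) by (intro mult_left_mono) (auto simp: \<beta>_def)
      then have "d - D \<le> f y * (1 - u y s) powr (- p) - \<alpha> * (f y * V powr (- p))"
        unfolding d_def D_def V_def by (simp add: algebra_simps)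
      also have "\<dots> = f y * ((1 - u y s) powr (- p) - W powr (- p))" unfolding e by (simp add: algebra_simps)
      also have "\<dots> \<le> f y * (M * (W - (1 - u y s)))"
        using powr_minus_diff_le[OF m(1) Y less_imp_le[OF WY] p_pos] f_nonneg[OF yc]
        unfolding M_def by (intro mult_left_mono) auto
      also have "\<dots> \<le> F * (M * (W - (1 - u y s)))"
        using F(2)[OF yc] M WY by (intro mult_right_mono) auto
      finally show ?thesis by (simp add: W_def V_def mult.assoc)
    qed
    moreover have "y \<in> interior (cball z R)" using yb by simp
    ultimately show "\<exists>v d D. t0 < s \<and> y \<in> interior (cball z R) \<and>
         v y s = pair_norm p (1 - u y (s + h)) (\<phi> y s) - (1 - u y s) \<and>
         (\<forall>\<^sub>F x in nhds y. v x s \<le> pair_norm p (1 - u x (s + h)) (\<phi> x s) - (1 - u x s)) \<and>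
         (\<forall>\<^sub>F r in at_left s. v y r \<le> pair_norm p (1 - u y (r + h)) (\<phi> y r) - (1 - u y r)) \<and>
         (v y has_real_derivative d) (at s) \<and> has_lap (\<lambda>y. v y s) y D \<and>
         d - D \<le> F * M * (pair_norm p (1 - u y (s + h)) (\<phi> y s) - (1 - u y s))"
      using s by (intro exI[of _ v] exI[of _ d] exI[of _ D]) simp
  qed (use x in auto)
  then show ?thesis by (simp add: \<phi>_def)
qed

text \<open>Over a time step \<open>h\<close> the quantity \<open>(1 - u) powr q\<close> drops by at
  least a fixed multiple of \<open>h\<close>; summing the drops gives the rate. The point is to have
  the initial comparison at \<open>t0\<close> uniformly over all balls of radius \<open>R\<close> in
  the domain.\<close>

lemma type_I_lower_bound:
  assumes nz: "\<exists>x\<in>closure \<Omega>. f x \<noteq> 0" and k: "1 < k" and R: "0 < R" and t0: "0 < t0" "t0 < T"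
  obtains c where "0 < c" "\<And>z x t. ball z R \<subseteq> \<Omega> \<Longrightarrow> x \<in> ball z R \<Longrightarrow> t0 \<le> t \<Longrightarrow> t < T \<Longrightarrow>
    c * (R\<^sup>2 - (norm (x - z))\<^sup>2) powr k * (T - t) powr (1 / (p + 1)) \<le> 1 - u x t"
proof -
  define q where "q = p + 1"
  have q: "1 < q" using p_pos by (simp add: q_def)
  \<comment> \<open>A compact set that contains the concentric half of every admissible ball, so
    that one pair \<open>c1\<close>, \<open>h1\<close> serves all centres.\<close>
  define S where "S = {x \<in> closure \<Omega>. R / 2 \<le> infdist x (- \<Omega>)}"
  have "\<Omega> \<noteq> UNIV" using bounded_dom not_bounded_UNIV by auto
  then have ne: "- \<Omega> \<noteq> {}" by auto
  have "closed {x. R / 2 \<le> infdist x (- \<Omega>)}" by (intro closed_Collect_le continuous_intros)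
  then have "compact (closure \<Omega> \<inter> {x. R / 2 \<le> infdist x (- \<Omega>)})"
    by (rule compact_Int_closed[OF compact_closure_dom])
  then have S: "compact S" unfolding S_def Int_def by simp
  have "S \<subseteq> \<Omega>"
  proof
    fix x assume "x \<in> S"
    then have "0 < infdist x (- \<Omega>)" using R by (auto simp: S_def)
    then show "x \<in> \<Omega>" using infdist_zero[of x "- \<Omega>"] by (cases "x \<in> \<Omega>") auto
  qed
  then have "increments_pos (t0 / 2) S" using S nz t0 by (intro increments_pos_compact) auto
  then obtain c1 h1 where
    1: "0 < c1" "0 < h1" "t0 / 2 + h1 < T" "\<And>h x. 0 < h \<Longrightarrow> h \<le> h1 \<Longrightarrow> x \<in> S \<Longrightarrow> c1 * h \<le> u x (t0 / 2 + h) - u x (t0 / 2)"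
    by (rule increments_posE) blast
  have half: "y \<in> S" if "y \<in> ball z (R / 2)" "ball z R \<subseteq> \<Omega>" for y z
  proof -
    have "y \<in> ball z R" using that(1) R by auto
    then have "y \<in> closure \<Omega>" using that(2) dom_subset by blast
    moreover have "R / 2 \<le> infdist y (- \<Omega>)"
      unfolding infdist_notempty[OF ne]
    proof (rule cINF_greatest[OF ne])
      fix w assume "w \<in> - \<Omega>"
      then have "w \<notin> ball z R" using that(2) by blast
      then show "R / 2 \<le> dist y w" using that(1) dist_triangle[of z w y] by auto
    qed
    ultimately show ?thesis by (simp add: S_def)
  qed
  obtain c2 where c2: "0 < c2" "\<And>z h \<epsilon> x. ball z R \<subseteq> \<Omega> \<Longrightarrow> 0 < h \<Longrightarrow> t0 + h < T \<Longrightarrow> 0 \<le> \<epsilon> \<Longrightarrow>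
    (\<And>y. y \<in> ball z (R / 2) \<Longrightarrow> \<epsilon> \<le> u y (t0 / 2 + h) - u y (t0 / 2)) \<Longrightarrow> x \<in> ball z R \<Longrightarrow>
    c2 * \<epsilon> * (R\<^sup>2 - (norm (x - z))\<^sup>2) powr k \<le> u x (t0 + h) - u x t0"
    using increment_grow[of "R / 2" R k "t0 / 2" t0] R k t0 by auto
  obtain K where K: "0 \<le> K" "\<And>(z::'a) x ta t. ta \<le> t \<Longrightarrow> 0 < bump K k (R\<^sup>2) 0 ta z x t \<Longrightarrow>
    \<exists>d L. (bump K k (R\<^sup>2) 0 ta z x has_real_derivative d) (at t) \<and>
      has_lap (\<lambda>y. bump K k (R\<^sup>2) 0 ta z y t) x L \<and> d \<le> L"
    using bump_heat_subsolution[OF k, of "R\<^sup>2" 0] R by auto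
  define h0 where "h0 = min h1 ((T - t0) / 2)"
  have h0: "0 < h0" "h0 \<le> h1" "t0 + h0 < T" using 1 t0 by (auto simp: h0_def min_def field_simps)
  obtain m where m: "0 < m" "\<And>x s. x \<in> closure \<Omega> \<Longrightarrow> 0 \<le> s \<Longrightarrow> s \<le> t0 + h0 \<Longrightarrow> m \<le> 1 - u x s"
    using gap[OF h0(3)] by blast
  \<comment> \<open>At \<open>t0\<close> the excess \<open>Y powr q - V powr q\<close> is at least
    \<open>V powr p * (Y - V)\<close>, hence at least
    \<open>m powr p * c2 * c1 * h * D y powr k\<close>. The surplus factor
    \<open>D y powr (k * p)\<close> in the power of the bump is bounded by
    \<open>(R\<^sup>2) powr (k * p)\<close>.\<close>
  define c3 where "c3 = m powr p * c2 * c1 / (R\<^sup>2) powr (k * p)"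
  have c3: "0 < c3" using m c2 1 R by (simp add: c3_def)
  define c where "c = (c3 / 2) powr (1 / q) * exp (- K * T)"
  have c: "0 < c" using c3 by (simp add: c_def)
  have "c * (R\<^sup>2 - (norm (x - z))\<^sup>2) powr k * (T - t) powr (1 / q) \<le> 1 - u x t"
    if z: "ball z R \<subseteq> \<Omega>" and x: "x \<in> ball z R" and t: "t0 \<le> t" "t < T" for z x t
  proof -
    define D where "D = (\<lambda>y. R\<^sup>2 - (norm (y - z))\<^sup>2)"
    have D: "0 < D y" "D y \<le> R\<^sup>2" if "y \<in> ball z R" for y
    proof -
      have "norm (y - z) < R" using that by (simp add: dist_norm norm_minus_commute)
      then have "(norm (y - z))\<^sup>2 < R\<^sup>2" by (intro power_strict_mono) auto
      then show "0 < D y" "D y \<le> R\<^sup>2" by (auto simp: D_def)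
    qed
    have b: "bump K k (R\<^sup>2) 0 t0 z y s = exp (- K * (s - t0)) * D y powr k" if "y \<in> ball z R" for y s
      using D[OF that] by (simp add: bump_def D_def)
    have xc: "x \<in> closure \<Omega>" using x z dom_subset by blast
    have init: "pair_norm p (1 - u y (t0 + h)) ((c3 * h) powr (1 / q) * bump K k (R\<^sup>2) 0 t0 z y t0) \<le> 1 - u y t0"
      if h: "0 < h" "h \<le> h0" and y: "y \<in> ball z R" for h y
    proof -
      have yc: "y \<in> closure \<Omega>" using y z dom_subset by blast
      define V where "V = 1 - u y (t0 + h)"
      define Y where "Y = 1 - u y t0"
      have V: "m \<le> V" using m(2)[OF yc, of "t0 + h"] h t0 by (auto simp: V_def)
      have "c2 * (c1 * h) * D y powr k \<le> u y (t0 + h) - u y t0"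
        unfolding D_def by (rule c2(2)[OF z h(1) _ _ _ y]) (use h h0 1 half z in auto)
      then have inc: "c2 * c1 * h * D y powr k \<le> Y - V" by (simp add: V_def Y_def mult.assoc)
      have "0 \<le> c2 * c1 * h * D y powr k" using c2 1 h by simp
      with inc have VY: "V \<le> Y" by simp
      have Vp: "0 < V" "0 < Y" using V VY m(1) by auto
      have "((c3 * h) powr (1 / q) * D y powr k) powr q = c3 * h * (D y powr k) powr q"
        using c3 h q by (simp add: powr_mult powr_powr)
      also have "(D y powr k) powr q = D y powr k * D y powr (k * p)"
        unfolding powr_powr powr_add[symmetric] q_def by (simp add: algebra_simps)
      also have "c3 * h * (D y powr k * D y powr (k * p)) \<le> c3 * h * (D y powr k * (R\<^sup>2) powr (k * p))"
        using D[OF y] c3 h k p_pos by (intro mult_left_mono powr_mono2) auto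
      also have "\<dots> = m powr p * (c2 * c1 * h * D y powr k)"
        using R by (simp add: c3_def)
      also have "\<dots> \<le> m powr p * (Y - V)" using inc by (intro mult_left_mono) auto
      also have "\<dots> \<le> V powr p * (Y - V)" using V m VY p_pos by (intro mult_right_mono powr_mono2) auto
      also have "\<dots> = V powr p * Y - V powr q" using Vp by (simp add: q_def powr_add algebra_simps)
      also have "\<dots> \<le> Y powr q - V powr q"
        using powr_mono2[of p V Y] VY Vp p_pos by (simp add: q_def powr_add)
      finally have "V powr q + ((c3 * h) powr (1 / q) * D y powr k) powr q \<le> Y powr q" by simp
      then show ?thesis unfolding b[OF y] using pair_norm_le_iff[OF p_pos, of Y] Vp by (simp add: V_def Y_def q_def)
    qed
    have step: "(1 - u x (s + h)) powr q + h * (c3 * (exp (- K * T) * D x powr k) powr q) \<le> (1 - u x s) powr q"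
      if h: "0 < h" "h \<le> h0" and s: "t0 \<le> s" "s + h < T" for h s
    proof -
      have "pair_norm p (1 - u x (s + h)) ((c3 * h) powr (1 / q) * bump K k (R\<^sup>2) 0 t0 z x s) \<le> 1 - u x s"
        by (rule type_I_step[of z R k t0 h s, OF z R _ t0(1) h(1) s(2) _ K(2) init[OF h] x s(1)]) (use k in auto)
      moreover have "0 \<le> 1 - u x s" using u_lt_1[OF xc, of s] s h t0 by auto
      ultimately have "(1 - u x (s + h)) powr q + ((c3 * h) powr (1 / q) * (exp (- K * (s - t0)) * D x powr k)) powr q
          \<le> (1 - u x s) powr q"
        using pair_norm_le_iff[OF p_pos] unfolding b[OF x] by (simp add: q_def)
      moreover have "((c3 * h) powr (1 / q) * (exp (- K * (s - t0)) * D x powr k)) powr q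
          = h * (c3 * (exp (- K * (s - t0)) * D x powr k) powr q)"
        using c3 h q by (simp add: powr_mult powr_powr)
      moreover have "h * (c3 * (exp (- K * T) * D x powr k) powr q) \<le> h * (c3 * (exp (- K * (s - t0)) * D x powr k) powr q)"
      proof (intro mult_left_mono powr_mono2 mult_right_mono)
        show "exp (- K * T) \<le> exp (- K * (s - t0))"
          using K(1) s t0 h by (simp add: mult_left_mono)
      qed (use h c3 q in auto)
      ultimately show ?thesis by linarith
    qed
    define a where "a = c3 * (exp (- K * T) * D x powr k) powr q"
    \<comment> \<open>The steps stop at the midpoint of \<open>t\<close> and \<open>T\<close>, where
      \<open>u\<close> is still defined; the factor 2 lost here is the one in
      \<open>c3 / 2\<close>.\<close>
    define t2 where "t2 = (T + t) / 2"
    have t2: "t < t2" "t2 < T" using t by (auto simp: t2_def)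
    obtain N :: nat where N: "(t2 - t) / h0 < real N" using reals_Archimedean2 by blast
    then have N0: "0 < real N" using t2 h0 by (meson divide_pos_pos diff_gt_0_iff_gt less_trans)
    define h where "h = (t2 - t) / real N"
    have h: "0 < h" "h \<le> h0" using N N0 t2 h0 by (auto simp: h_def field_simps)
    have hN: "t + real N * h = t2" using N0 by (simp add: h_def)
    have "(1 - u x (t + real j * h)) powr q + real j * h * a \<le> (1 - u x t) powr q" if "j \<le> N" for j
      using that
    proof (induction j)
      case (Suc j)
      have e: "t + real j * h + h = t + real (Suc j) * h" by (simp add: algebra_simps)
      have "real (Suc j) * h \<le> real N * h" using Suc.prems h by (intro mult_right_mono) auto
      then have "t + real j * h + h < T" using hN t2 unfolding e by linarith
      moreover have "0 \<le> real j * h" using h by simp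
      then have "t0 \<le> t + real j * h" using t by linarith
      ultimately have "(1 - u x (t + real (Suc j) * h)) powr q + h * a \<le> (1 - u x (t + real j * h)) powr q"
        using step[OF h, of "t + real j * h"] unfolding e a_def by simp
      moreover have "(1 - u x (t + real j * h)) powr q + real j * h * a \<le> (1 - u x t) powr q"
        using Suc by simp
      ultimately show ?case by (simp add: algebra_simps)
    qed simp
    from this[of N] have "real N * h * a \<le> (1 - u x t) powr q"
      using powr_ge_zero[of "1 - u x (t + real N * h)" q] by linarith
    moreover have "real N * h = (T - t) / 2" using hN by (simp add: t2_def field_simps)
    ultimately have "(T - t) / 2 * a \<le> (1 - u x t) powr q" by simp
    then have "((T - t) / 2 * a) powr (1 / q) \<le> ((1 - u x t) powr q) powr (1 / q)"
      using t c3 q by (intro powr_mono2) (auto simp: a_def)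
    also have "\<dots> = 1 - u x t" using u_lt_1[OF xc, of t] t t0 q by (simp add: powr_powr)
    also have "(T - t) / 2 * a = (c3 / 2) * (T - t) * (exp (- K * T) * D x powr k) powr q"
      by (simp add: a_def)
    also have "\<dots> powr (1 / q) = c * D x powr k * (T - t) powr (1 / q)"
    proof -
      have root: "(a * b * X powr q) powr (1 / q) = a powr (1 / q) * b powr (1 / q) * X"
        if "0 \<le> a" "0 \<le> b" "0 \<le> X" for a b X :: real
        using that q by (simp add: powr_mult powr_powr)
      show ?thesis using root[of "c3 / 2" "T - t" "exp (- K * T) * D x powr k"] c3 t
        by (simp add: c_def mult_ac)
    qed
    finally show ?thesis by (simp add: D_def)
  qed
  with c that show ?thesis unfolding q_def by blast
qed

section \<open>Barrier at a boundary point\<close>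

text \<open>The depth of \<open>y\<close> in its interior ball is at least \<open>c * h y\<close>,
  so the rate bound, raised to the power \<open>- p\<close>, can be written in terms of
  \<open>h\<close>.\<close>

lemma reaction_upper_bound:
  assumes nz: "\<exists>x\<in>closure \<Omega>. f x \<noteq> 0" and k: "1 < k" and Rc: "0 < R" "0 < c"
    and pos: "\<And>y. y \<in> N \<Longrightarrow> 0 < h y"
    and ball: "\<And>y. y \<in> N \<Longrightarrow> \<exists>z. ball z R \<subseteq> \<Omega> \<and> y \<in> ball z R \<and> c * h y \<le> R\<^sup>2 - (norm (y - z))\<^sup>2"
  obtains A where "0 < A" "\<And>y t. y \<in> N \<Longrightarrow> T / 2 \<le> t \<Longrightarrow> t < T \<Longrightarrow>
    (1 - u y t) powr (- p) \<le> A * h y powr (- (k * p)) * (T - t) powr (- (p / (p + 1)))"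
proof -
  obtain c0 where c0: "0 < c0" "\<And>z x t. ball z R \<subseteq> \<Omega> \<Longrightarrow> x \<in> ball z R \<Longrightarrow> T / 2 \<le> t \<Longrightarrow> t < T \<Longrightarrow>
    c0 * (R\<^sup>2 - (norm (x - z))\<^sup>2) powr k * (T - t) powr (1 / (p + 1)) \<le> 1 - u x t"
    by (rule type_I_lower_bound[OF nz k Rc(1), of "T / 2"]) (use T_pos in auto)
  define A where "A = (c0 * c powr k) powr (- p)"
  have "(1 - u y t) powr (- p) \<le> A * h y powr (- (k * p)) * (T - t) powr (- (p / (p + 1)))"
    if y: "y \<in> N" and t: "T / 2 \<le> t" "t < T" for y t
  proof -
    obtain z where z: "ball z R \<subseteq> \<Omega>" "y \<in> ball z R" "c * h y \<le> R\<^sup>2 - (norm (y - z))\<^sup>2"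
      using ball[OF y] by blast
    have hy: "0 < h y" by (rule pos[OF y])
    have "(c * h y) powr k \<le> (R\<^sup>2 - (norm (y - z))\<^sup>2) powr k"
      using z(3) Rc hy k by (intro powr_mono2) auto
    then have "c0 * (c * h y) powr k * (T - t) powr (1 / (p + 1)) \<le>
        c0 * (R\<^sup>2 - (norm (y - z))\<^sup>2) powr k * (T - t) powr (1 / (p + 1))"
      using c0 by (intro mult_right_mono mult_left_mono) auto
    also have "\<dots> \<le> 1 - u y t" by (rule c0(2)[OF z(1,2) t])
    finally have "(1 - u y t) powr (- p) \<le> (c0 * (c * h y) powr k * (T - t) powr (1 / (p + 1))) powr (- p)"
      using c0 Rc hy t p_pos by (intro powr_mono2') auto
    also have "\<dots> = A * h y powr (- (k * p)) * (T - t) powr (- (p / (p + 1)))"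
      using c0 Rc hy t by (simp add: A_def powr_mult powr_powr)
    finally show ?thesis .
  qed
  moreover have "0 < A" using c0 Rc by (simp add: A_def)
  ultimately show ?thesis using that by blast
qed

lemma source_bound:
  assumes nz: "\<exists>x\<in>closure \<Omega>. f x \<noteq> 0" and r: "0 < r" and Rc: "0 < R" "0 < c"
    and h0: "isCont h x0" "h x0 = 0"
    and pos: "\<And>y. y \<in> \<Omega> \<Longrightarrow> y \<in> ball x0 r \<Longrightarrow> 0 < h y"
    and infd: "\<And>y. y \<in> \<Omega> \<Longrightarrow> y \<in> ball x0 r \<Longrightarrow> infdist y (frontier \<Omega>) \<le> h y"
    and ball: "\<And>y. y \<in> \<Omega> \<Longrightarrow> y \<in> ball x0 r \<Longrightarrow>
      \<exists>z. ball z R \<subseteq> \<Omega> \<and> y \<in> ball z R \<and> c * h y \<le> R\<^sup>2 - (norm (y - z))\<^sup>2"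
    and cond: "p < 1 \<or> (\<forall>\<theta>>0. \<exists>\<eta>>0. \<forall>x\<in>\<Omega>. infdist x (frontier \<Omega>) < \<eta> \<longrightarrow>
        f x \<le> \<theta> * infdist x (frontier \<Omega>) powr (p + 1))"
  obtains \<mu> \<sigma> C \<rho> where "0 < \<mu>" "\<mu> < 1" "0 < \<sigma>" "\<sigma> < 1" "0 < C" "0 < \<rho>" "\<rho> \<le> r"
    "\<And>y t. y \<in> \<Omega> \<Longrightarrow> y \<in> ball x0 \<rho> \<Longrightarrow> T / 2 \<le> t \<Longrightarrow> t < T \<Longrightarrow>
      f y * (1 - u y t) powr (- p) \<le> C * (h y powr (\<mu> - 2) + (T - t) powr (- \<sigma>))"
proof -
  define b where "b = p / (p + 1)"
  have b: "0 < b" "b < 1" using p_pos by (auto simp: b_def)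
  define N where "N = \<Omega> \<inter> ball x0 r"
  have posN: "0 < h y" if "y \<in> N" for y using pos that by (simp add: N_def)
  have ballN: "\<exists>z. ball z R \<subseteq> \<Omega> \<and> y \<in> ball z R \<and> c * h y \<le> R\<^sup>2 - (norm (y - z))\<^sup>2" if "y \<in> N" for y
    using ball that by (simp add: N_def)
  from cond show ?thesis
  proof
    assume p1: "p < 1"
    have b2: "b < 1 / 2" using p1 p_pos by (simp add: b_def field_simps)
    obtain A where A: "0 < A" "\<And>y t. y \<in> N \<Longrightarrow> T / 2 \<le> t \<Longrightarrow> t < T \<Longrightarrow>
      (1 - u y t) powr (- p) \<le> A * h y powr (- (1 / p * p)) * (T - t) powr (- (p / (p + 1)))"
      by (rule reaction_upper_bound[OF nz _ Rc posN ballN, of "1 / p"]) (use p1 p_pos in auto)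
    obtain F where F: "0 < F" "\<And>x. x \<in> closure \<Omega> \<Longrightarrow> f x \<le> F" using f_bounded by blast
    \<comment> \<open>The midpoint of \<open>1 / 2\<close> and \<open>1 - b\<close>, an interval
      that is nonempty because \<open>p < 1\<close>. As the weight in Young's inequality, \<kappa>
      must exceed \<open>1 / 2\<close> for \<open>\<mu> = 2 - 1 / \<kappa>\<close> to be positive
      and stay below \<open>1 - b\<close> for \<open>\<sigma> = b / (1 - \<kappa>)\<close> to be
      less than 1.\<close>
    define \<kappa> where "\<kappa> = 3 / 4 - b / 2"
    have lam: "1 / 2 < \<kappa>" "\<kappa> < 1" using b b2 by (auto simp: \<kappa>_def)
    define \<sigma> where "\<sigma> = b / (1 - \<kappa>)"
    have \<sigma>: "0 < \<sigma>" "\<sigma> < 1" "\<sigma> * (1 - \<kappa>) = b" using b b2 lam by (auto simp: \<sigma>_def \<kappa>_def field_simps)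
    define \<mu> where "\<mu> = 2 - 1 / \<kappa>"
    have \<mu>: "0 < \<mu>" "\<mu> < 1" "(\<mu> - 2) * \<kappa> = - 1" using lam by (auto simp: \<mu>_def field_simps)
    have "f y * (1 - u y t) powr (- p) \<le> F * A * (h y powr (\<mu> - 2) + (T - t) powr (- \<sigma>))"
      if y: "y \<in> \<Omega>" "y \<in> ball x0 r" and t: "T / 2 \<le> t" "t < T" for y t
    proof -
      have yN: "y \<in> N" using y by (simp add: N_def)
      define X where "X = h y powr (\<mu> - 2)"
      define Y where "Y = (T - t) powr (- \<sigma>)"
      have XY: "0 < X" "0 < Y" using posN[OF yN] t by (auto simp: X_def Y_def)
      have "h y powr (- (1 / p * p)) * (T - t) powr (- (p / (p + 1))) = X powr \<kappa> * Y powr (1 - \<kappa>)"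
      proof -
        have "X powr \<kappa> = h y powr (- 1)" unfolding X_def powr_powr \<mu>(3) ..
        moreover have "Y powr (1 - \<kappa>) = (T - t) powr (- b)" unfolding Y_def powr_powr using \<sigma>(3) by simp
        ultimately show ?thesis using p_pos by (simp add: b_def)
      qed
      also have "\<dots> \<le> \<kappa> * X + (1 - \<kappa>) * Y" using lam XY by (intro Youngs_inequality_0) auto
      also have "\<dots> \<le> 1 * X + 1 * Y" using lam XY by (intro add_mono mult_right_mono) auto
      finally have 1: "A * (h y powr (- (1 / p * p)) * (T - t) powr (- (p / (p + 1)))) \<le> A * (X + Y)"
        using A(1) by (intro mult_left_mono) auto
      have "f y * (1 - u y t) powr (- p) \<le> F * (A * (X + Y))"
        using A(2)[OF yN t] 1 F(2)[OF dom_subset[OF y(1)]] F(1) f_nonneg[OF dom_subset[OF y(1)]]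
        by (intro mult_mono) (auto simp: mult.assoc)
      then show ?thesis by (simp add: X_def Y_def mult.assoc)
    qed
    then show ?thesis using that[OF \<mu>(1,2) \<sigma>(1,2) _ r order_refl, of "F * A"] F(1) A(1) by simp
  next
    assume "\<forall>\<theta>>0. \<exists>\<eta>>0. \<forall>x\<in>\<Omega>. infdist x (frontier \<Omega>) < \<eta> \<longrightarrow>
        f x \<le> \<theta> * infdist x (frontier \<Omega>) powr (p + 1)"
    then obtain \<eta> where \<eta>: "\<eta> > 0" "\<And>x. x \<in> \<Omega> \<Longrightarrow> infdist x (frontier \<Omega>) < \<eta> \<Longrightarrow>
        f x \<le> 1 * infdist x (frontier \<Omega>) powr (p + 1)"
      using zero_less_one by blast
    \<comment> \<open>Here \<open>k * p = p + 1\<close>, the power that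
      \<open>f y \<le> h y powr (p + 1)\<close> cancels. What is left depends on time alone, so the
      value 1/2 for \<mu> below is an arbitrary choice.\<close>
    obtain A where A: "0 < A" "\<And>y t. y \<in> N \<Longrightarrow> T / 2 \<le> t \<Longrightarrow> t < T \<Longrightarrow>
      (1 - u y t) powr (- p) \<le> A * h y powr (- ((1 + 1 / p) * p)) * (T - t) powr (- (p / (p + 1)))"
      by (rule reaction_upper_bound[OF nz _ Rc posN ballN, of "1 + 1 / p"]) (use p_pos in auto)
    have "\<forall>\<^sub>F y in nhds x0. h y < \<eta>"
      using h0 \<eta> by (intro isCont_eventually_less) auto
    then obtain d where d: "d > 0" "\<And>y. dist y x0 < d \<Longrightarrow> h y < \<eta>" unfolding eventually_nhds_metric by blast
    define \<rho> where "\<rho> = min d r"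
    have \<rho>: "0 < \<rho>" "\<rho> \<le> d" "\<rho> \<le> r" using d r by (auto simp: \<rho>_def)
    have "f y * (1 - u y t) powr (- p) \<le> A * (h y powr (1 / 2 - 2) + (T - t) powr (- b))"
      if y: "y \<in> \<Omega>" "y \<in> ball x0 \<rho>" and t: "T / 2 \<le> t" "t < T" for y t
    proof -
      have yr: "y \<in> ball x0 r" using y(2) \<rho> by auto
      then have yN: "y \<in> N" using y by (simp add: N_def)
      have hy: "0 < h y" by (rule posN[OF yN])
      have "h y < \<eta>" using d(2)[of y] y(2) \<rho> by (auto simp: dist_commute)
      then have "f y \<le> infdist y (frontier \<Omega>) powr (p + 1)"
        using \<eta>(2)[OF y(1)] infd[OF y(1) yr] by auto
      also have "\<dots> \<le> h y powr (p + 1)" using infd[OF y(1) yr] p_pos by (intro powr_mono2) (auto simp: infdist_nonneg)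
      finally have fy: "f y \<le> h y powr (p + 1)" .
      have e: "(1 + 1 / p) * p = p + 1" using p_pos by (simp add: field_simps)
      have "f y * (1 - u y t) powr (- p) \<le> h y powr (p + 1) * (A * h y powr (- (p + 1)) * (T - t) powr (- b))"
        using A(2)[OF yN t] fy f_nonneg[OF dom_subset[OF y(1)]] unfolding e b_def by (intro mult_mono) auto
      also have "\<dots> = (h y powr (p + 1) * h y powr (- (p + 1))) * (A * (T - t) powr (- b))" by (simp only: mult_ac)
      also have "h y powr (p + 1) * h y powr (- (p + 1)) = 1"
        using hy by (simp add: powr_add[symmetric] del: powr_minus)
      also have "1 * (A * (T - t) powr (- b)) \<le> A * (h y powr (1 / 2 - 2) + (T - t) powr (- b))"
        using A(1) by simp
      finally show ?thesis .
    qed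
    then show ?thesis using that[of "1 / 2" b A \<rho>] b A(1) \<rho> by simp
  qed
qed

text \<open>The barrier is \<open>1 / 4 + A * h powr \<mu> + B * (norm (y - x0))\<^sup>2 + \<tau> a
  t\<close>. The constant covers the values at \<open>t1\<close>; the quadratic term reaches 1,
  hence exceeds \<open>u\<close>, on the sphere; \<tau> integrates the part singular in time. The
  Laplacian of \<open>h powr \<mu>\<close> is at most a negative multiple of
  \<open>h powr (\<mu> - 2)\<close> and pays for the rest.\<close>

lemma boundary_barrier:
  assumes x0: "x0 \<in> frontier \<Omega>" and r: "0 < r" and M: "0 < M" and h0: "h x0 = 0"
    and mem: "\<And>x. x \<in> ball x0 r \<Longrightarrow> x \<in> \<Omega> \<longleftrightarrow> 0 < h x"
    and dh: "\<And>x. (h has_derivative (\<lambda>v. N x \<bullet> v)) (at x)" and dN: "\<And>x. (N has_derivative H x) (at x)"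
    and H: "\<And>x v. x \<in> ball x0 r \<Longrightarrow> norm (H x v) \<le> M * norm v" and N1: "\<And>x. 1 \<le> norm (N x)"
    and \<mu>: "0 < \<mu>" "\<mu> < 1" and \<sigma>: "0 < \<sigma>" "\<sigma> < 1" and C: "0 < C"
    and src: "\<And>y t. y \<in> \<Omega> \<Longrightarrow> y \<in> ball x0 r \<Longrightarrow> T / 2 \<le> t \<Longrightarrow> t < T \<Longrightarrow>
      f y * (1 - u y t) powr (- p) \<le> C * (h y powr (\<mu> - 2) + (T - t) powr (- \<sigma>))"
  obtains \<rho> t1 where "0 < \<rho>" "t1 < T"
    "\<And>y t. y \<in> closure \<Omega> \<Longrightarrow> dist y x0 < \<rho> \<Longrightarrow> t1 \<le> t \<Longrightarrow> t < T \<Longrightarrow> u y t \<le> 3 / 4"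
proof -
  define n where "n = real DIM('a)"
  have x0c: "x0 \<in> closure \<Omega>" using x0 by (simp add: frontier_def)
  have hcont: "isCont h x" for x by (rule has_derivative_continuous[OF dh])
  have hcontS: "continuous_on S h" for S by (intro continuous_at_imp_continuous_on ballI hcont)
  \<comment> \<open>The antiderivative of \<open>C * (T - t) powr (- \<sigma>)\<close> that vanishes
    at \<open>T - a\<close>; it stays bounded up to \<open>T\<close> because
    \<open>\<sigma> < 1\<close>.\<close>
  define \<tau> where "\<tau> = (\<lambda>a t. C / (1 - \<sigma>) * (a powr (1 - \<sigma>) - (T - t) powr (1 - \<sigma>)))"
  \<comment> \<open>Small enough that \<tau> gains at most 1/4 between \<open>T - a\<close> and
    \<open>T\<close>.\<close>
  define a where "a = min (T / 2) (((1 - \<sigma>) / (4 * C)) powr (1 / (1 - \<sigma>)))"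
  have a: "0 < a" "a \<le> T / 2" using T_pos \<sigma> C by (auto simp: a_def)
  have a4: "C / (1 - \<sigma>) * a powr (1 - \<sigma>) \<le> 1 / 4"
  proof -
    have "a powr (1 - \<sigma>) \<le> (((1 - \<sigma>) / (4 * C)) powr (1 / (1 - \<sigma>))) powr (1 - \<sigma>)"
      using a \<sigma> by (intro powr_mono2) (auto simp: a_def)
    also have "\<dots> = (1 - \<sigma>) / (4 * C)" using \<sigma> C by (simp add: powr_powr)
    finally have "C / (1 - \<sigma>) * a powr (1 - \<sigma>) \<le> C / (1 - \<sigma>) * ((1 - \<sigma>) / (4 * C))"
      using \<sigma> C by (intro mult_left_mono) auto
    also have "\<dots> = 1 / 4" using \<sigma> C by simp
    finally show ?thesis .
  qed
  define t1 where "t1 = T - a"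
  have t1: "T / 2 \<le> t1" "0 < t1" "t1 < T" using a T_pos by (auto simp: t1_def)
  have \<tau>_bounds: "0 \<le> \<tau> a t" "\<tau> a t \<le> 1 / 4" if "t1 \<le> t" "t < T" for t
  proof -
    have "(T - t) powr (1 - \<sigma>) \<le> a powr (1 - \<sigma>)" using that \<sigma> by (intro powr_mono2) (auto simp: t1_def)
    then show "0 \<le> \<tau> a t" using \<sigma> C by (simp add: \<tau>_def)
    have "\<tau> a t \<le> C / (1 - \<sigma>) * a powr (1 - \<sigma>)" unfolding \<tau>_def using \<sigma> C by (intro mult_left_mono) auto
    then show "\<tau> a t \<le> 1 / 4" using a4 by (rule order_trans)
  qed
  have d\<tau>: "(\<tau> a has_real_derivative C * (T - t) powr (- \<sigma>)) (at t)" if "t < T" for t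
  proof -
    have "((\<lambda>t. T - t) has_real_derivative - 1) (at t)" by (auto intro!: derivative_eq_intros)
    from DERIV_fun_powr[OF this, of "1 - \<sigma>"] that
    have "((\<lambda>t. (T - t) powr (1 - \<sigma>)) has_real_derivative (1 - \<sigma>) * (T - t) powr (- \<sigma>) * - 1) (at t)" by simp
    from DERIV_cmult[OF DERIV_diff[OF DERIV_const this], of "C / (1 - \<sigma>)" "a powr (1 - \<sigma>)"]
    show ?thesis unfolding \<tau>_def by (rule DERIV_cong) (use \<sigma> in simp)
  qed
  \<comment> \<open>The time \<open>t1\<close> is fixed before the radius: continuity at this one
    time gives a neighbourhood of \<open>x0\<close> in which \<open>u\<close> is below 1/4.\<close>
  have "u x0 t1 = 0" using u_frontier[OF x0, of t1] t1 by simp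
  have "continuous_on (closure \<Omega>) (\<lambda>y. (\<lambda>(x,t). u x t) (y, t1))"
    by (rule continuous_on_compose2[OF u_cont]) (use t1 in \<open>auto intro!: continuous_intros\<close>)
  then have "continuous_on (closure \<Omega>) (\<lambda>y. u y t1)" by simp
  then obtain d1 where d1: "d1 > 0" "\<And>y. y \<in> closure \<Omega> \<Longrightarrow> dist y x0 < d1 \<Longrightarrow> dist (u y t1) (u x0 t1) < 1 / 4"
    unfolding continuous_on_iff using x0c by (metis zero_less_divide_1_iff zero_less_numeral)
  \<comment> \<open>\<open>h < \<epsilon>\<close> keeps the second derivatives of \<open>h\<close>
    from using up more than half of the gain
    \<open>\<mu> * (1 - \<mu>) * h powr (\<mu> - 2)\<close>; \<open>h < 1\<close> makes that power
    of \<open>h\<close> at least 1, so it also dominates constants.\<close>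
  define \<epsilon> where "\<epsilon> = min 1 ((1 - \<mu>) / (2 * n * M))"
  have n: "1 \<le> n" by (simp add: n_def Suc_leI)
  have \<epsilon>: "0 < \<epsilon>" "\<epsilon> \<le> 1" "\<epsilon> \<le> (1 - \<mu>) / (2 * n * M)" using \<mu> M n by (auto simp: \<epsilon>_def)
  have "\<forall>\<^sub>F y in nhds x0. h y < \<epsilon>"
    using hcont h0 \<epsilon> by (intro isCont_eventually_less) auto
  then obtain d2 where d2: "d2 > 0" "\<And>y. dist y x0 < d2 \<Longrightarrow> h y < \<epsilon>" unfolding eventually_nhds_metric by blast
  define \<rho> where "\<rho> = min (min d1 d2) r / 2"
  have \<rho>: "0 < \<rho>" "\<rho> < d1" "\<rho> < d2" "\<rho> < r" using d1 d2 r by (auto simp: \<rho>_def)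
  define B where "B = 1 / \<rho>\<^sup>2"
  have B: "0 < B" using \<rho> by (simp add: B_def)
  \<comment> \<open>The remaining half of the gain must pay for
    \<open>C * h powr (\<mu> - 2)\<close> and for \<open>2 * n * B\<close>, the Laplacian of the
    quadratic term.\<close>
  define A where "A = 2 * (C + 2 * n * B) / (\<mu> * (1 - \<mu>))"
  have A: "0 < A" using \<mu> C B n by (simp add: A_def add_pos_pos)
  have A2: "A * (\<mu> * (1 - \<mu>) / 2) = C + 2 * n * B" using \<mu> by (simp add: A_def)
  \<comment> \<open>The truncation by \<open>max 0\<close> makes \<psi> continuous on the whole
    space; in the domain near \<open>x0\<close>, where \<open>h > 0\<close>, it changes
    nothing.\<close>
  define \<psi> where "\<psi> = (\<lambda>y. 1 / 4 + A * (max 0 (h y)) powr \<mu> + B * (norm (y - x0))\<^sup>2)"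
  have \<psi>0: "1 / 4 \<le> \<psi> y" for y using A B by (simp add: \<psi>_def)
  have \<psi>cont: "continuous_on S \<psi>" for S
    unfolding \<psi>_def using \<mu> by (intro continuous_intros continuous_on_powr' hcontS) auto
  define S where "S = closure \<Omega> \<inter> cball x0 \<rho>"
  have comp: "compact S" unfolding S_def by (intro compact_Int_closed compact_closure_dom closed_cball)
  have lap_h: "\<exists>L. has_lap (\<lambda>y. max 0 (h y) powr \<mu>) y L \<and> C * h y powr (\<mu> - 2) + 2 * n * B \<le> - A * L"
    if y: "y \<in> \<Omega>" "y \<in> ball x0 \<rho>" for y
  proof -
    have yr: "y \<in> ball x0 r" using y(2) \<rho> by auto
    have hy: "0 < h y" using mem[OF yr] y(1) by simp
    have hy\<epsilon>: "h y < \<epsilon>" using d2(2)[of y] y(2) \<rho> by (auto simp: dist_commute)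
    define L where "L = (\<Sum>b\<in>Basis. \<mu> * (\<mu> - 1) * h y powr (\<mu> - 2) * (N y \<bullet> b)\<^sup>2 + \<mu> * h y powr (\<mu> - 1) * (H y b \<bullet> b))"
    have line: "((\<lambda>s. h (y + s *\<^sub>R b)) has_real_derivative N (y + s *\<^sub>R b) \<bullet> b) (at s)" for s b
    proof -
      have "((\<lambda>s. y + s *\<^sub>R b) has_derivative (\<lambda>r. r *\<^sub>R b)) (at s)" by (auto intro!: derivative_eq_intros)
      from has_derivative_compose[OF this dh]
      show ?thesis by (rule has_derivative_imp_has_field_derivative) simp
    qed
    have line2: "((\<lambda>s. N (y + s *\<^sub>R b) \<bullet> b) has_real_derivative H y b \<bullet> b) (at 0)" for b
    proof -
      have "((\<lambda>s. y + s *\<^sub>R b) has_derivative (\<lambda>r. r *\<^sub>R b)) (at 0)" by (auto intro!: derivative_eq_intros)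
      moreover have "(N has_derivative H y) (at (y + 0 *\<^sub>R b))" using dN[of y] by simp
      ultimately have "((\<lambda>s. N (y + s *\<^sub>R b)) has_derivative (\<lambda>r. H y (r *\<^sub>R b))) (at 0)"
        by (rule has_derivative_compose)
      then have "((\<lambda>s. N (y + s *\<^sub>R b) \<bullet> b) has_derivative (\<lambda>r. H y (r *\<^sub>R b) \<bullet> b)) (at 0)"
        by (rule has_derivative_inner_left)
      moreover have "linear (H y)" using dN has_derivative_linear by blast
      ultimately show ?thesis
        by (elim has_derivative_imp_has_field_derivative) (simp add: linear_scale)
    qed
    have "has_lap (\<lambda>y. h y powr \<mu>) y L"
      unfolding has_lap_def
    proof (intro exI conjI ballI)
      show "has_d2 (\<lambda>y. h y powr \<mu>) y b
        (\<mu> * (\<mu> - 1) * h y powr (\<mu> - 2) * (N y \<bullet> b)\<^sup>2 + \<mu> * h y powr (\<mu> - 1) * (H y b \<bullet> b))" for b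
        using has_d2_powr[OF always_eventually[OF allI, OF line] line2 hy, of \<mu> b] by simp
    qed (rule L_def)
    moreover have "\<forall>\<^sub>F w in nhds y. h w powr \<mu> = max 0 (h w) powr \<mu>"
    proof -
      have "\<forall>\<^sub>F w in nhds y. 0 < h w"
        using hcont hy by (rule isCont_eventually_greater)
      then show ?thesis by eventually_elim simp
    qed
    ultimately have lap: "has_lap (\<lambda>y. max 0 (h y) powr \<mu>) y L" by (rule has_lap_cong)
    have "1 \<le> (norm (N y))\<^sup>2" using N1[of y] by (simp add: one_le_power)
    also have NN: "(norm (N y))\<^sup>2 = (\<Sum>b\<in>Basis. (N y \<bullet> b)\<^sup>2)"
      unfolding power2_norm_eq_inner by (subst euclidean_inner) (simp add: power2_eq_square)
    finally have N1': "1 \<le> (\<Sum>b\<in>Basis. (N y \<bullet> b)\<^sup>2)" .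
    have "(\<Sum>b\<in>Basis. H y b \<bullet> b) \<le> (\<Sum>b\<in>(Basis::'a set). M)"
    proof (rule sum_mono)
      fix b :: 'a assume b: "b \<in> Basis"
      have "H y b \<bullet> b \<le> norm (H y b) * norm b" by (rule norm_cauchy_schwarz)
      also have "\<dots> \<le> M" using H[OF yr, of b] b by simp
      finally show "H y b \<bullet> b \<le> M" .
    qed
    then have HM: "(\<Sum>b\<in>Basis. H y b \<bullet> b) \<le> n * M" by (simp add: n_def)
    define X where "X = h y powr (\<mu> - 2)"
    have X1: "1 \<le> X"
      using powr_mono2'[of "\<mu> - 2" "h y" 1] hy hy\<epsilon> \<epsilon> \<mu> by (simp add: X_def)
    have hX: "h y powr (\<mu> - 1) = h y * X"
      using hy by (simp add: X_def powr_diff powr_numeral power2_eq_square)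
    have "L = - \<mu> * (1 - \<mu>) * X * (\<Sum>b\<in>Basis. (N y \<bullet> b)\<^sup>2) + \<mu> * (h y * X) * (\<Sum>b\<in>Basis. H y b \<bullet> b)"
      unfolding L_def hX sum.distrib sum_distrib_left[symmetric] X_def by (simp add: algebra_simps)
    also have "\<dots> \<le> - \<mu> * (1 - \<mu>) * X * 1 + \<mu> * (h y * X) * (n * M)"
    proof (rule add_mono)
      show "- \<mu> * (1 - \<mu>) * X * (\<Sum>b\<in>Basis. (N y \<bullet> b)\<^sup>2) \<le> - \<mu> * (1 - \<mu>) * X * 1"
        using \<mu> X1 by (intro mult_left_mono_neg[OF N1']) (simp add: mult_nonneg_nonneg)
      show "\<mu> * (h y * X) * (\<Sum>b\<in>Basis. H y b \<bullet> b) \<le> \<mu> * (h y * X) * (n * M)"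
        using \<mu> X1 hy by (intro mult_left_mono[OF HM]) simp
    qed
    also have "\<dots> = \<mu> * X * (h y * (n * M)) - \<mu> * (1 - \<mu>) * X" by (simp add: algebra_simps)
    also have "\<dots> \<le> \<mu> * X * ((1 - \<mu>) / 2) - \<mu> * (1 - \<mu>) * X"
    proof (intro diff_right_mono mult_left_mono)
      have "h y \<le> (1 - \<mu>) / (2 * n * M)" using hy\<epsilon> \<epsilon> by simp
      then show "h y * (n * M) \<le> (1 - \<mu>) / 2" using n M by (simp add: field_simps)
    qed (use \<mu> X1 in auto)
    also have "\<dots> = - (\<mu> * (1 - \<mu>) / 2) * X" by (simp add: field_simps)
    finally have "A * L \<le> A * (- (\<mu> * (1 - \<mu>) / 2) * X)" using A by (intro mult_left_mono) auto
    also have "\<dots> = - (A * (\<mu> * (1 - \<mu>) / 2)) * X" by simp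
    also have "\<dots> = - (C + 2 * n * B) * X" unfolding A2 ..
    finally have "(C + 2 * n * B) * X \<le> - A * L" by (simp add: algebra_simps)
    moreover have "2 * n * B * 1 \<le> 2 * n * B * X" using X1 n B by (intro mult_left_mono) auto
    ultimately have "C * X + 2 * n * B \<le> - A * L" by (simp add: algebra_simps)
    then show ?thesis using lap unfolding X_def by blast
  qed
  have main: "u y t \<le> \<psi> y + \<tau> a t" if y: "y \<in> S" and t: "t1 \<le> t" "t < T" for y t
  proof -
    have "u y t - (\<psi> y + \<tau> a t) \<le> 0"
    proof (rule parabolic_max_principle_smooth[OF comp, of t1 t "\<lambda>y t. u y t - (\<psi> y + \<tau> a t)" 0])
      have "continuous_on (S \<times> {t1..t}) (\<lambda>(x,t). u x (t + 0))"
        using t t1 by (intro u_cont_shift) (auto simp: S_def)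
      then have c1: "continuous_on (S \<times> {t1..t}) (\<lambda>w. u (fst w) (snd w))" by (simp add: case_prod_beta)
      have c2: "continuous_on (S \<times> {t1..t}) (\<lambda>w. \<psi> (fst w))"
        by (rule continuous_on_compose2[OF \<psi>cont[of UNIV]]) (auto intro!: continuous_intros)
      have "continuous_on {t1..t} (\<tau> a)"
      proof (intro continuous_at_imp_continuous_on ballI)
        fix s assume "s \<in> {t1..t}"
        then have "s < T" using t by auto
        then show "isCont (\<tau> a) s" by (rule DERIV_isCont[OF d\<tau>])
      qed
      then have c3: "continuous_on (S \<times> {t1..t}) (\<lambda>w. \<tau> a (snd w))"
        by (rule continuous_on_compose2) (auto intro!: continuous_intros)
      show "continuous_on (S \<times> {t1..t}) (\<lambda>(y, t). u y t - (\<psi> y + \<tau> a t))"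
        unfolding case_prod_beta by (rule continuous_on_diff[OF c1 continuous_on_add[OF c2 c3]])
    next
      fix y s assume y: "y \<in> S" "t1 \<le> s" "s \<le> t" "0 < u y s - (\<psi> y + \<tau> a s)"
      have s: "s < T" "0 < s" "T / 2 \<le> s" using y t t1 by auto
      have yc: "y \<in> closure \<Omega>" and y\<rho>: "dist y x0 \<le> \<rho>" using y by (auto simp: S_def dist_commute)
      have u\<psi>: "\<psi> y < u y s" using y \<tau>_bounds[of s] s by simp
      have yO: "y \<in> \<Omega>"
        using closure_cases[OF yc] u_frontier[of y s] u\<psi> \<psi>0[of y] s by auto
      have yb: "y \<in> ball x0 \<rho>"
      proof (rule ccontr)
        assume "y \<notin> ball x0 \<rho>"
        then have "norm (y - x0) = \<rho>" using y\<rho> by (simp add: dist_norm norm_minus_commute)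
        then have "B * (norm (y - x0))\<^sup>2 = 1" using \<rho> by (simp add: B_def)
        moreover have "0 \<le> A * max 0 (h y) powr \<mu>" using A by simp
        ultimately have "1 \<le> \<psi> y" unfolding \<psi>_def by linarith
        then show False using u\<psi> u_lt_1[OF yc, of s] s by simp
      qed
      have st: "t1 < s"
      proof (rule ccontr)
        assume "\<not> t1 < s"
        then have "s = t1" using y by simp
        then have "dist (u y s) (u x0 t1) < 1 / 4" using d1(2)[OF yc] y\<rho> \<rho> by simp
        then show False using \<open>u x0 t1 = 0\<close> u\<psi> \<psi>0[of y] by (simp add: dist_real_def)
      qed
      obtain L where L: "has_lap (\<lambda>y. u y s) y L"
        "(u y has_real_derivative (L + f y * (1 - u y s) powr (- p))) (at s)"
        using u_pde[OF yO s(2,1)] by blast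
      obtain Lh where Lh: "has_lap (\<lambda>y. max 0 (h y) powr \<mu>) y Lh" "C * h y powr (\<mu> - 2) + 2 * n * B \<le> - A * Lh"
        using lap_h[OF yO yb] by blast
      define d where "d = (L + f y * (1 - u y s) powr (- p)) - (0 + C * (T - s) powr (- \<sigma>))"
      define D where "D = L - ((0 + A * Lh + B * (2 * n)) + 0)"
      have "has_lap \<psi> y (0 + A * Lh + B * (2 * n))"
        unfolding \<psi>_def n_def by (intro has_lap_add has_lap_const has_lap_cmult Lh has_lap_norm_sq)
      then have lap: "has_lap (\<lambda>y. u y s - (\<psi> y + \<tau> a s)) y D"
        unfolding D_def by (intro has_lap_diff has_lap_add has_lap_const L)
      have der: "((\<lambda>s. u y s - (\<psi> y + \<tau> a s)) has_real_derivative d) (at s)"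
        unfolding d_def by (intro DERIV_diff DERIV_add DERIV_const L d\<tau> s)
      have "y \<in> ball x0 r" using yb \<rho> by auto
      from src[OF yO this s(3,1)] Lh(2) have sub: "d - D \<le> 0"
        by (simp add: d_def D_def algebra_simps)
      have yi: "y \<in> interior S"
        using yb interior_closure[OF yO] by (simp add: S_def)
      show "t1 < s \<and> y \<in> interior S \<and>
        (\<exists>d D. ((\<lambda>t. u y t - (\<psi> y + \<tau> a t)) has_real_derivative d) (at s) \<and>
          has_lap (\<lambda>y. u y s - (\<psi> y + \<tau> a s)) y D \<and> d - D \<le> 0 * (u y s - (\<psi> y + \<tau> a s)))"
        unfolding mult_zero_left by (intro conjI exI[of _ d] exI[of _ D] st yi der lap sub)
    qed (use y t in auto)
    then show ?thesis by simp
  qed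
  have "isCont \<psi> x0" using \<psi>cont[of UNIV] by (simp add: continuous_on_eq_continuous_at)
  moreover have "\<psi> x0 = 1 / 4" using h0 \<mu> by (simp add: \<psi>_def)
  ultimately have "\<forall>\<^sub>F y in nhds x0. \<psi> y < 1 / 2"
    by (intro isCont_eventually_less) auto
  then obtain d3 where d3: "d3 > 0" "\<And>y. dist y x0 < d3 \<Longrightarrow> \<psi> y < 1 / 2" unfolding eventually_nhds_metric by blast
  have "u y t \<le> 3 / 4" if "y \<in> closure \<Omega>" "dist y x0 < min \<rho> d3" "t1 \<le> t" "t < T" for y t
  proof -
    have "y \<in> S" using that by (simp add: S_def dist_commute)
    from main[OF this that(3,4)] d3(2)[of y] \<tau>_bounds[of t] that show ?thesis by simp
  qed
  moreover have "0 < min \<rho> d3" using \<rho> d3 by simp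
  ultimately show ?thesis using that t1 by blast
qed

end

section \<open>Exclusion of quenching points on the boundary\<close>

theorem theorem3:
  fixes \<Omega> :: "(real ^ 'n) set"
    and f :: "real ^ 'n \<Rightarrow> real"
    and u :: "real ^ 'n \<Rightarrow> real \<Rightarrow> real"
    and p \<nu> \<alpha> :: real
    and T :: ereal
  defines "\<delta> \<equiv> (\<lambda>x. infdist x (frontier \<Omega>))"
  assumes "0 < \<nu>" "\<nu> \<le> 1" "bounded_C2_holder_domain \<nu> \<Omega>"
    and "0 < p"
    and "\<forall>x\<in>closure \<Omega>. 0 \<le> f x"
    and "0 < \<alpha>" "\<alpha> \<le> 1" "holder_on \<alpha> (closure \<Omega>) f"
    and "\<exists>x\<in>closure \<Omega>. f x \<noteq> 0"
    and "maximal_classical_solution \<Omega> f p T u"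
    and "T < \<infinity>"
    and "p < 1 \<or>
         (\<forall>\<theta>>0. \<exists>\<eta>>0. \<forall>x\<in>\<Omega>. \<delta> x < \<eta> \<longrightarrow> f x \<le> \<theta> * \<delta> x powr (p + 1))"
  shows "quenching_set \<Omega> T u \<subseteq> \<Omega>"
proof
  fix x0 assume q: "x0 \<in> quenching_set \<Omega> T u"
  have sol: "classical_solution \<Omega> f p T u"
    using assms(11) by (simp add: maximal_classical_solution_def)
  then have "0 < T" by (simp add: classical_solution_def)
  then obtain T' where T': "T = ereal T'" using assms(12) by (cases T) auto
  have fcont: "continuous_on (closure \<Omega>) f"
  proof -
    obtain C where C: "\<And>x y. x \<in> closure \<Omega> \<Longrightarrow> y \<in> closure \<Omega> \<Longrightarrow> \<bar>f x - f y\<bar> \<le> C * dist x y powr \<alpha>"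
      using assms(9) by (auto simp: holder_on_def)
    show ?thesis
      unfolding continuous_on_def
    proof
      fix x assume x: "x \<in> closure \<Omega>"
      have "((\<lambda>y. C * dist y x powr \<alpha>) \<longlongrightarrow> C * dist x x powr \<alpha>) (at x within closure \<Omega>)"
        by (intro tendsto_intros tendsto_powr') (use assms(7) in auto)
      then have "((\<lambda>y. C * dist y x powr \<alpha>) \<longlongrightarrow> 0) (at x within closure \<Omega>)" by simp
      moreover have "\<forall>\<^sub>F y in at x within closure \<Omega>. norm (f y - f x) \<le> C * dist y x powr \<alpha>"
        unfolding eventually_at_filter using C x by (intro always_eventually) auto
      ultimately have "((\<lambda>y. f y - f x) \<longlongrightarrow> 0) (at x within closure \<Omega>)" by (rule Lim_null_comparison[rotated])
      then show "(f \<longlongrightarrow> f x) (at x within closure \<Omega>)" by (simp add: LIM_zero_iff)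
    qed
  qed
  interpret quenching_solution \<Omega> f p T' u
    by unfold_locales (use assms fcont sol T' in \<open>auto simp: bounded_C2_holder_domain_def\<close>)
  show "x0 \<in> \<Omega>"
  proof (rule ccontr)
    assume "x0 \<notin> \<Omega>"
    moreover have "x0 \<in> closure \<Omega>" using q by (simp add: quenching_set_def)
    ultimately have x0: "x0 \<in> frontier \<Omega>" using closure_cases by blast
    obtain r R M c h N H where rR: "0 < r" "0 < R" "0 < M" "0 < c" and h0: "h x0 = 0"
      and mem: "\<And>x. x \<in> ball x0 r \<Longrightarrow> x \<in> \<Omega> \<longleftrightarrow> 0 < h x"
      and dh: "\<And>x. (h has_derivative (\<lambda>v. N x \<bullet> v)) (at x)" and dN: "\<And>x. (N has_derivative H x) (at x)"
      and H: "\<And>x v. x \<in> ball x0 r \<Longrightarrow> norm (H x v) \<le> M * norm v" and N1: "\<And>x. 1 \<le> norm (N x)"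
      and infd: "\<And>y. y \<in> \<Omega> \<Longrightarrow> y \<in> ball x0 r \<Longrightarrow> infdist y (frontier \<Omega>) \<le> h y"
      and ball: "\<And>y. y \<in> \<Omega> \<Longrightarrow> y \<in> ball x0 r \<Longrightarrow>
        \<exists>z. ball z R \<subseteq> \<Omega> \<and> y \<in> ball z R \<and> c * h y \<le> R\<^sup>2 - (norm (y - z))\<^sup>2"
      by (rule C2_domain_boundary[OF assms(4,2) x0]) blast
    have pos: "0 < h y" if "y \<in> \<Omega>" "y \<in> ball x0 r" for y using mem that by simp
    obtain \<mu> \<sigma> C \<rho> where ms: "0 < \<mu>" "\<mu> < 1" "0 < \<sigma>" "\<sigma> < 1" "0 < C" and \<rho>: "0 < \<rho>" "\<rho> \<le> r"
      and src: "\<And>y t. y \<in> \<Omega> \<Longrightarrow> y \<in> ball x0 \<rho> \<Longrightarrow> T' / 2 \<le> t \<Longrightarrow> t < T' \<Longrightarrow>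
        f y * (1 - u y t) powr (- p) \<le> C * (h y powr (\<mu> - 2) + (T' - t) powr (- \<sigma>))"
    proof (rule source_bound[OF assms(10) rR(1,2,4) has_derivative_continuous[OF dh] h0 pos infd ball assms(13)[unfolded \<delta>_def]])
      fix \<mu> \<sigma> C \<rho>
      assume a: "0 < \<mu>" "\<mu> < 1" "0 < \<sigma>" "\<sigma> < 1" "0 < C" "0 < \<rho>" "\<rho> \<le> r"
        "\<And>y t. y \<in> \<Omega> \<Longrightarrow> y \<in> ball x0 \<rho> \<Longrightarrow> T' / 2 \<le> t \<Longrightarrow> t < T' \<Longrightarrow>
          f y * (1 - u y t) powr (- p) \<le> C * (h y powr (\<mu> - 2) + (T' - t) powr (- \<sigma>))"
      show thesis by (rule that[OF a])
    qed
    have sub: "y \<in> ball x0 r" if "y \<in> ball x0 \<rho>" for y using that \<rho> by auto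
    obtain \<rho>' t1 where b: "0 < \<rho>'" "t1 < T'"
      "\<And>y t. y \<in> closure \<Omega> \<Longrightarrow> dist y x0 < \<rho>' \<Longrightarrow> t1 \<le> t \<Longrightarrow> t < T' \<Longrightarrow> u y t \<le> 3 / 4"
    proof (rule boundary_barrier[OF x0 \<rho>(1) rR(3) h0 mem[OF sub] dh dN H[OF sub] N1 ms src])
      fix \<rho>' t1
      assume a: "0 < \<rho>'" "t1 < T'"
        "\<And>y t. y \<in> closure \<Omega> \<Longrightarrow> dist y x0 < \<rho>' \<Longrightarrow> t1 \<le> t \<Longrightarrow> t < T' \<Longrightarrow> u y t \<le> 3 / 4"
      show thesis by (rule that[OF a])
    qed
    from q obtain x t where xt: "\<And>k::nat. x k \<in> closure \<Omega> \<and> 0 < t k \<and> ereal (t k) < T"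
      "x \<longlonglongrightarrow> x0" "(\<lambda>k. ereal (t k)) \<longlonglongrightarrow> T" "(\<lambda>k. u (x k) (t k)) \<longlonglongrightarrow> 1"
      unfolding quenching_set_def by blast
    \<comment> \<open>Near \<open>x0\<close> and close to the final time the barrier keeps
      \<open>u\<close> at most 3/4, whereas along a quenching sequence its values tend to 1.\<close>
    have "\<forall>\<^sub>F k in sequentially. dist (x k) x0 < \<rho>'" using tendstoD[OF xt(2) b(1)] .
    moreover have "\<forall>\<^sub>F k in sequentially. ereal t1 < ereal (t k)"
      using order_tendstoD(1)[OF xt(3), of "ereal t1"] b(2) T' by simp
    moreover have "\<forall>\<^sub>F k in sequentially. 3 / 4 < u (x k) (t k)"
      using order_tendstoD(1)[OF xt(4), of "3 / 4"] by simp
    ultimately have "\<forall>\<^sub>F k in sequentially. False"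
    proof eventually_elim
      case (elim k)
      then show ?case using b(3)[of "x k" "t k"] xt(1)[of k] T' by auto
    qed
    then show False by simp
  qed
qed

end
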